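(* Let $n\ge 2$, $k \geq 2$ and $1 \leq \ell \leq \lfloor n/2 \rfloor$ be integers. Then the multiplicity $mult_{k\Lambda_0}(k\Lambda_0 - \gamma_\ell)$ of the weight $k\Lambda_0-\gamma_\ell$ in the irreducible highest weight $\widehat{sl}(n)$-module $V(k\Lambda_0)$ is equal to the number of $(k+1)k\cdots21$-avoiding permutations of $\{1,2,\ldots,\ell\}$.
   Context: $\mathfrak g=\widehat{sl}(n)=sl(n)\otimes\mathbb C[t,t^{-1}]\oplus\mathbb C c\oplus\mathbb C d$ is the affine Kac-Moody Lie algebra, where $sl(n)$ is the Lie algebra of trace zero $n\times n$ complex matrices, $c$ is the canonical central element and $d=1\otimes t\frac{d}{dt}$ is the degree derivation. Its generalized Cartan matrix $A=(a_{ij})_{0\le i,j\le n-1}$ is, for $n\ge 3$, given by $a_{ii}=2$, $a_{ij}=-1$ if $|i-j|=1$, $a_{0,n-1}=a_{n-1,0}=-1$, and $a_{ij}=0$ otherwise; for $n=2$, $a_{00}=a_{11}=2$ and $a_{01}=a_{10}=-2$. The Cartan subalgebra is $\mathfrak h=\mathrm{span}_{\mathbb C}\{h_0,h_1,\ldots,h_{n-1},d\}$, with simple coroots $h_0,\ldots,h_{n-1}$ and simple roots $\alpha_0,\ldots,\alpha_{n-1}\in\mathfrak h^*$, where $\alpha_j(h_i)=a_{ij}$. The fundamental weights $\Lambda_0,\ldots,\Lambda_{n-1}\in\mathfrak h^*$ are defined by $\Lambda_i(h_j)=\delta_{ij}$, $\Lambda_i(d)=0$. For a dominant integral weight $\Lambda$,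 $V(\Lambda)$ is the irreducible highest weight $\mathfrak g$-module of highest weight $\Lambda$; for $\mu\in\mathfrak h^*$, $mult_\Lambda(\mu)=\dim V(\Lambda)_\mu$, where $V(\Lambda)_\mu=\{v\in V(\Lambda)\mid h(v)=\mu(h)v\ \forall h\in\mathfrak h\}$. For $1\le\ell\le\lfloor n/2\rfloor$, $$\gamma_\ell=\ell\alpha_0+\sum_{i=1}^{\ell-1}(\ell-i)\alpha_i+\sum_{i=1}^{\ell-1}(\ell-i)\alpha_{n-i}.$$ A permutation of $\{1,\ldots,\ell\}$ is written as a sequence $w=w_1w_2\cdots w_\ell$ with $i\mapsto w_i$. It is $(k+1)k\cdots21$-avoiding if it has no decreasing subsequence of length $k+1$ (subsequences need not be consecutive). *)

theory Defs
  imports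
    Complex_Main
    "HOL-Library.Poly_Mapping"
    "HOL-Library.Sublist"
    "HOL-Combinatorics.Multiset_Permutations"
begin

section \<open>The affine Lie algebra\<close>

text \<open>
  The loop algebra \<open>sl(n) \<otimes> C[t,t\<inverse>]\<close> is realised as the trace-zero \<open>n \<times> n\<close> matrices with
  entries in \<open>C[t,t\<inverse>]\<close>, so \<open>x \<otimes> t\<^sup>p\<close> is the matrix \<open>t\<^sup>p x\<close>. A Laurent polynomial is a finitely
  supported coefficient function on the integers, multiplied by convolution. Matrices are indexed
  by \<open>{0..<n}\<close> (not \<open>{1..n}\<close>) and are zero outside this range.
\<close>

type_synonym laurent = "int \<Rightarrow>\<^sub>0 complex"

definition tmonom :: "complex \<Rightarrow> int \<Rightarrow> laurent" where
  "tmonom a p = Poly_Mapping.single p a"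

text \<open>The derivation \<open>t d/dt\<close>.\<close>

definition euler :: "laurent \<Rightarrow> laurent" where
  "euler f = Abs_poly_mapping (\<lambda>p. of_int p * Poly_Mapping.lookup f p)"

lemma lookup_euler [simp]: "Poly_Mapping.lookup (euler f) p = of_int p * Poly_Mapping.lookup f p"
proof -
  have "finite {p. of_int p * Poly_Mapping.lookup f p \<noteq> 0}"
    by (rule finite_subset [OF _ finite_lookup [of f]]) auto
  then show ?thesis by (simp add: euler_def)
qed

text \<open>\<open>Affine A a b\<close> stands for \<open>A + a c + b d\<close>.\<close>

datatype affine =
  Affine (loop_part: "nat \<Rightarrow> nat \<Rightarrow> laurent") (c_part: complex) (d_part: complex)

instantiation affine :: ab_group_add
begin

definition zero_affine :: affine where
  "0 = Affine (\<lambda>i j. 0) 0 0"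

definition plus_affine :: "affine \<Rightarrow> affine \<Rightarrow> affine" where
  "x + y = Affine (\<lambda>i j. loop_part x i j + loop_part y i j)
    (c_part x + c_part y) (d_part x + d_part y)"

definition uminus_affine :: "affine \<Rightarrow> affine" where
  "- x = Affine (\<lambda>i j. - loop_part x i j) (- c_part x) (- d_part x)"

definition minus_affine :: "affine \<Rightarrow> affine \<Rightarrow> affine" where
  "x - y = Affine (\<lambda>i j. loop_part x i j - loop_part y i j)
    (c_part x - c_part y) (d_part x - d_part y)"

instance
  by standard (simp_all add: zero_affine_def plus_affine_def uminus_affine_def minus_affine_def
      algebra_simps affine.expand)

end

definition ascale :: "complex \<Rightarrow> affine \<Rightarrow> affine" where
  "ascale a x = Affine (\<lambda>i j. tmonom a 0 * loop_part x i j) (a * c_part x) (a * d_part x)"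

lemma tmonom_0_1: "tmonom 1 0 = 1"
  by (simp add: tmonom_def)

lemma tmonom_0_mult: "tmonom (a * b) 0 = tmonom a 0 * tmonom b 0"
  by (simp add: tmonom_def mult_single)

lemma tmonom_0_add: "tmonom (a + b) 0 = tmonom a 0 + tmonom b 0"
  by (simp add: tmonom_def single_add)

lemma vector_space_ascale: "vector_space ascale"
  by standard (simp_all add: ascale_def plus_affine_def tmonom_0_mult tmonom_0_add tmonom_0_1 algebra_simps
      affine.expand)

definition affine_sl :: "nat \<Rightarrow> affine set" where
  "affine_sl n = {x. (\<forall>i j. \<not> (i < n \<and> j < n) \<longrightarrow> loop_part x i j = 0) \<and>
     (\<Sum>i<n. loop_part x i i) = 0}"

definition mat_prod ::
  "nat \<Rightarrow> (nat \<Rightarrow> nat \<Rightarrow> laurent) \<Rightarrow> (nat \<Rightarrow> nat \<Rightarrow> laurent) \<Rightarrow> nat \<Rightarrow> nat \<Rightarrow> laurent" where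
  "mat_prod n A B = (\<lambda>i j. \<Sum>m<n. A i m * B m j)"

text \<open>
  On homogeneous elements the bracket below reads
  \<open>[x \<otimes> t\<^sup>p, y \<otimes> t\<^sup>q] = [x,y] \<otimes> t\<^sup>p\<^sup>+\<^sup>q + p \<delta>(p + q, 0) tr(x y) c\<close> and \<open>[d, x \<otimes> t\<^sup>p] = p x \<otimes> t\<^sup>p\<close>, with \<open>c\<close>
  central; the cocycle is the \<open>t\<^sup>0\<close>-coefficient of \<open>tr((t dA/dt) B)\<close>.
\<close>

definition bracket :: "nat \<Rightarrow> affine \<Rightarrow> affine \<Rightarrow> affine" where
  "bracket n x y = (let A = loop_part x; B = loop_part y in
     Affine
       (\<lambda>i j. mat_prod n A B i j - mat_prod n B A i j
          + tmonom (d_part x) 0 * euler (B i j) - tmonom (d_part y) 0 * euler (A i j))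
       (Poly_Mapping.lookup (\<Sum>i<n. mat_prod n (\<lambda>i j. euler (A i j)) B i i) 0)
       0)"

definition mat_unit :: "nat \<Rightarrow> nat \<Rightarrow> laurent \<Rightarrow> nat \<Rightarrow> nat \<Rightarrow> laurent" where
  "mat_unit r s f = (\<lambda>i j. if i = r \<and> j = s then f else 0)"

text \<open>
  With matrix rows and columns numbered from 0: \<open>e\<^sub>0 = E\<^sub>n\<^sub>-\<^sub>1\<^sub>,\<^sub>0 \<otimes> t\<close> and
  \<open>h\<^sub>0 = E\<^sub>n\<^sub>-\<^sub>1\<^sub>,\<^sub>n\<^sub>-\<^sub>1 - E\<^sub>0\<^sub>,\<^sub>0 + c\<close>; for \<open>1 \<le> i < n\<close>, \<open>e\<^sub>i = E\<^sub>i\<^sub>-\<^sub>1\<^sub>,\<^sub>i\<close> and \<open>h\<^sub>i = E\<^sub>i\<^sub>-\<^sub>1\<^sub>,\<^sub>i\<^sub>-\<^sub>1 - E\<^sub>i\<^sub>,\<^sub>i\<close>.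
\<close>

definition chevalley_e :: "nat \<Rightarrow> nat \<Rightarrow> affine" where
  "chevalley_e n i =
     (if i = 0 then Affine (mat_unit (n - 1) 0 (tmonom 1 1)) 0 0
      else Affine (mat_unit (i - 1) i 1) 0 0)"

definition coroot :: "nat \<Rightarrow> nat \<Rightarrow> affine" where
  "coroot n i =
     (if i = 0 then Affine (\<lambda>r s. mat_unit (n - 1) (n - 1) 1 r s - mat_unit 0 0 1 r s) 1 0
      else Affine (\<lambda>r s. mat_unit (i - 1) (i - 1) 1 r s - mat_unit i i 1 r s) 0 0)"

definition degree_derivation :: affine where
  "degree_derivation = Affine (\<lambda>i j. 0) 0 1"

definition cartan :: "nat \<Rightarrow> affine set" where
  "cartan n = module.span ascale (coroot n ` {..<n} \<union> {degree_derivation})"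

text \<open>\<open>n\<^sub>+\<close>, the Lie subalgebra generated by \<open>e\<^sub>0, \<dots>, e\<^sub>n\<^sub>-\<^sub>1\<close>.\<close>

inductive_set n_plus :: "nat \<Rightarrow> affine set" for n :: nat where
  zero: "0 \<in> n_plus n"
| generator: "i < n \<Longrightarrow> chevalley_e n i \<in> n_plus n"
| add: "x \<in> n_plus n \<Longrightarrow> y \<in> n_plus n \<Longrightarrow> x + y \<in> n_plus n"
| scale: "x \<in> n_plus n \<Longrightarrow> ascale a x \<in> n_plus n"
| bracket: "x \<in> n_plus n \<Longrightarrow> y \<in> n_plus n \<Longrightarrow> bracket n x y \<in> n_plus n"


section \<open>Weights\<close>

definition cartan_matrix :: "nat \<Rightarrow> nat \<Rightarrow> nat \<Rightarrow> int" where
  "cartan_matrix n i j =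
     (if i = j then 2
      else if n = 2 then - 2
      else if i = j + 1 \<or> j = i + 1 \<or> (i = 0 \<and> j = n - 1) \<or> (i = n - 1 \<and> j = 0) then - 1
      else 0)"

text \<open>Elements of \<open>h\<^sup>*\<close> are extended by 0 outside \<open>h\<close>, so that they are determined by their
  values on \<open>h\<close>.\<close>

definition cartan_dual :: "nat \<Rightarrow> (affine \<Rightarrow> complex) set" where
  "cartan_dual n = {\<phi>.
     (\<forall>x\<in>cartan n. \<forall>y\<in>cartan n. \<phi> (x + y) = \<phi> x + \<phi> y) \<and>
     (\<forall>a. \<forall>x\<in>cartan n. \<phi> (ascale a x) = a * \<phi> x) \<and>
     (\<forall>x. x \<notin> cartan n \<longrightarrow> \<phi> x = 0)}"

definition weight_with_values :: "nat \<Rightarrow> (nat \<Rightarrow> complex) \<Rightarrow> complex \<Rightarrow> affine \<Rightarrow> complex" where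
  "weight_with_values n u b =
     (THE \<phi>. \<phi> \<in> cartan_dual n \<and> (\<forall>i<n. \<phi> (coroot n i) = u i) \<and> \<phi> degree_derivation = b)"

lemma weight_with_values_ex1:
  assumes "2 \<le> n"
  shows "\<exists>!\<phi>. \<phi> \<in> cartan_dual n \<and> (\<forall>i<n. \<phi> (coroot n i) = u i) \<and> \<phi> degree_derivation = b"
proof (rule ex_ex1I)
  interpret A: vector_space ascale by (rule vector_space_ascale)
  define \<psi> where "\<psi> x =
    (\<Sum>j<n. u j * (c_part x + (\<Sum>i<j. Poly_Mapping.lookup (loop_part x i i) 0))) + b * d_part x" for x
  define \<phi> where "\<phi> x = (if x \<in> cartan n then \<psi> x else 0)" for x
  have lookup_scale: "Poly_Mapping.lookup (tmonom a 0 * f) 0 = a * Poly_Mapping.lookup f 0" for a f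
    by (simp add: tmonom_def Poly_Mapping.map.rep_eq when_def flip: mult_map_scale_conv_mult)
  have \<psi>_add: "\<psi> (x + y) = \<psi> x + \<psi> y" for x y
    by (simp add: \<psi>_def plus_affine_def lookup_add sum.distrib algebra_simps)
  have \<psi>_scale: "\<psi> (ascale a x) = a * \<psi> x" for a x
    by (simp add: \<psi>_def ascale_def lookup_scale sum_distrib_left algebra_simps)
  have mem: "i < n \<Longrightarrow> coroot n i \<in> cartan n" "degree_derivation \<in> cartan n" for i
    by (auto simp: cartan_def intro: A.span_base)
  have coord: "c_part (coroot n i) + (\<Sum>r<j. Poly_Mapping.lookup (loop_part (coroot n i) r r) 0)
      = (if j = i then 1 else 0)" if "i < n" "j < n" for i j
  proof (cases "i = 0")
    case True
    have "(\<Sum>r<j. Poly_Mapping.lookup (loop_part (coroot n i) r r) 0) = (\<Sum>r<j. if r = 0 then - 1 else 0)"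
      using that True by (intro sum.cong)
        (auto simp: coroot_def mat_unit_def lookup_minus lookup_one)
    then show ?thesis using that True by (auto simp: coroot_def)
  next
    case False
    have "(\<Sum>r<j. Poly_Mapping.lookup (loop_part (coroot n i) r r) 0)
        = (\<Sum>r<j. (if r = i - 1 then 1 else 0) - (if r = i then 1 else 0))"
      using that False by (intro sum.cong)
        (auto simp: coroot_def mat_unit_def lookup_minus lookup_one)
    also have "\<dots> = (if j = i then 1 else 0)"
      using False by (auto simp: sum_subtractf)
    finally show ?thesis using False by (simp add: coroot_def)
  qed
  have "\<psi> (coroot n i) = u i" if "i < n" for i
  proof -
    have "d_part (coroot n i) = 0" by (simp add: coroot_def)
    moreover have "(\<Sum>j<n. u j * (c_part (coroot n i) +
        (\<Sum>r<j. Poly_Mapping.lookup (loop_part (coroot n i) r r) 0))) = (\<Sum>j<n. if j = i then u j else 0)"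
      using that by (intro sum.cong) (auto simp: coord)
    ultimately show ?thesis using that by (simp add: \<psi>_def)
  qed
  moreover have "\<psi> degree_derivation = b"
    by (simp add: \<psi>_def degree_derivation_def)
  moreover have "\<phi> \<in> cartan_dual n"
    using A.span_add A.span_scale
    by (auto simp: cartan_dual_def \<phi>_def \<psi>_add \<psi>_scale cartan_def)
  ultimately show "\<exists>\<phi>. \<phi> \<in> cartan_dual n \<and> (\<forall>i<n. \<phi> (coroot n i) = u i) \<and> \<phi> degree_derivation = b"
    using mem by (intro exI [of _ \<phi>]) (auto simp: \<phi>_def)
next
  interpret A: vector_space ascale by (rule vector_space_ascale)
  fix \<phi> \<phi>'
  assume 1: "\<phi> \<in> cartan_dual n \<and> (\<forall>i<n. \<phi> (coroot n i) = u i) \<and> \<phi> degree_derivation = b"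
    and 2: "\<phi>' \<in> cartan_dual n \<and> (\<forall>i<n. \<phi>' (coroot n i) = u i) \<and> \<phi>' degree_derivation = b"
  have zero: "0 \<in> cartan n" by (simp add: cartan_def A.span_zero)
  have \<phi>0: "\<xi> 0 = 0" if "\<xi> \<in> cartan_dual n" for \<xi>
  proof -
    have "\<xi> (ascale 0 0) = 0 * \<xi> 0"
      using that zero unfolding cartan_dual_def by blast
    then show ?thesis by simp
  qed
  have "x \<in> cartan n \<and> \<phi> x = \<phi>' x" if "x \<in> cartan n" for x
    using that unfolding cartan_def
  proof (induction rule: A.span_induct_alt)
    case base
    have "\<phi> 0 = 0" "\<phi>' 0 = 0" using 1 2 \<phi>0 by blast+
    then show ?case by (simp add: A.span_zero)
  next
    case (step a x y)
    have x: "x \<in> cartan n" and y: "y \<in> cartan n"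
      using step unfolding cartan_def by (blast intro: A.span_base)+
    have sx: "ascale a x \<in> cartan n" and sxy: "ascale a x + y \<in> cartan n"
      using x y unfolding cartan_def by (blast intro: A.span_add A.span_scale)+
    have lin: "\<xi> (ascale a x + y) = a * \<xi> x + \<xi> y" if "\<xi> \<in> cartan_dual n" for \<xi>
    proof -
      have "\<xi> (ascale a x + y) = \<xi> (ascale a x) + \<xi> y" "\<xi> (ascale a x) = a * \<xi> x"
        using that x y sx unfolding cartan_dual_def by blast+
      then show ?thesis by (rule trans [OF _ arg_cong])
    qed
    have "\<phi> x = \<phi>' x"
    proof (cases "x = degree_derivation")
      case True
      have "\<phi> degree_derivation = b" "\<phi>' degree_derivation = b" using 1 2 by blast+
      then show ?thesis unfolding True by (rule trans [OF _ sym])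
    next
      case False
      then obtain i where i: "i < n" "x = coroot n i" using step by blast
      have "\<phi> (coroot n i) = u i" "\<phi>' (coroot n i) = u i" using 1 2 i(1) by blast+
      then show ?thesis unfolding i(2) by (rule trans [OF _ sym])
    qed
    moreover have "\<phi> y = \<phi>' y" using step by blast
    ultimately have "\<phi> (ascale a x + y) = \<phi>' (ascale a x + y)"
      using lin [of \<phi>] lin [of \<phi>'] 1 2 by metis
    then show ?case using sxy unfolding cartan_def by blast
  qed
  moreover have "\<phi> x = 0" "\<phi>' x = 0" if "x \<notin> cartan n" for x
    using 1 2 that unfolding cartan_dual_def by blast+
  ultimately show "\<phi> = \<phi>'"
    by (intro ext) metis
qed

definition fundamental_weight :: "nat \<Rightarrow> nat \<Rightarrow> affine \<Rightarrow> complex" where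
  "fundamental_weight n i = weight_with_values n (\<lambda>j. if j = i then 1 else 0) 0"

text \<open>The value \<open>\<alpha>\<^sub>j(d) = \<delta>(j, 0)\<close> is the one given by \<open>[d, e\<^sub>j] = \<alpha>\<^sub>j(d) e\<^sub>j\<close>.\<close>

definition simple_root :: "nat \<Rightarrow> nat \<Rightarrow> affine \<Rightarrow> complex" where
  "simple_root n j =
     weight_with_values n (\<lambda>i. of_int (cartan_matrix n i j)) (if j = 0 then 1 else 0)"

definition gamma_root :: "nat \<Rightarrow> nat \<Rightarrow> affine \<Rightarrow> complex" where
  "gamma_root n l = (\<lambda>h. of_nat l * simple_root n 0 h
     + (\<Sum>i = 1..<l. of_nat (l - i) * simple_root n i h)
     + (\<Sum>i = 1..<l. of_nat (l - i) * simple_root n (n - i) h))"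


section \<open>Modules\<close>

locale affine_module = vector_space scale
  for scale :: "complex \<Rightarrow> 'v::ab_group_add \<Rightarrow> 'v" +
  fixes n :: nat
    and act :: "affine \<Rightarrow> 'v \<Rightarrow> 'v"
  assumes act_add: "x \<in> affine_sl n \<Longrightarrow> y \<in> affine_sl n \<Longrightarrow> act (x + y) v = act x v + act y v"
    and act_scale: "x \<in> affine_sl n \<Longrightarrow> act (ascale a x) v = scale a (act x v)"
    and act_add_right: "x \<in> affine_sl n \<Longrightarrow> act x (v + w) = act x v + act x w"
    and act_scale_right: "x \<in> affine_sl n \<Longrightarrow> act x (scale a v) = scale a (act x v)"
    and act_bracket: "x \<in> affine_sl n \<Longrightarrow> y \<in> affine_sl n \<Longrightarrow>
      act (bracket n x y) v = act x (act y v) - act y (act x v)"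
begin

definition submodule :: "'v set \<Rightarrow> bool" where
  "submodule W \<longleftrightarrow> subspace W \<and> (\<forall>x\<in>affine_sl n. \<forall>w\<in>W. act x w \<in> W)"

definition irreducible_module :: bool where
  "irreducible_module \<longleftrightarrow>
     (\<exists>v::'v. v \<noteq> 0) \<and> (\<forall>W. submodule W \<longrightarrow> W = {0} \<or> W = UNIV)"

text \<open>That \<open>v\<close> generates the module is expressed by: every submodule containing \<open>v\<close> is everything.\<close>

definition highest_weight_module :: "(affine \<Rightarrow> complex) \<Rightarrow> bool" where
  "highest_weight_module \<Lambda> \<longleftrightarrow>
     (\<exists>v. v \<noteq> 0 \<and>
        (\<forall>x\<in>n_plus n. act x v = 0) \<and>
        (\<forall>h\<in>cartan n. act h v = scale (\<Lambda> h) v) \<and>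
        (\<forall>W. submodule W \<and> v \<in> W \<longrightarrow> W = UNIV))"

definition weight_space :: "(affine \<Rightarrow> complex) \<Rightarrow> 'v set" where
  "weight_space \<mu> = {v. \<forall>h\<in>cartan n. act h v = scale (\<mu> h) v}"

text \<open>As \<open>dim\<close> is 0 on infinite-dimensional spaces, a positive value here includes the
  finite-dimensionality of the weight space.\<close>

definition multiplicity :: "(affine \<Rightarrow> complex) \<Rightarrow> nat" where
  "multiplicity \<mu> = dim (weight_space \<mu>)"

end

text \<open>
  \<open>V(\<Lambda>)\<close> is determined up to isomorphism: the predicate says that the module carried by the type
  \<open>'v\<close> is (a copy of) the irreducible highest weight module of highest weight \<open>\<Lambda>\<close>.
\<close>

definition is_irreducible_highest_weight_module ::
  "nat \<Rightarrow> (affine \<Rightarrow> complex) \<Rightarrow> (complex \<Rightarrow> 'v::ab_group_add \<Rightarrow> 'v) \<Rightarrow> (affine \<Rightarrow> 'v \<Rightarrow> 'v) \<Rightarrow> bool"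
  where
  "is_irreducible_highest_weight_module n \<Lambda> scale act \<longleftrightarrow>
     affine_module scale n act \<and>
     affine_module.irreducible_module scale n act \<and>
     affine_module.highest_weight_module scale n act \<Lambda>"


section \<open>Pattern-avoiding permutations\<close>

text \<open>Permutations of \<open>{1..l}\<close> in one-line notation, without decreasing (not necessarily
  consecutive) subsequence of length \<open>k + 1\<close>.\<close>

definition avoiding_permutations :: "nat \<Rightarrow> nat \<Rightarrow> nat list set" where
  "avoiding_permutations k l =
     {w \<in> permutations_of_set {1..l}.
        \<not> (\<exists>s. subseq s w \<and> length s = k + 1 \<and> sorted_wrt (>) s)}"

end

theory Submission
  imports Defs
begin

text \<open>
  The coefficients of \<open>\<gamma>\<^sub>l\<close> are supported on the \<open>2l - 1\<close> nodes nearest to node 0 of the cyclic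
  Dynkin diagram. As \<open>2l \<le> n\<close>, these nodes form a path with node 0 in the middle, so the weight
  space only feels a copy of \<open>sl(2l)\<close>. The maximal parabolic subalgebra of \<open>sl(2l)\<close> that belongs to
  the middle node has an abelian nilradical, the space of \<open>l \<times> l\<close> matrices. Let \<open>y\<^sub>a\<^sub>b\<close> (\<open>ymul\<close>)
  be the root vectors of the opposite nilradical. They commute, and the root vectors of the Levi part
  \<open>sl(l) \<times> sl(l)\<close> annihilate the highest weight vector \<open>vac\<close> and act on the \<open>y\<^sub>a\<^sub>b\<close> by changing
  the row or the column index. So products of the \<open>y\<^sub>a\<^sub>b\<close> applied to \<open>vac\<close> span everything below
  \<open>vac\<close> that these nodes can reach, and by weights the weight space in question is spanned by
  the \<open>l!\<close> vectors \<open>Y\<^sub>s = (\<Prod>a. y\<^sub>a\<^sub>,\<^sub>s\<^sub>(\<^sub>a\<^sub>)) vac\<close>, one for each permutation \<open>s\<close>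
  (\<open>weight_space_span\<close>). What remains is to find the linear relations among them.

  Upper bound. Singular vectors of lower weight vanish by irreducibility; hence \<open>f\<^sub>0\<^sup>k\<^sup>+\<^sup>1 vac = 0\<close>
  (\<open>f0_power_zero\<close>), that is, \<open>y\<^sub>0\<^sub>0\<^sup>k\<^sup>+\<^sup>1 vac = 0\<close>. Polarizing with the Levi part
  shows that the permanent of every \<open>(k + 1) \<times> (k + 1)\<close> array of \<open>y\<^sub>a\<^sub>b\<close> annihilates \<open>vac\<close>
  (\<open>permanent_zero\<close>). If \<open>s\<close> decreases along \<open>k + 1\<close> positions, the permanent on these rows and
  their images writes \<open>Y\<^sub>s\<close> through lexicographically smaller permutations. Thus the
  \<open>Y\<^sub>s\<close> with \<open>s\<close> avoiding the pattern span (\<open>yprod_in_span_avoiders\<close>).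

  Lower bound. Applying to \<open>Y\<^sub>s\<close> the product of raising operators dual to \<open>Y\<^sub>t\<close> gives
  \<open>sign s sign t N(s,t) vac\<close>, where \<open>N(s,t)\<close> is the number of maps \<open>g\<close> from \<open>l\<close> points to \<open>k\<close>
  colours with \<open>g \<circ> s = g \<circ> t\<close> (\<open>raise_along_yprod_pairing\<close>). For \<open>s = t \<circ> p\<close> this is
  \<open>k\<close> to the number of cycles of \<open>p\<close>, the trace of \<open>p\<close> on the \<open>l\<close>-th tensor power of a
  \<open>k\<close>-dimensional space. So up to signs the Gram matrix is that of the 0-1 vectors
  \<open>e\<^sub>s = ([g \<circ> s = f])\<close>, indexed by pairs of colourings \<open>(f, g)\<close>, and it suffices that the \<open>e\<^sub>s\<close>
  with \<open>s\<close> avoiding are independent (\<open>gram_independent\<close>). This is a triangularity argument: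
  colour each position by the length of a longest decreasing subsequence ending there. An avoiding
  \<open>s\<close> needs only \<open>k\<close> colours and is increasing on each colour class, hence it is the
  lexicographically least permutation compatible with its colouring of positions and values
  (\<open>avoider_lex_least\<close>).
\<close>

section \<open>The bracket on matrix units\<close>

definition loop_unit :: "nat \<Rightarrow> nat \<Rightarrow> int \<Rightarrow> affine" where
  "loop_unit i j p = Affine (mat_unit i j (tmonom 1 p)) 0 0"

definition central :: affine where
  "central = Affine (\<lambda>i j. 0) 1 0"

lemma tmonom_mult: "tmonom a p * tmonom b q = tmonom (a * b) (p + q)"
  by (simp add: tmonom_def mult_single)

lemma euler_tmonom: "euler (tmonom a p) = tmonom (of_int p * a) p"
  by (rule poly_mapping_eqI) (auto simp: tmonom_def lookup_single when_def)

lemma euler_add: "euler (f + g) = euler f + euler g"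
  by (rule poly_mapping_eqI) (auto simp: lookup_add algebra_simps)

lemma euler_0: "euler 0 = 0"
  by (rule poly_mapping_eqI) auto

lemma bracket_add_left: "bracket n (x + y) z = bracket n x z + bracket n y z"
  by (simp add: bracket_def plus_affine_def Let_def mat_prod_def fun_eq_iff sum.distrib
      euler_add lookup_add tmonom_0_add algebra_simps)

lemma bracket_diff_left: "bracket n (x - y) z = bracket n x z - bracket n y z"
proof -
  have "bracket n x z = bracket n (x - y) z + bracket n y z"
    by (simp flip: bracket_add_left)
  then show ?thesis by simp
qed

lemma mat_prod_unit:
  assumes "j < n"
  shows "mat_prod n (mat_unit i j f) (mat_unit r s g) = (if j = r then mat_unit i s (f * g) else (\<lambda>_ _. 0))"
proof (intro ext)
  fix a b
  have "mat_prod n (mat_unit i j f) (mat_unit r s g) a b =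
    (\<Sum>m<n. if m = j then (if a = i \<and> j = r \<and> b = s then f * g else 0) else 0)"
    unfolding mat_prod_def mat_unit_def by (intro sum.cong) auto
  then show "mat_prod n (mat_unit i j f) (mat_unit r s g) a b =
      (if j = r then mat_unit i s (f * g) else (\<lambda>_ _. 0)) a b"
    using assms by (simp add: mat_unit_def)
qed

lemma trace_mat_unit: "i < n \<Longrightarrow> (\<Sum>r<n. mat_unit i j f r r) = (if i = j then f else 0)"
proof -
  assume i: "i < n"
  have "(\<Sum>r<n. mat_unit i j f r r) = (\<Sum>r<n. if r = i then (if i = j then f else 0) else 0)"
    by (intro sum.cong) (auto simp: mat_unit_def)
  then show ?thesis using i by simp
qed

lemma bracket_loop_unit:
  assumes "i < n" "j < n" "r < n" "s < n"
  shows "bracket n (loop_unit i j p) (loop_unit r s q) =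
    (if j = r then loop_unit i s (p + q) else 0) - (if s = i then loop_unit r j (p + q) else 0)
    + (if j = r \<and> s = i \<and> p + q = 0 then ascale (of_int p) central else 0)"
proof -
  have e: "(\<lambda>a b. euler (mat_unit i j (tmonom 1 p) a b)) = mat_unit i j (tmonom (of_int p) p)"
    by (auto simp: mat_unit_def fun_eq_iff euler_0 euler_tmonom)
  have "bracket n (loop_unit i j p) (loop_unit r s q) = Affine
     (\<lambda>a b. (if j = r then mat_unit i s (tmonom 1 (p + q)) else (\<lambda>_ _. 0)) a b
        - (if s = i then mat_unit r j (tmonom 1 (p + q)) else (\<lambda>_ _. 0)) a b)
     (if j = r \<and> s = i \<and> p + q = 0 then of_int p else 0) 0"
    unfolding bracket_def Let_def loop_unit_def affine.sel e
      mat_prod_unit[OF assms(2)] mat_prod_unit[OF assms(4)]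
    using trace_mat_unit[OF assms(1)]
    by (auto simp: tmonom_mult add.commute fun_eq_iff) (auto simp: tmonom_def lookup_of_int lookup_single)
  then show ?thesis
    by (auto simp: loop_unit_def central_def ascale_def plus_affine_def minus_affine_def
        zero_affine_def fun_eq_iff)
qed

lemma bracket_central: "bracket n central x = 0"
  by (simp add: bracket_def Let_def central_def mat_prod_def euler_0 zero_affine_def fun_eq_iff
     tmonom_def)

lemma bracket_degree: "bracket n degree_derivation (loop_unit i j p) = ascale (of_int p) (loop_unit i j p)"
  by (auto simp: bracket_def Let_def degree_derivation_def mat_prod_def zero_affine_def fun_eq_iff
     loop_unit_def ascale_def mat_unit_def euler_0 euler_tmonom tmonom_mult)

lemma loop_unit_mem [simp]: "i < n \<Longrightarrow> j < n \<Longrightarrow> i \<noteq> j \<Longrightarrow> loop_unit i j p \<in> affine_sl n"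
  by (auto simp: affine_sl_def loop_unit_def trace_mat_unit) (auto simp: mat_unit_def)

lemma loop_unit_diff_mem [simp]:
  "i < n \<Longrightarrow> j < n \<Longrightarrow> loop_unit i i p - loop_unit j j p \<in> affine_sl n"
  by (auto simp: affine_sl_def loop_unit_def minus_affine_def trace_mat_unit sum_subtractf) (auto simp: mat_unit_def)

lemma central_mem [simp]: "central \<in> affine_sl n"
  by (simp add: affine_sl_def central_def)

lemma degree_mem [simp]: "degree_derivation \<in> affine_sl n"
  by (simp add: affine_sl_def degree_derivation_def)

lemma affine_sl_add: "x \<in> affine_sl n \<Longrightarrow> y \<in> affine_sl n \<Longrightarrow> x + y \<in> affine_sl n"
  by (simp add: affine_sl_def plus_affine_def sum.distrib)

lemma affine_sl_scale: "x \<in> affine_sl n \<Longrightarrow> ascale a x \<in> affine_sl n"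
  by (simp add: affine_sl_def ascale_def flip: sum_distrib_left)

lemma affine_sl_zero: "0 \<in> affine_sl n"
  by (simp add: affine_sl_def zero_affine_def)

lemma chevalley_e_eq: "2 \<le> n \<Longrightarrow> chevalley_e n i = (if i = 0 then loop_unit (n - 1) 0 1 else loop_unit (i - 1) i 0)"
  by (simp add: chevalley_e_def loop_unit_def tmonom_0_1)

lemma coroot_eq: "coroot n i = (if i = 0 then loop_unit (n - 1) (n - 1) 0 - loop_unit 0 0 0 + central
   else loop_unit (i - 1) (i - 1) 0 - loop_unit i i 0)"
  by (simp add: coroot_def loop_unit_def tmonom_0_1 minus_affine_def plus_affine_def central_def)

definition chevalley_f :: "nat \<Rightarrow> nat \<Rightarrow> affine" where
  "chevalley_f n i = (if i = 0 then loop_unit 0 (n - 1) (- 1) else loop_unit i (i - 1) 0)"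

text \<open>
  A trace-zero matrix is the sum of its off-diagonal entries and of \<open>E\<^sub>i\<^sub>i f - E\<^sub>0\<^sub>0 f\<close>, where \<open>f\<close>
  runs through its diagonal entries; each Laurent polynomial \<open>f\<close> is a sum of monomials.
\<close>

lemma affine_sl_induct:
  assumes n: "2 \<le> n" and x: "x \<in> affine_sl n"
    and add: "\<And>x y. x \<in> affine_sl n \<Longrightarrow> y \<in> affine_sl n \<Longrightarrow> P x \<Longrightarrow> P y \<Longrightarrow> P (x + y)"
    and scale: "\<And>a x. x \<in> affine_sl n \<Longrightarrow> P x \<Longrightarrow> P (ascale a x)"
    and off: "\<And>i j p. i < n \<Longrightarrow> j < n \<Longrightarrow> i \<noteq> j \<Longrightarrow> P (loop_unit i j p)"
    and diag: "\<And>i p. 0 < i \<Longrightarrow> i < n \<Longrightarrow> P (loop_unit i i p - loop_unit 0 0 p)"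
    and c: "P central" and d: "P degree_derivation"
  shows "P x"
proof -
  define Q where "Q x \<longleftrightarrow> x \<in> affine_sl n \<and> P x" for x
  have Qadd: "Q x \<Longrightarrow> Q y \<Longrightarrow> Q (x + y)" for x y unfolding Q_def using add affine_sl_add by blast
  have Qscale: "Q x \<Longrightarrow> Q (ascale a x)" for x a unfolding Q_def using scale affine_sl_scale by blast
  have Q0: "Q 0"
  proof -
    have "ascale 0 central = 0" by (simp add: ascale_def central_def zero_affine_def tmonom_def)
    then show ?thesis using Qscale[of central 0] c by (simp add: Q_def)
  qed
  have Qsum: "(\<And>s. s \<in> S \<Longrightarrow> Q (g s)) \<Longrightarrow> Q (sum g S)" for g :: "nat \<times> nat \<Rightarrow> affine" and S
    by (induction S rule: infinite_finite_induct) (auto intro: Q0 Qadd)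
  define D where "D i j f = (if i = j then
      Affine (\<lambda>r s. mat_unit i i f r s - mat_unit 0 0 f r s) 0 0 else Affine (mat_unit i j f) 0 0)" for i j f
  have D_add: "D i j (f + g) = D i j f + D i j g" for i j f g
    by (auto simp: D_def plus_affine_def mat_unit_def fun_eq_iff)
  have D_single: "Q (D i j (Poly_Mapping.single p a))" if "i < n" "j < n" for i j p a
  proof (cases "i = 0 \<and> j = 0")
    case True
    then show ?thesis using Q0 by (simp add: D_def zero_affine_def)
  next
    case False
    have s: "Poly_Mapping.single p a = tmonom a 0 * tmonom 1 p" by (simp add: tmonom_def mult_single)
    have "D i j (Poly_Mapping.single p a) = ascale a (if i = j then loop_unit i i p - loop_unit 0 0 p else loop_unit i j p)"
      unfolding s by (auto simp: D_def ascale_def loop_unit_def minus_affine_def fun_eq_iff mat_unit_def)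
    moreover have "Q (if i = j then loop_unit i i p - loop_unit 0 0 p else loop_unit i j p)"
      using that False n off diag by (auto simp: Q_def)
    ultimately show ?thesis using Qscale by simp
  qed
  have D_all: "Q (D i j f)" if "i < n" "j < n" for i j f
  proof -
    have "Q (D i j (\<Sum>p\<in>S. Poly_Mapping.single p (Poly_Mapping.lookup f p)))" if "finite S" for S
      using that
    proof induction
      case empty
      show ?case using D_single[OF \<open>i < n\<close> \<open>j < n\<close>, of 0 0] by simp
    next
      case (insert p S)
      then show ?case using D_add Qadd D_single[OF \<open>i < n\<close> \<open>j < n\<close>] by simp
    qed
    moreover have "(\<Sum>p\<in>Poly_Mapping.keys f. Poly_Mapping.single p (Poly_Mapping.lookup f p)) = f"
      by (rule poly_mapping_eqI)
        (auto simp: lookup_sum lookup_single when_def in_keys_iff)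
    ultimately show ?thesis by (metis finite_keys)
  qed
  define A where "A = loop_part x"
  have out: "A i j = 0" if "\<not> (i < n \<and> j < n)" for i j
    using x that by (simp add: affine_sl_def A_def)
  have tr: "(\<Sum>i<n. A i i) = 0" using x by (simp add: affine_sl_def A_def)
  have "x = (\<Sum>s\<in>{..<n}\<times>{..<n}. D (fst s) (snd s) (A (fst s) (snd s))) + (ascale (c_part x) central + ascale (d_part x) degree_derivation)"
    (is "x = ?S + ?T")
  proof (rule affine.expand, intro conjI)
    have lp: "loop_part (sum g S) r t = (\<Sum>s\<in>S. loop_part (g s) r t)"
      and cp: "c_part (sum g S) = (\<Sum>s\<in>S. c_part (g s))"
      and dp: "d_part (sum g S) = (\<Sum>s\<in>S. d_part (g s))" for g :: "nat \<times> nat \<Rightarrow> affine" and S r t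
      by (induction S rule: infinite_finite_induct; simp add: zero_affine_def plus_affine_def)+
    have D0: "c_part (D i j f) = 0" "d_part (D i j f) = 0" for i j f by (auto simp: D_def)
    show "c_part x = c_part (?S + ?T)" "d_part x = d_part (?S + ?T)"
      by (simp_all add: plus_affine_def cp dp D0 ascale_def central_def degree_derivation_def)
    have lD: "loop_part (D i j f) r t = mat_unit i j f r t - (if i = j then mat_unit 0 0 f r t else 0)" for i j f r t
      by (auto simp: D_def)
    have "loop_part ?S r t = A r t" for r t
    proof -
      have "loop_part ?S r t = (\<Sum>s\<in>{..<n}\<times>{..<n}. mat_unit (fst s) (snd s) (A (fst s) (snd s)) r t)
         - (\<Sum>s\<in>{..<n}\<times>{..<n}. if fst s = snd s then mat_unit 0 0 (A (fst s) (snd s)) r t else 0)"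
        by (simp add: lp lD sum_subtractf)
      also have "(\<Sum>s\<in>{..<n}\<times>{..<n}. mat_unit (fst s) (snd s) (A (fst s) (snd s)) r t) =
          (\<Sum>s\<in>{..<n}\<times>{..<n}. if s = (r, t) then A r t else 0)"
        by (intro sum.cong) (auto simp: mat_unit_def)
      also have "\<dots> = A r t" using out by (auto simp: sum.delta)
      also have "(\<Sum>s\<in>{..<n}\<times>{..<n}. if fst s = snd s then mat_unit 0 0 (A (fst s) (snd s)) r t else 0)
         = (\<Sum>i<n. \<Sum>j<n. if j = i then mat_unit 0 0 (A i i) r t else 0)"
        unfolding sum.cartesian_product by (intro sum.cong) auto
      also have "\<dots> = (\<Sum>i<n. mat_unit 0 0 (A i i) r t)" by simp
      also have "\<dots> = mat_unit 0 0 (\<Sum>i<n. A i i) r t" by (auto simp: mat_unit_def)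
      also have "\<dots> = 0" by (simp add: tr mat_unit_def)
      finally show ?thesis by simp
    qed
    then show "loop_part x = loop_part (?S + ?T)"
      by (simp add: plus_affine_def ascale_def central_def degree_derivation_def fun_eq_iff A_def)
  qed
  moreover have "Q ?S" by (rule Qsum) (auto intro: D_all)
  moreover have "Q ?T" using c d by (intro Qadd Qscale) (auto simp: Q_def)
  ultimately have "Q x" using Qadd by metis
  then show ?thesis by (simp add: Q_def)
qed

section \<open>Generation by the Chevalley generators\<close>

text \<open>
  Every off-diagonal matrix unit is an iterated commutator of units next to the diagonal. The rule is
  used for two properties: to preserve a given subspace, and to annihilate the highest weight vector.
\<close>

lemma offdiag_induct:
  fixes P :: "nat \<Rightarrow> nat \<Rightarrow> bool"
  assumes up: "\<And>i. 0 < i \<Longrightarrow> i < n \<Longrightarrow> P (i - 1) i"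
    and down: "\<And>i. 0 < i \<Longrightarrow> i < n \<Longrightarrow> P i (i - 1)"
    and comp: "\<And>i j s. i < n \<Longrightarrow> j < n \<Longrightarrow> s < n \<Longrightarrow> i \<noteq> j \<Longrightarrow> j \<noteq> s \<Longrightarrow> i \<noteq> s \<Longrightarrow> P i j \<Longrightarrow> P j s \<Longrightarrow> P i s"
    and ij: "i < n" "j < n" "i \<noteq> j"
  shows "P i j"
proof -
  have "i + Suc d < n \<Longrightarrow> P i (i + Suc d) \<and> P (i + Suc d) i" for i d
  proof (induction d)
    case 0
    then show ?case using up[of "Suc i"] down[of "Suc i"] by simp
  next
    case (Suc d)
    have "P (i + Suc d) (i + Suc (Suc d))" "P (i + Suc (Suc d)) (i + Suc d)"
      using up[of "i + Suc (Suc d)"] down[of "i + Suc (Suc d)"] Suc.prems by simp_all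
    then show ?case
      using Suc comp[of i "i + Suc d" "i + Suc (Suc d)"] comp[of "i + Suc (Suc d)" "i + Suc d" i] by simp
  qed
  from this[of i "j - i - 1"] this[of j "i - j - 1"] ij show ?thesis
    by (cases "i < j") auto
qed

text \<open>
  The case \<open>m = n - 1\<close> presents the central element as the sum of all coroots, so that stability
  under coroots implies stability under it.
\<close>

lemma sum_coroots: "m < n \<Longrightarrow> (\<Sum>i\<le>m. coroot n i) = loop_unit (n - 1) (n - 1) 0 - loop_unit m m 0 + central"
  by (induction m) (auto simp: coroot_eq algebra_simps)

lemma coroot_mem [simp]: "2 \<le> n \<Longrightarrow> i < n \<Longrightarrow> coroot n i \<in> affine_sl n"
  by (auto simp: coroot_eq intro!: affine_sl_add)

lemma chevalley_e_mem [simp]: "2 \<le> n \<Longrightarrow> i < n \<Longrightarrow> chevalley_e n i \<in> affine_sl n"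
  by (auto simp: chevalley_e_eq)

lemma chevalley_f_mem [simp]: "2 \<le> n \<Longrightarrow> i < n \<Longrightarrow> chevalley_f n i \<in> affine_sl n"
  by (auto simp: chevalley_f_def)

lemma ascale_minus_one: "x + ascale (- 1) y = x - y"
  by (simp add: ascale_def plus_affine_def minus_affine_def tmonom_def single_uminus)

lemma cartan_subset: "2 \<le> n \<Longrightarrow> cartan n \<subseteq> affine_sl n"
proof -
  assume n: "2 \<le> n"
  interpret A: vector_space ascale by (rule vector_space_ascale)
  have "A.subspace (affine_sl n)"
    by (auto simp: A.subspace_def affine_sl_add affine_sl_scale affine_sl_zero)
  then show ?thesis unfolding cartan_def using n by (intro A.span_minimal) auto
qed

context affine_module
begin

lemma act_zero_right: "x \<in> affine_sl n \<Longrightarrow> act x 0 = 0"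
  using act_scale_right[of x 0 0] by simp

lemma act_minus_right: "x \<in> affine_sl n \<Longrightarrow> act x (- v) = - act x v"
  using act_scale_right[of x "- 1" v] by simp

lemma act_diff_right: "x \<in> affine_sl n \<Longrightarrow> act x (v - w) = act x v - act x w"
  using act_add_right[of x v "- w"] act_minus_right[of x w] by simp

lemma act_sum_right: "x \<in> affine_sl n \<Longrightarrow> act x (\<Sum>i\<in>I. g i) = (\<Sum>i\<in>I. act x (g i))"
  by (induction I rule: infinite_finite_induct) (simp_all add: act_zero_right act_add_right)

lemma act_zero: "act 0 v = 0"
proof -
  have "ascale 0 0 = 0" by (simp add: ascale_def zero_affine_def tmonom_def)
  then show ?thesis using act_scale[OF affine_sl_zero, of 0 v] by simp
qed

lemma act_diff: "x \<in> affine_sl n \<Longrightarrow> y \<in> affine_sl n \<Longrightarrow> act (x - y) v = act x v - act y v"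
  using act_add[of x "ascale (- 1) y" v] act_scale[of y "- 1" v]
  by (simp add: ascale_minus_one affine_sl_scale)

lemma act_sum: "(\<And>i. i \<in> I \<Longrightarrow> g i \<in> affine_sl n) \<Longrightarrow> act (\<Sum>i\<in>I. g i) v = (\<Sum>i\<in>I. act (g i) v) \<and> (\<Sum>i\<in>I. g i) \<in> affine_sl n"
  by (induction I rule: infinite_finite_induct)
   (auto simp: act_zero act_add affine_sl_add affine_sl_zero)

lemma act_span_mono:
  assumes "x \<in> affine_sl n" "\<And>s. s \<in> S \<Longrightarrow> act x s \<in> span T" "w \<in> span S"
  shows "act x w \<in> span T"
  using assms(3)
proof (induction rule: span_induct_alt)
  case base
  show ?case by (simp add: act_zero_right assms(1) span_zero)
next
  case (step c s w)
  then show ?case using assms by (simp add: act_add_right act_scale_right span_add span_scale)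
qed

text \<open>
  The bracket is used from here on only through the commutators of the operators by which
  matrix units act.
\<close>

lemma commute_loop_unit:
  assumes "i < n" "j < n" "r < n" "s < n" "i \<noteq> j" "r \<noteq> s" "\<not> (j = r \<and> s = i)"
  shows "act (loop_unit i j p) (act (loop_unit r s q) w) = act (loop_unit r s q) (act (loop_unit i j p) w)
    + (if j = r then act (loop_unit i s (p + q)) w else if s = i then - act (loop_unit r j (p + q)) w else 0)"
proof -
  have "act (bracket n (loop_unit i j p) (loop_unit r s q)) w =
     (if j = r then act (loop_unit i s (p + q)) w else if s = i then - act (loop_unit r j (p + q)) w else 0)"
    using assms act_diff[OF affine_sl_zero, of "loop_unit r j (p+q)" w]
    by (auto simp: bracket_loop_unit act_zero)
  then show ?thesis using assms by (simp add: act_bracket algebra_simps)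
qed

lemma commute_opposite:
  assumes "i < n" "j < n" "i \<noteq> j"
  shows "act (loop_unit i j p) (act (loop_unit j i q) w) = act (loop_unit j i q) (act (loop_unit i j p) w)
    + (act (loop_unit i i (p + q) - loop_unit j j (p + q)) w + (if p + q = 0 then scale (of_int p) (act central w) else 0))"
proof -
  have "act (bracket n (loop_unit i j p) (loop_unit j i q)) w =
     act (loop_unit i i (p + q) - loop_unit j j (p + q)) w + (if p + q = 0 then scale (of_int p) (act central w) else 0)"
    using assms 
    by (auto simp: bracket_loop_unit act_add act_scale affine_sl_scale)
  then show ?thesis using assms by (simp add: act_bracket algebra_simps)
qed

lemma commute_central: "x \<in> affine_sl n \<Longrightarrow> act central (act x w) = act x (act central w)"
  using act_bracket[of central x w] by (simp add: bracket_central act_zero)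

lemma commute_diag:
  assumes "i < n" "j < n" "r < n" "s < n" "r \<noteq> s"
  shows "act (loop_unit i i p - loop_unit j j p) (act (loop_unit r s q) w) =
    act (loop_unit r s q) (act (loop_unit i i p - loop_unit j j p) w) +
    scale ((if i = r then 1 else 0) - (if i = s then 1 else 0) - (if j = r then 1 else 0) + (if j = s then 1 else 0))
      (act (loop_unit r s (p + q)) w)"
proof -
  have m: "act (- loop_unit r s t) w = - act (loop_unit r s t) w" for t
    using act_diff[OF affine_sl_zero, of "loop_unit r s t" w] assms by (simp add: act_zero)
  have p: "act (loop_unit r s t + loop_unit r s t) w = scale 2 (act (loop_unit r s t) w)" for t
    using act_add[of "loop_unit r s t" "loop_unit r s t"] scale_left_distrib[of 1 1 "act (loop_unit r s t) w"] assms by simp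
  have pm: "act (- loop_unit r s t - loop_unit r s t) w = scale (- 2) (act (loop_unit r s t) w)" for t
  proof -
    have "act (- loop_unit r s t - loop_unit r s t) w = act (0 - (loop_unit r s t + loop_unit r s t)) w"
      by simp
    also have "\<dots> = - act (loop_unit r s t + loop_unit r s t) w"
      using assms by (subst act_diff) (auto simp: affine_sl_zero affine_sl_add act_zero)
    finally show ?thesis using p by simp
  qed
  have "act (bracket n (loop_unit i i p - loop_unit j j p) (loop_unit r s q)) w =
    scale ((if i = r then 1 else 0) - (if i = s then 1 else 0) - (if j = r then 1 else 0) + (if j = s then 1 else 0))
      (act (loop_unit r s (p + q)) w)"
    using assms by (auto simp: bracket_loop_unit bracket_diff_left act_zero m p pm)
  then show ?thesis using assms by (simp add: act_bracket algebra_simps)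
qed

lemma commute_degree:
  assumes "r < n" "s < n" "r \<noteq> s"
  shows "act degree_derivation (act (loop_unit r s q) w) =
    act (loop_unit r s q) (act degree_derivation w) + scale (of_int q) (act (loop_unit r s q) w)"
  using act_bracket[of degree_derivation "loop_unit r s q" w] assms
  by (simp add: bracket_degree act_scale algebra_simps)

text \<open>
  The Chevalley generators and \<open>d\<close> generate the affine algebra. The constant matrix units come from
  those next to the diagonal. To change the power of \<open>t\<close>, bracket with
  \<open>H\<^sub>\<plusminus> = (E\<^sub>r\<^sub>r - E\<^sub>0\<^sub>0) t\<^sup>\<plusminus>\<^sup>1\<close>, \<open>r = n - 1\<close>, which arises from \<open>e\<^sub>0\<close> or \<open>f\<^sub>0\<close> and an opposite
  constant unit: it multiplies \<open>E\<^sub>r\<^sub>0\<close> and \<open>E\<^sub>0\<^sub>r\<close> by \<open>\<plusminus>2 t\<^sup>\<plusminus>\<^sup>1\<close>. Brackets with constant units then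
  move these two entries to every off-diagonal place.
\<close>

lemma submoduleI:
  assumes n: "2 \<le> n" and W: "subspace W"
    and e: "\<And>i w. i < n \<Longrightarrow> w \<in> W \<Longrightarrow> act (chevalley_e n i) w \<in> W"
    and f: "\<And>i w. i < n \<Longrightarrow> w \<in> W \<Longrightarrow> act (chevalley_f n i) w \<in> W"
    and h: "\<And>i w. i < n \<Longrightarrow> w \<in> W \<Longrightarrow> act (coroot n i) w \<in> W"
    and d: "\<And>w. w \<in> W \<Longrightarrow> act degree_derivation w \<in> W"
  shows "submodule W"
proof -
  define K where "K x \<longleftrightarrow> (\<forall>w\<in>W. act x w \<in> W)" for x
  have Kc: "K central"
  proof -
    have "central = (\<Sum>i\<le>n - 1. coroot n i)" using sum_coroots[of "n - 1" n] n by simp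
    moreover have "act (\<Sum>i\<le>n - 1. coroot n i) w = (\<Sum>i\<le>n - 1. act (coroot n i) w)" for w
      using act_sum[of "{..n - 1}" "coroot n" w] n by simp
    ultimately show ?thesis
      using n unfolding K_def by (auto intro!: subspace_sum[OF W] h)
  qed
  have comp: "K (loop_unit i s (p + q))"
    if K: "K (loop_unit i j p)" "K (loop_unit j s q)" and ij: "i < n" "j < n" "s < n" "i \<noteq> j" "j \<noteq> s" "i \<noteq> s"
    for i j s p q
    unfolding K_def
  proof
    fix w assume w: "w \<in> W"
    have "act (loop_unit i s (p + q)) w = act (loop_unit i j p) (act (loop_unit j s q) w) - act (loop_unit j s q) (act (loop_unit i j p) w)"
      using commute_loop_unit[of i j j s p q w] ij by simp
    then show "act (loop_unit i s (p + q)) w \<in> W"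
      using K w subspace_diff[OF W] unfolding K_def by simp
  qed
  have diag: "K (loop_unit i i (p + q) - loop_unit j j (p + q))"
    if K: "K (loop_unit i j p)" "K (loop_unit j i q)" and ij: "i < n" "j < n" "i \<noteq> j" for i j p q
    unfolding K_def
  proof
    fix w assume w: "w \<in> W"
    have "act (loop_unit i i (p + q) - loop_unit j j (p + q)) w =
        act (loop_unit i j p) (act (loop_unit j i q) w) - act (loop_unit j i q) (act (loop_unit i j p) w)
        - (if p + q = 0 then scale (of_int p) (act central w) else 0)"
      using commute_opposite[of i j p q w] ij by (simp add: algebra_simps)
    moreover have "(if p + q = 0 then scale (of_int p) (act central w) else 0) \<in> W"
      using Kc w subspace_scale[OF W] subspace_0[OF W] unfolding K_def by simp
    ultimately show "act (loop_unit i i (p + q) - loop_unit j j (p + q)) w \<in> W"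
      using K w subspace_diff[OF W] unfolding K_def by simp
  qed
  have half: "u \<in> W" if "scale 2 u \<in> W \<or> scale (- 2) u \<in> W" for u
    using that subspace_scale[OF W, of "scale 2 u" "1/2"] subspace_scale[OF W, of "scale (- 2) u" "- 1/2"] by auto
  have shift: "K (loop_unit r s (p + q))"
    if K: "K (loop_unit i i p - loop_unit j j p)" "K (loop_unit r s q)" and ij: "i < n" "j < n" "i \<noteq> j" "r = i \<and> s = j \<or> r = j \<and> s = i"
    for i j r s p q
    unfolding K_def
  proof
    fix w assume w: "w \<in> W"
    let ?H = "loop_unit i i p - loop_unit j j p"
    have "act ?H (act (loop_unit r s q) w) - act (loop_unit r s q) (act ?H w) \<in> W"
      using K w subspace_diff[OF W] unfolding K_def by blast
    moreover have "act ?H (act (loop_unit r s q) w) - act (loop_unit r s q) (act ?H w) =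
        scale (if r = i then 2 else - 2) (act (loop_unit r s (p + q)) w)"
      using commute_diag[of i j r s p q w] ij by auto
    ultimately show "act (loop_unit r s (p + q)) w \<in> W"
      by (intro half) (auto split: if_splits)
  qed
  have const: "K (loop_unit i j 0)" if "i < n" "j < n" "i \<noteq> j" for i j
    using _ _ _ that
  proof (rule offdiag_induct)
    show "K (loop_unit (i - 1) i 0)" "K (loop_unit i (i - 1) 0)" if "0 < i" "i < n" for i
      using e[of i] f[of i] n that by (auto simp: K_def chevalley_e_eq chevalley_f_def)
    show "K (loop_unit i s 0)"
      if "i < n" "j < n" "s < n" "i \<noteq> j" "j \<noteq> s" "i \<noteq> s" "K (loop_unit i j 0)" "K (loop_unit j s 0)" for i j s
      using comp[of i j 0 s 0] that by simp
  qed
  \<comment> \<open>\<open>H\<close> raises or lowers the power of \<open>t\<close> in the corner entries \<open>E\<^sub>r\<^sub>0\<close> and \<open>E\<^sub>0\<^sub>r\<close>.\<close>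
  define r where "r = n - 1"
  have r: "r < n" "0 < n" "r \<noteq> 0" using n by (auto simp: r_def)
  have e0: "K (loop_unit r 0 1)" and f0: "K (loop_unit 0 r (- 1))"
    using e[of 0] f[of 0] n by (auto simp: K_def chevalley_e_eq chevalley_f_def r_def)
  have H: "K (loop_unit r r 1 - loop_unit 0 0 1)" "K (loop_unit r r (- 1) - loop_unit 0 0 (- 1))"
    using diag[OF e0 const[of 0 r]] diag[OF const[of r 0] f0] r by simp_all
  have base: "K (loop_unit r 0 p) \<and> K (loop_unit 0 r p)" for p
  proof (induction p rule: int_induct[of _ 0])
    case base
    then show ?case using const r by auto
  next
    case (step1 p)
    then show ?case using shift[OF H(1), of r 0 p] shift[OF H(1), of 0 r p] r by (simp add: add.commute)
  next
    case (step2 p)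
    then show ?case using shift[OF H(2), of r 0 p] shift[OF H(2), of 0 r p] r by (simp add: add.commute)
  qed
  have off: "K (loop_unit i j p)" if ij: "i < n" "j < n" "i \<noteq> j" for i j p
  proof -
    have col: "K (loop_unit i 0 p)" if "i < n" "i \<noteq> 0" for i
      using comp[of i r 0 0 p] const[of i r] base that r by (cases "i = r") auto
    have row: "K (loop_unit 0 j p)" if "j < n" "j \<noteq> 0" for j
      using comp[of 0 r p j 0] const[of r j] base that r by (cases "j = r") auto
    show ?thesis
      using comp[of i 0 p j 0] const[of 0 j] col row ij by (cases "i = 0"; cases "j = 0") auto
  qed
  have "K x" if "x \<in> affine_sl n" for x
    using n that
  proof (rule affine_sl_induct)
    show "K (loop_unit i i p - loop_unit 0 0 p)" if "0 < i" "i < n" for i p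
      using diag[of i 0 p 0] off that by simp
  qed (auto simp: K_def act_add act_scale intro: d subspace_add[OF W] subspace_scale[OF W] off[unfolded K_def, rule_format] Kc[unfolded K_def, rule_format])
  then show ?thesis unfolding submodule_def K_def using W by blast
qed

end

section \<open>Weights and simple roots\<close>

text \<open>
  The predecessor on the cycle of nodes. With it the formulas for the generators at node 0 and at
  the other nodes take the same form.
\<close>

definition cpred :: "nat \<Rightarrow> nat \<Rightarrow> nat" where
  "cpred n i = (if i = 0 then n - 1 else i - 1)"

lemma cpred_less: "2 \<le> n \<Longrightarrow> i < n \<Longrightarrow> cpred n i < n"
  and cpred_neq: "2 \<le> n \<Longrightarrow> cpred n i \<noteq> i"
  and cpred_eq_iff: "i < n \<Longrightarrow> j < n \<Longrightarrow> cpred n i = cpred n j \<longleftrightarrow> i = j"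
  by (auto simp: cpred_def)

lemma cpred_eq_succ: "r < n \<Longrightarrow> s < n \<Longrightarrow> cpred n r = s \<longleftrightarrow> r = (if s = n - 1 then 0 else Suc s)"
  by (auto simp: cpred_def split: if_splits)

lemma e_cpred: "2 \<le> n \<Longrightarrow> chevalley_e n i = loop_unit (cpred n i) i (if i = 0 then 1 else 0)"
  and f_cpred: "chevalley_f n i = loop_unit i (cpred n i) (if i = 0 then - 1 else 0)"
  and coroot_cpred: "coroot n i = loop_unit (cpred n i) (cpred n i) 0 - loop_unit i i 0 + (if i = 0 then central else 0)"
  by (auto simp: chevalley_e_eq chevalley_f_def coroot_eq cpred_def)

text \<open>
  This form of the Cartan matrix is the one that comes out of the bracket of \<open>h\<^sub>i\<close> with \<open>f\<^sub>j\<close>, up to sign. It covers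
  \<open>n = 2\<close>, where the two neighbours of a node coincide and their contributions add up to \<open>-2\<close>.
\<close>

lemma cartan_matrix_cpred:
  assumes "2 \<le> n" "i < n" "j < n"
  shows "cartan_matrix n i j =
    (if cpred n i = cpred n j then 1 else 0) - (if cpred n i = j then 1 else 0)
    - (if i = cpred n j then 1 else 0) + (if i = j then 1 else 0)"
proof (cases "i = j")
  case True
  then show ?thesis using cpred_neq[OF assms(1), of i] cpred_neq[OF assms(1), of i, symmetric]
    by (simp add: cartan_matrix_def)
next
  case False
  have p: "cpred n r = s \<longleftrightarrow> r = s + 1 \<or> r = 0 \<and> s = n - 1" if "r < n" "s < n" for r s
    using that by (auto simp: cpred_def)
  have both: "cpred n i = j \<and> cpred n j = i \<longleftrightarrow> n = 2"
    unfolding p[OF assms(2,3)] p[OF assms(3,2)] using assms False by arith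
  have adj: "i = j + 1 \<or> j = i + 1 \<or> (i = 0 \<and> j = n - 1) \<or> (i = n - 1 \<and> j = 0)
      \<longleftrightarrow> cpred n i = j \<or> cpred n j = i"
    unfolding p[OF assms(2,3)] p[OF assms(3,2)] by blast
  have gen: "(if i = j then 2 else if n = 2 then - 2 else if a \<or> b then - 1 else 0) =
      (if c then 1 else 0) - (if a then 1 else 0) - (if b then 1 else 0) + (if i = j then 1 else (0::int))"
    if "a \<and> b \<longleftrightarrow> n = 2" "\<not> c" for a b c
    using that False by (cases a; cases b; simp)
  have b: "cpred n i = j \<and> i = cpred n j \<longleftrightarrow> n = 2"
    unfolding both[symmetric] eq_commute[of i "cpred n j"] by (rule refl)
  have c: "\<not> cpred n i = cpred n j"
    unfolding cpred_eq_iff[OF assms(2,3)] by (rule False)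
  show ?thesis
    unfolding cartan_matrix_def adj eq_commute[of "cpred n j" i] by (rule gen[OF b c])
qed

lemma coroot_in_cartan: "i < n \<Longrightarrow> coroot n i \<in> cartan n"
  and degree_in_cartan: "degree_derivation \<in> cartan n"
proof -
  interpret A: vector_space ascale by (rule vector_space_ascale)
  show "i < n \<Longrightarrow> coroot n i \<in> cartan n" "degree_derivation \<in> cartan n"
    by (auto simp: cartan_def intro: A.span_base)
qed

lemma module_ascale: "module ascale"
  using vector_space_ascale by (simp add: module_iff_vector_space)

lemma weight_with_values:
  assumes "2 \<le> n"
  shows "weight_with_values n u b \<in> cartan_dual n"
    and "i < n \<Longrightarrow> weight_with_values n u b (coroot n i) = u i"
    and "weight_with_values n u b degree_derivation = b"
proof -
  have "weight_with_values n u b \<in> cartan_dual n \<and>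
      (\<forall>i<n. weight_with_values n u b (coroot n i) = u i) \<and> weight_with_values n u b degree_derivation = b"
    unfolding weight_with_values_def by (rule theI'[OF weight_with_values_ex1[OF assms]])
  then show "weight_with_values n u b \<in> cartan_dual n"
    and "i < n \<Longrightarrow> weight_with_values n u b (coroot n i) = u i"
    and "weight_with_values n u b degree_derivation = b"
    by simp_all
qed

lemma simple_root_dual: "2 \<le> n \<Longrightarrow> simple_root n j \<in> cartan_dual n"
  and simple_root_coroot: "2 \<le> n \<Longrightarrow> i < n \<Longrightarrow> simple_root n j (coroot n i) = of_int (cartan_matrix n i j)"
  and simple_root_degree: "2 \<le> n \<Longrightarrow> simple_root n j degree_derivation = (if j = 0 then 1 else 0)"
  by (simp_all add: simple_root_def weight_with_values)

lemma fundamental_weight_coroot: "2 \<le> n \<Longrightarrow> i < n \<Longrightarrow> fundamental_weight n 0 (coroot n i) = (if i = 0 then 1 else 0)"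
  by (simp add: fundamental_weight_def weight_with_values)

lemma cartan_dual_add: "\<phi> \<in> cartan_dual n \<Longrightarrow> x \<in> cartan n \<Longrightarrow> y \<in> cartan n \<Longrightarrow> \<phi> (x + y) = \<phi> x + \<phi> y"
  and cartan_dual_scale: "\<phi> \<in> cartan_dual n \<Longrightarrow> x \<in> cartan n \<Longrightarrow> \<phi> (ascale a x) = a * \<phi> x"
  by (simp_all add: cartan_dual_def)

lemma cartan_induct [consumes 1, case_names zero coroot degree add scale]:
  assumes "h \<in> cartan n" "P 0" "\<And>i. i < n \<Longrightarrow> P (coroot n i)" "P degree_derivation"
    and "\<And>x y. x \<in> cartan n \<Longrightarrow> y \<in> cartan n \<Longrightarrow> P x \<Longrightarrow> P y \<Longrightarrow> P (x + y)"
    and "\<And>a x. x \<in> cartan n \<Longrightarrow> P x \<Longrightarrow> P (ascale a x)"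
  shows "P h"
proof -
  interpret A: vector_space ascale by (rule vector_space_ascale)
  have "h \<in> cartan n \<and> P h" using assms(1) unfolding cartan_def
  proof (induction rule: A.span_induct_alt)
    case base
    then show ?case using assms(2) by (simp add: A.span_zero)
  next
    case (step c x y)
    have x: "x \<in> cartan n" "P x" using step assms(3,4) coroot_in_cartan degree_in_cartan by auto
    have y: "y \<in> cartan n" "P y" using step by (auto simp: cartan_def)
    have s: "ascale c x \<in> cartan n" using x A.span_scale unfolding cartan_def by blast
    then have "ascale c x + y \<in> cartan n" using y A.span_add unfolding cartan_def by blast
    then show ?case using assms(5)[OF s y(1)] assms(6)[OF x] y unfolding cartan_def by blast
  qed
  then show ?thesis by blast
qed

text \<open>
  The derivation \<open>d\<close> only sees \<open>c\<^sub>0\<close>, so \<open>c\<^sub>0 = 0\<close>. The coroots then say that \<open>c\<close> is a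
  cyclic sequence with vanishing second difference; it is linear along \<open>0, 1, \<dots>, n\<close> and
  vanishes at both ends.
\<close>

lemma simple_roots_independent:
  fixes c :: "nat \<Rightarrow> complex"
  assumes n: "2 \<le> n" and z: "\<And>h. h \<in> cartan n \<Longrightarrow> (\<Sum>i<n. c i * simple_root n i h) = 0" and i: "i < n"
  shows "c i = 0"
proof -
  have c0: "c 0 = 0"
  proof -
    have "(\<Sum>i<n. c i * simple_root n i degree_derivation) = (\<Sum>i<n. if i = 0 then c 0 else 0)"
      using n by (intro sum.cong) (auto simp: simple_root_degree)
    then show ?thesis using z[OF degree_in_cartan] n by simp
  qed
  have row: "(\<Sum>i<n. c i * of_int (cartan_matrix n j i)) = 0" if "j < n" for j
    using z[OF coroot_in_cartan[OF that]] that n by (simp add: simple_root_coroot)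
  have rec: "2 * c j - c (cpred n j) - c (if j = n - 1 then 0 else Suc j) = 0" if j: "j < n" for j
  proof -
    let ?s = "if j = n - 1 then 0 else Suc j"
    have s: "?s < n" using j by auto
    have "c i * of_int (cartan_matrix n j i) = (if i = j then 2 * c i else 0) - (if i = cpred n j then c i else 0) - (if i = ?s then c i else 0)"
      if "i < n" for i
    proof -
      have s: "i = ?s \<longleftrightarrow> cpred n i = j" using cpred_eq_succ[OF that j] by simp
      have gen: "c i * of_int ((if a then 1 else 0) - (if b then 1 else 0) - (if d then 1 else 0) + (if a then 1 else 0)) =
        (if a then 2 * c i else 0) - (if b then c i else 0) - (if d then c i else 0)" for a b d
        by (simp add: algebra_simps)
      show ?thesis
        unfolding cartan_matrix_cpred[OF n j that] cpred_eq_iff[OF j that] eq_commute[of i j]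
          eq_commute[of i "cpred n j"] eq_commute[of j "cpred n i"] s
        by (rule gen)
    qed
    then have "(\<Sum>i<n. c i * of_int (cartan_matrix n j i)) =
      (\<Sum>i<n. (if i = j then 2 * c i else 0) - (if i = cpred n j then c i else 0) - (if i = ?s then c i else 0))"
      by (intro sum.cong) auto
    also have "\<dots> = 2 * c j - c (cpred n j) - c ?s"
      using j s cpred_less[OF n j] by (simp add: sum_subtractf)
    finally show ?thesis using row[OF j] by simp
  qed
  have lin: "c j = of_nat j * c 1 \<and> c (j - 1) = of_nat (j - 1) * c 1" if "j < n" for j
    using that
  proof (induction j)
    case 0
    then show ?case by (simp add: c0)
  next
    case (Suc j)
    show ?case
    proof (cases j)
      case 0
      then show ?thesis by (simp add: c0)
    next
      case (Suc m)
      have "c (Suc j) = 2 * c j - c (j - 1)"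
      proof -
        have "j < n" "j \<noteq> n - 1" using Suc.prems by simp_all
        then have "2 * c j - c (cpred n j) - c (Suc j) = 0" using rec[of j] by simp
        moreover have "cpred n j = j - 1" using Suc by (simp add: cpred_def)
        ultimately show ?thesis by (simp add: algebra_simps)
      qed
      then have "c (Suc j) = 2 * (of_nat j * c 1) - of_nat (j - 1) * c 1"
        using Suc.IH Suc.prems by simp
      then show ?thesis using Suc.IH Suc.prems \<open>j = Suc m\<close> by (simp add: algebra_simps)
    qed
  qed
  have "of_nat n * c 1 = 0"
  proof -
    have "2 * c 0 - c (n - 1) - c 1 = 0" using rec[of 0] n by (simp add: cpred_def split: if_splits)
    moreover have "c (n - 1) + c 1 = - (2 * c 0 - c (n - 1) - c 1)" by (simp add: c0)
    ultimately have "c (n - 1) + c 1 = 0" by simp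
    moreover have "c (n - 1) = of_nat (n - 1) * c 1" using lin[of "n - 1"] n by simp
    ultimately have "(of_nat (n - 1) + 1) * c 1 = 0" by (simp add: algebra_simps)
    moreover have "of_nat (n - 1) + 1 = (of_nat n :: complex)" using n by (simp add: of_nat_diff)
    ultimately show ?thesis by simp
  qed
  then show ?thesis using lin[OF i] n by simp
qed

context affine_module
begin

lemma act_coroot:
  assumes n: "2 \<le> n" and i: "i < n"
  shows "act (coroot n i) w = act (loop_unit (cpred n i) (cpred n i) 0 - loop_unit i i 0) w
    + scale (if i = 0 then 1 else 0) (act central w)"
proof -
  have "loop_unit (cpred n i) (cpred n i) 0 - loop_unit i i 0 \<in> affine_sl n"
    using i cpred_less[OF n i] by simp
  from act_add[OF this central_mem, of w] show ?thesis
    unfolding coroot_cpred by (cases "i = 0") (simp_all only: if_True if_False simp_thms scale_one scale_zero_left add_0_right)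
qed

lemma commute_e_f:
  assumes n: "2 \<le> n" and "i < n" "j < n"
  shows "act (chevalley_e n i) (act (chevalley_f n j) w) =
    act (chevalley_f n j) (act (chevalley_e n i) w) + (if i = j then act (coroot n i) w else 0)"
proof (cases "i = j")
  case True
  let ?p = "if i = 0 then 1 else 0 :: int" and ?D = "loop_unit (cpred n i) (cpred n i) 0 - loop_unit i i 0"
  have pi: "cpred n i < n" "cpred n i \<noteq> i" using cpred_less cpred_neq assms by auto
  have D: "?D \<in> affine_sl n" using pi assms by simp
  have "act (loop_unit (cpred n i) i ?p) (act (loop_unit i (cpred n i) (- ?p)) w) =
    act (loop_unit i (cpred n i) (- ?p)) (act (loop_unit (cpred n i) i ?p) w)
      + (act ?D w + scale (of_int ?p) (act central w))"
    using commute_opposite[OF pi(1) assms(2) pi(2), of ?p "- ?p" w] by (simp only: right_minus if_True refl)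
  moreover have "act (coroot n i) w = act ?D w + scale (of_int ?p) (act central w)"
    unfolding act_coroot[OF n assms(2)] by simp
  moreover have "(if i = 0 then - 1 else 0) = - ?p" by simp
  ultimately show ?thesis
    unfolding True[symmetric] e_cpred[OF n] f_cpred by (simp only: if_True refl)
next
  case False
  have pi: "cpred n i < n" "cpred n i \<noteq> i" "cpred n j < n" "cpred n j \<noteq> j" using cpred_less cpred_neq assms by auto
  have pij: "cpred n j \<noteq> cpred n i" using cpred_eq_iff[OF assms(2,3)] False by simp
  show ?thesis
    unfolding e_cpred[OF n] f_cpred
    by (subst commute_loop_unit) (simp_all only: pi pij False assms pi(2)[symmetric] pi(4)[symmetric]
        simp_thms not_False_eq_True if_False)
qed

lemma commute_cartan_f:
  assumes n: "2 \<le> n" and i: "i < n" and h: "h \<in> cartan n"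
  shows "act h (act (chevalley_f n i) w) =
    act (chevalley_f n i) (act h w) - scale (simple_root n i h) (act (chevalley_f n i) w)"
  using h
proof (induction arbitrary: w rule: cartan_induct)
  case zero
  have "simple_root n i 0 = 0"
    using cartan_dual_scale[OF simple_root_dual[OF n, of i] degree_in_cartan, of 0]
    by (simp add: module.scale_zero_left[OF module_ascale])
  then show ?case using n i by (simp add: act_zero act_zero_right)
next
  case (coroot j)
  have d: "act (loop_unit (cpred n j) (cpred n j) 0 - loop_unit j j 0) (act (chevalley_f n i) w) =
    act (chevalley_f n i) (act (loop_unit (cpred n j) (cpred n j) 0 - loop_unit j j 0) w)
    - scale (simple_root n i (coroot n j)) (act (chevalley_f n i) w)"
    unfolding f_cpred
  proof (subst commute_diag)
    have gen: "((if a then 1 else 0) - (if b then 1 else 0) - (if d then 1 else 0) + (if e then 1 else 0)) =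
      - (complex_of_int ((if b then 1 else 0) - (if a then 1 else 0) - (if e then 1 else 0) + (if d then 1 else 0)))" for a b d e
      by simp
    show "act (loop_unit i (cpred n i) (if i = 0 then - 1 else 0))
     (act (loop_unit (cpred n j) (cpred n j) 0 - loop_unit j j 0) w) +
    scale ((if cpred n j = i then 1 else 0) - (if cpred n j = cpred n i then 1 else 0) - (if j = i then 1 else 0)
        + (if j = cpred n i then 1 else 0))
     (act (loop_unit i (cpred n i) (0 + (if i = 0 then - 1 else 0))) w) =
    act (loop_unit i (cpred n i) (if i = 0 then - 1 else 0))
     (act (loop_unit (cpred n j) (cpred n j) 0 - loop_unit j j 0) w) -
    scale (simple_root n i (coroot n j)) (act (loop_unit i (cpred n i) (if i = 0 then - 1 else 0)) w)"
      unfolding simple_root_coroot[OF n coroot] cartan_matrix_cpred[OF n coroot i] gen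
      by (simp only: scale_minus_left add_0 diff_conv_add_uminus)
  qed (use coroot i cpred_less[OF n coroot] cpred_less[OF n i] cpred_neq[OF n, of i, symmetric] in simp_all)
  have c: "act central (act (chevalley_f n i) w) = act (chevalley_f n i) (act central w)"
    using n i by (simp add: commute_central)
  show ?case
  proof -
    let ?D = "loop_unit (cpred n j) (cpred n j) 0 - loop_unit j j 0" and ?c = "if j = 0 then 1 else 0 :: complex"
    have f: "chevalley_f n i \<in> affine_sl n" using n i by simp
    show ?thesis
      unfolding act_coroot[OF n coroot] d c act_add_right[OF f] act_scale_right[OF f] by (simp only: diff_add_eq)
  qed
next
  case degree
  show ?case
    unfolding f_cpred using i cpred_less[OF n i] cpred_neq[OF n, of i]
    by (subst commute_degree) (simp_all add: simple_root_degree[OF n])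
next
  case (add x y)
  have s: "x \<in> affine_sl n" "y \<in> affine_sl n" using add cartan_subset[OF n] by auto
  have f: "chevalley_f n i \<in> affine_sl n" using n i by simp
  show ?case
    using add(3,4) by (simp add: s f act_add act_add_right scale_left_distrib
      cartan_dual_add[OF simple_root_dual[OF n] add(1,2)])
next
  case (scale a x)
  have s: "x \<in> affine_sl n" using scale cartan_subset[OF n] by auto
  have f: "chevalley_f n i \<in> affine_sl n" using n i by simp
  show ?case
    using scale(2) by (simp add: s f act_scale act_scale_right scale_right_diff_distrib
      cartan_dual_scale[OF simple_root_dual[OF n] scale(1)])
qed

text \<open>
  Vectors of distinct weights are independent: applying \<open>h - \<chi>(h)\<close> for a weight \<open>\<chi> \<noteq> \<mu>\<close> that occurs
  in a presentation of \<open>w\<close> removes a term and multiplies \<open>w\<close> by \<open>\<mu>(h) - \<chi>(h)\<close>.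
\<close>

lemma weight_component:
  assumes n: "2 \<le> n"
    and S: "\<And>i. i \<in> I \<Longrightarrow> g i \<in> weight_space (\<chi> i)"
    and w: "w \<in> span (g ` I)" "w \<in> weight_space \<mu>"
  shows "w \<in> span (g ` {i \<in> I. \<forall>h\<in>cartan n. \<chi> i h = \<mu> h})"
proof -
  let ?T = "g ` {i \<in> I. \<forall>h\<in>cartan n. \<chi> i h = \<mu> h}"
  define ch where "ch s = \<chi> (SOME i. i \<in> I \<and> g i = s)" for s
  have ch: "s \<in> weight_space (ch s)" "(\<forall>h\<in>cartan n. ch s h = \<mu> h) \<Longrightarrow> s \<in> ?T" if "s \<in> g ` I" for s
  proof -
    define j where "j = (SOME i. i \<in> I \<and> g i = s)"
    have "\<exists>i. i \<in> I \<and> g i = s" using that by auto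
    from someI_ex[OF this] have j: "j \<in> I" "g j = s" unfolding j_def by blast+
    have c: "ch s = \<chi> j" unfolding ch_def j_def by (rule refl)
    have "s \<in> weight_space (\<chi> j)" using S[OF j(1)] unfolding j(2) .
    then show "s \<in> weight_space (ch s)" unfolding c .
    show "s \<in> ?T" if "\<forall>h\<in>cartan n. ch s h = \<mu> h"
      using that unfolding c by (intro image_eqI[of _ _ j]) (simp_all add: j)
  qed
  have gen: "finite t \<Longrightarrow> t \<subseteq> g ` I \<Longrightarrow> w = (\<Sum>s\<in>t. scale (r s) s) \<Longrightarrow> w \<in> weight_space \<mu> \<Longrightarrow> w \<in> span ?T" for t r w
  proof (induction "card t" arbitrary: t r w)
    case 0
    then show ?case by (simp add: span_zero)
  next
    case (Suc m)
    show ?case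
    proof (cases "\<forall>s\<in>t. \<forall>h\<in>cartan n. ch s h = \<mu> h")
      case True
      have "s \<in> span ?T" if "s \<in> t" for s
        using ch(2)[OF subsetD[OF Suc.prems(2) that]] True that by (intro span_base) simp
      then show ?thesis unfolding Suc.prems(3) by (intro span_sum span_scale)
    next
      case False
      then obtain s0 h where s0: "s0 \<in> t" and h: "h \<in> cartan n" and ne: "ch s0 h \<noteq> \<mu> h" by blast
      let ?q = "\<mu> h - ch s0 h"
      have hs: "h \<in> affine_sl n" using h cartan_subset[OF n] by auto
      have "scale ?q w = act h w - scale (ch s0 h) w"
        using Suc.prems(4) h by (simp add: weight_space_def scale_left_diff_distrib)
      also have "\<dots> = (\<Sum>s\<in>t. scale (r s * (ch s h - ch s0 h)) s)"
      proof -
        have "act h (scale (r s) s) = scale (r s * ch s h) s" if "s \<in> t" for s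
        proof -
          have "act h s = scale (ch s h) s"
            using ch(1)[OF subsetD[OF Suc.prems(2) that]] h by (simp add: weight_space_def)
          then show ?thesis by (simp add: act_scale_right[OF hs])
        qed
        then show ?thesis
          unfolding Suc.prems(3)
          unfolding act_sum_right[OF hs] scale_sum_right sum_subtractf[symmetric]
          by (intro sum.cong refl)
            (simp add: right_diff_distrib scale_left_diff_distrib mult.commute)
      qed
      also have "\<dots> = (\<Sum>s\<in>t - {s0}. scale (r s * (ch s h - ch s0 h)) s)"
        using s0 Suc.prems(1) by (subst sum.remove[of _ s0]) auto
      finally have "scale (1 / ?q) (scale ?q w) = (\<Sum>s\<in>t - {s0}. scale (1 / ?q * (r s * (ch s h - ch s0 h))) s)"
        by (simp add: scale_sum_right)
      then have "w = (\<Sum>s\<in>t - {s0}. scale (1 / ?q * (r s * (ch s h - ch s0 h))) s)"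
        using ne by simp
      moreover have "m = card (t - {s0})" using Suc.hyps(2) s0 Suc.prems(1) by simp
      ultimately show ?thesis
        by (intro Suc.hyps(1)[of "t - {s0}"]) (use Suc.prems in auto)
    qed
  qed
  obtain t r where "finite t" "t \<subseteq> g ` I" "w = (\<Sum>s\<in>t. scale (r s) s)"
    using w(1) unfolding span_explicit by blast
  then show ?thesis using gen w(2) by blast
qed

end

section \<open>Singular vectors of the irreducible module\<close>

locale vacuum_module = affine_module scale n act
  for scale :: "complex \<Rightarrow> 'v::ab_group_add \<Rightarrow> 'v" and n :: nat and act :: "affine \<Rightarrow> 'v \<Rightarrow> 'v" +
  fixes k :: nat and vac :: 'v
  assumes rank: "2 \<le> n"
    and irreducible: "submodule W \<Longrightarrow> W = {0} \<or> W = UNIV"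
    and vac_nonzero: "vac \<noteq> 0"
    and e_vac: "i < n \<Longrightarrow> act (chevalley_e n i) vac = 0"
    and cartan_vac: "h \<in> cartan n \<Longrightarrow> act h vac = scale (of_nat k * fundamental_weight n 0 h) vac"
    and vac_generates: "submodule W \<Longrightarrow> vac \<in> W \<Longrightarrow> W = UNIV"
begin

definition lowering :: "nat list \<Rightarrow> 'v" where
  "lowering is = foldr (\<lambda>i. act (chevalley_f n i)) is vac"

lemma lowering_simps [simp]: "lowering [] = vac" "lowering (i # is) = act (chevalley_f n i) (lowering is)"
  by (simp_all add: lowering_def)

lemma cartan_lowering:
  assumes "h \<in> cartan n"
  shows "set is \<subseteq> {..<n} \<Longrightarrow> act h (lowering is) =
    scale (of_nat k * fundamental_weight n 0 h - (\<Sum>i\<leftarrow>is. simple_root n i h)) (lowering is)"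
  using assms rank
  by (induction "is")
    (simp_all add: cartan_vac commute_cartan_f act_scale_right act_diff_right scale_left_diff_distrib scale_left_distrib)

lemma lowering_weight:
  "set is \<subseteq> {..<n} \<Longrightarrow> lowering is \<in> weight_space (\<lambda>h. of_nat k * fundamental_weight n 0 h - (\<Sum>i\<leftarrow>is. simple_root n i h))"
  by (simp add: weight_space_def cartan_lowering)

lemma sum_list_simple_root:
  "set is \<subseteq> {..<n} \<Longrightarrow> (\<Sum>i\<leftarrow>is. simple_root n i h) = (\<Sum>i<n. of_nat (count_list is i) * simple_root n i h)"
proof (induction "is")
  case (Cons a "is")
  have "(\<Sum>i<n. of_nat (count_list (a # is) i) * simple_root n i h)
    = (\<Sum>i<n. (if i = a then simple_root n i h else 0) + of_nat (count_list is i) * simple_root n i h)"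
    by (intro sum.cong) (auto simp: algebra_simps)
  then show ?case using Cons by (simp add: sum.distrib)
qed simp

text \<open>
  Half of the triangular decomposition: by \<open>[e\<^sub>i, f\<^sub>j] = \<delta>\<^sub>i\<^sub>j h\<^sub>i\<close>, the lowering operators alone
  generate the submodule of a weight vector that is annihilated by all \<open>e\<^sub>i\<close>.
\<close>

lemma submodule_singular:
  assumes "set is \<subseteq> {..<n}" and e: "\<And>i. i < n \<Longrightarrow> act (chevalley_e n i) (lowering is) = 0"
  shows "submodule (span ((\<lambda>js. lowering (js @ is)) ` {js. set js \<subseteq> {..<n}}))" (is "submodule (span ?G)")
proof (rule submoduleI[OF rank subspace_span])
  have cartan: "act h w \<in> span ?G" if "h \<in> cartan n" "w \<in> span ?G" for h w
  proof (rule act_span_mono[OF _ _ that(2)])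
    show "h \<in> affine_sl n" using that cartan_subset[OF rank] by auto
    show "act h s \<in> span ?G" if "s \<in> ?G" for s
    proof -
      from that obtain js where js: "set js \<subseteq> {..<n}" "s = lowering (js @ is)" by auto
      then have "act h s = scale (of_nat k * fundamental_weight n 0 h - (\<Sum>i\<leftarrow>js @ is. simple_root n i h)) s"
        using cartan_lowering[OF \<open>h \<in> cartan n\<close>, of "js @ is"] assms(1) by simp
      then show ?thesis using that by (simp add: span_scale span_base)
    qed
  qed
  show "act (coroot n i) w \<in> span ?G" if "i < n" "w \<in> span ?G" for i w
    using cartan coroot_in_cartan that by blast
  show "act degree_derivation w \<in> span ?G" if "w \<in> span ?G" for w
    using cartan degree_in_cartan that by blast
  have f: "act (chevalley_f n i) w \<in> span ?G" if "i < n" "w \<in> span ?G" for i w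
  proof (rule act_span_mono[OF _ _ that(2)])
    show "chevalley_f n i \<in> affine_sl n" using that rank by simp
    show "act (chevalley_f n i) s \<in> span ?G" if "s \<in> ?G" for s
    proof -
      from that obtain js where "set js \<subseteq> {..<n}" "s = lowering (js @ is)" by auto
      then show ?thesis using \<open>i < n\<close> by (auto intro!: span_base image_eqI[of _ _ "i # js"])
    qed
  qed
  then show "act (chevalley_f n i) w \<in> span ?G" if "i < n" "w \<in> span ?G" for i w
    using that by blast
  show "act (chevalley_e n i) w \<in> span ?G" if i: "i < n" and "w \<in> span ?G" for i w
  proof (rule act_span_mono[OF _ _ that(2)])
    show "chevalley_e n i \<in> affine_sl n" using i rank by simp
    have "act (chevalley_e n i) (lowering (js @ is)) \<in> span ?G" if "set js \<subseteq> {..<n}" for js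
      using that
    proof (induction js)
      case Nil
      then show ?case using e i by (simp add: span_zero)
    next
      case (Cons j js)
      have "lowering (js @ is) \<in> span ?G" using Cons.prems by (auto intro: span_base)
      then show ?case using Cons i rank f cartan[OF coroot_in_cartan[OF i]]
        by (auto simp: commute_e_f intro!: span_add span_zero)
    qed
    then show "act (chevalley_e n i) s \<in> span ?G" if "s \<in> ?G" for s
      using that by auto
  qed
qed

lemma lowering_span: "span (lowering ` {js. set js \<subseteq> {..<n}}) = UNIV"
proof (rule vac_generates)
  show "submodule (span (lowering ` {js. set js \<subseteq> {..<n}}))"
    using submodule_singular[of "[]"] e_vac by simp
  show "vac \<in> span (lowering ` {js. set js \<subseteq> {..<n}})"
    by (rule span_base) (auto intro!: image_eqI[of _ _ "[]"])
qed

text \<open>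
  All weights of the submodule generated by a singular vector of lower weight differ from the highest
  one by a nonzero sum of simple roots, so that submodule misses \<open>vac\<close> and is zero.
\<close>

lemma singular_vector_zero:
  assumes "is": "set is \<subseteq> {..<n}" "is \<noteq> []" and e: "\<And>i. i < n \<Longrightarrow> act (chevalley_e n i) (lowering is) = 0"
  shows "lowering is = 0"
proof -
  let ?J = "{js. set js \<subseteq> {..<n}}"
  let ?G = "(\<lambda>js. lowering (js @ is)) ` ?J"
  have sub: "submodule (span ?G)" using submodule_singular[OF "is"(1) e] .
  have "vac \<notin> span ?G"
  proof
    assume v: "vac \<in> span ?G"
    let ?X = "\<lambda>js h. of_nat k * fundamental_weight n 0 h - (\<Sum>i\<leftarrow>js @ is. simple_root n i h)"
    let ?m = "\<lambda>h. of_nat k * fundamental_weight n 0 h"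
    have "vac \<in> span ((\<lambda>js. lowering (js @ is)) ` {js \<in> ?J. \<forall>h\<in>cartan n. ?X js h = ?m h})"
    proof (rule weight_component[OF rank _ v])
      show "lowering (js @ is) \<in> weight_space (?X js)" if "js \<in> ?J" for js
        using that "is"(1) lowering_weight[of "js @ is"] by simp
      show "vac \<in> weight_space ?m" using cartan_vac by (simp add: weight_space_def)
    qed
    moreover have "{js \<in> ?J. \<forall>h\<in>cartan n. ?X js h = ?m h} = {}"
    proof -
      have False if js: "js \<in> ?J" and eq: "\<forall>h\<in>cartan n. ?X js h = ?m h" for js
      proof -
        obtain i where i: "i \<in> set is" using "is"(2) by (cases "is") auto
        have "(of_nat (count_list (js @ is) i) :: complex) = 0"
        proof (rule simple_roots_independent[OF rank, where c = "\<lambda>i. of_nat (count_list (js @ is) i)"])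
          show "(\<Sum>i<n. of_nat (count_list (js @ is) i) * simple_root n i h) = 0" if "h \<in> cartan n" for h
          proof -
            have "(\<Sum>i\<leftarrow>js @ is. simple_root n i h) = 0"
              using bspec[OF eq that] by (simp del: map_append sum_list.append)
            then show ?thesis using sum_list_simple_root[of "js @ is" h] js "is"(1)
              by (simp del: map_append sum_list.append count_list_append)
          qed
          show "i < n" using i "is"(1) by auto
        qed
        then have "i \<notin> set (js @ is)" by (metis count_list_0_iff of_nat_eq_0_iff)
        then show False using i by simp
      qed
      then show ?thesis by blast
    qed
    ultimately have "vac \<in> span {}" by (metis image_empty)
    then show False using vac_nonzero by simp
  qed
  then have "span ?G = {0}" using irreducible[OF sub] by blast
  moreover have "lowering is \<in> span ?G" by (rule span_base) (auto intro!: image_eqI[of _ _ "[]"])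
  ultimately show ?thesis by simp
qed

lemma f_vac: "0 < i \<Longrightarrow> i < n \<Longrightarrow> act (chevalley_f n i) vac = 0"
  using singular_vector_zero[of "[i]"] rank
  by (simp add: commute_e_f e_vac act_zero_right cartan_vac coroot_in_cartan fundamental_weight_coroot)

text \<open>
  The computation in the copy of \<open>sl(2)\<close> at node 0. The factor vanishes for \<open>j = k + 1\<close>, and this is
  where the level \<open>k\<close> enters. For \<open>j = 0\<close> the right-hand side is 0 because of the factor \<open>j\<close>.
\<close>

lemma f0_power_vac: "act (chevalley_e n 0) (lowering (replicate j 0)) =
    scale (of_nat j * (of_nat k + 1 - of_nat j)) (lowering (replicate (j - 1) 0))"
proof (induction j)
  case 0
  show ?case using rank by (simp add: e_vac)
next
  case (Suc j)
  have r: "act (coroot n 0) (lowering (replicate j 0)) = scale (of_nat k - 2 * of_nat j) (lowering (replicate j 0))"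
    using rank by (subst cartan_lowering)
      (auto simp: coroot_in_cartan fundamental_weight_coroot sum_list_replicate simple_root_coroot cartan_matrix_def)
  have f: "act (chevalley_f n 0) (scale (of_nat j * c) (lowering (replicate (j - 1) 0))) = scale (of_nat j * c) (lowering (replicate j 0))" for c
    using rank by (cases j) (simp_all add: act_scale_right act_zero_right)
  have "act (chevalley_e n 0) (lowering (replicate (Suc j) 0)) =
      act (chevalley_f n 0) (act (chevalley_e n 0) (lowering (replicate j 0))) + act (coroot n 0) (lowering (replicate j 0))"
    using commute_e_f[OF rank, of 0 0 "lowering (replicate j 0)"] rank by simp
  also have "\<dots> = scale (of_nat j * (of_nat k + 1 - of_nat j) + (of_nat k - 2 * of_nat j)) (lowering (replicate j 0))"
    unfolding Suc f r scale_left_distrib ..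
  also have "of_nat j * (of_nat k + 1 - of_nat j) + (of_nat k - 2 * of_nat j) = of_nat (Suc j) * (of_nat k + 1 - (of_nat (Suc j) :: complex))"
    by (simp add: algebra_simps)
  finally show ?case by simp
qed

lemma f0_power_zero: "lowering (replicate (Suc k) 0) = 0"
proof (rule singular_vector_zero)
  show "act (chevalley_e n i) (lowering (replicate (Suc k) 0)) = 0" if "i < n" for i
  proof (cases "i = 0")
    case True
    then show ?thesis using f0_power_vac[of "Suc k"] by simp
  next
    case False
    have "act (chevalley_e n i) (lowering (replicate j 0)) = 0" for j
      by (induction j) (use that False rank in \<open>simp_all add: e_vac commute_e_f act_zero_right\<close>)
    then show ?thesis .
  qed
qed (use rank in auto)

end

section \<open>The commuting lowering operators\<close>

locale vacuum_window = vacuum_module scale n act k vac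
  for scale :: "complex \<Rightarrow> 'v::ab_group_add \<Rightarrow> 'v" and n :: nat and act :: "affine \<Rightarrow> 'v \<Rightarrow> 'v"
    and k :: nat and vac :: 'v +
  fixes l :: nat
  assumes window_pos: "1 \<le> l" and window_le: "2 * l \<le> n"
begin

lemma window: "a < l \<Longrightarrow> a < n" "b < l \<Longrightarrow> n - 1 - b < n" "a < l \<Longrightarrow> b < l \<Longrightarrow> a \<noteq> n - 1 - b"
    "a < l \<Longrightarrow> b < l \<Longrightarrow> n - 1 - b \<noteq> a" "b < l \<Longrightarrow> d < l \<Longrightarrow> n - 1 - b = n - 1 - d \<longleftrightarrow> b = d"
    "b < l \<Longrightarrow> n - Suc b < n" "a < l \<Longrightarrow> b < l \<Longrightarrow> a \<noteq> n - Suc b"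
    "a < l \<Longrightarrow> b < l \<Longrightarrow> n - Suc b \<noteq> a" "b < l \<Longrightarrow> d < l \<Longrightarrow> n - Suc b = n - Suc d \<longleftrightarrow> b = d"
  using window_le by auto

text \<open>
  The root vectors \<open>y\<^sub>a\<^sub>b\<close>, with \<open>a, b < l\<close>, of the opposite abelian nilradical; \<open>y\<^sub>0\<^sub>0 = f\<^sub>0\<close>.
  Columns are counted from the last one of the matrix, so that \<open>a\<close> and \<open>b\<close> both measure
  the distance from node 0. The value 0 for other indices makes the operators commute without
  side conditions, as needed for folding over multisets.
\<close>

definition ymul :: "nat \<times> nat \<Rightarrow> 'v \<Rightarrow> 'v" where
  "ymul p w = (if fst p < l \<and> snd p < l then act (loop_unit (fst p) (n - 1 - snd p) (- 1)) w else 0)"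

lemma ymul_eq: "a < l \<Longrightarrow> b < l \<Longrightarrow> ymul (a, b) w = act (loop_unit a (n - 1 - b) (- 1)) w"
  by (simp add: ymul_def)

lemma ymul_outside: "\<not> (a < l \<and> b < l) \<Longrightarrow> ymul (a, b) w = 0"
  by (auto simp: ymul_def)

lemma ymul_linear: "ymul p (v + w) = ymul p v + ymul p w" "ymul p (v - w) = ymul p v - ymul p w"
    "ymul p (- w) = - ymul p w" "ymul p 0 = 0" "ymul p (scale c w) = scale c (ymul p w)"
  using window by (auto simp: ymul_def act_add_right act_diff_right act_minus_right act_zero_right act_scale_right)

lemma ymul_sum: "ymul p (\<Sum>i\<in>I. g i) = (\<Sum>i\<in>I. ymul p (g i))"
  by (induction I rule: infinite_finite_induct) (simp_all add: ymul_linear)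

lemma ymul_commute: "ymul p (ymul q w) = ymul q (ymul p w)"
proof -
  obtain a b c d where pq: "p = (a, b)" "q = (c, d)" by (metis surj_pair)
  show ?thesis
  proof (cases "a < l \<and> b < l \<and> c < l \<and> d < l")
    case True
    then show ?thesis
      using commute_loop_unit[of a "n - 1 - b" c "n - 1 - d" "- 1" "- 1" w] window by (simp add: pq ymul_eq)
  next
    case False
    then show ?thesis unfolding pq using ymul_outside[of a b] ymul_outside[of c d] ymul_linear(4) by metis
  qed
qed

sublocale ymul: comp_fun_commute ymul
  by standard (auto simp: ymul_commute)

definition ymonomial :: "(nat \<times> nat) multiset \<Rightarrow> 'v" where
  "ymonomial M = fold_mset ymul vac M"

lemma ymonomial_simps [simp]: "ymonomial {#} = vac" "ymonomial (add_mset p M) = ymul p (ymonomial M)"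
  by (simp_all add: ymonomial_def)

lemma ymonomial_union: "ymonomial (M + N) = fold_mset ymul (ymonomial M) N"
  by (simp add: ymonomial_def ymul.fold_mset_union)

text \<open>
  The root vectors of the Levi part: \<open>row_op a' a\<close> turns row \<open>a\<close> into row \<open>a'\<close>, and \<open>col_op b' b\<close>
  turns column \<open>b\<close> into column \<open>b'\<close> up to sign.
\<close>

definition row_op :: "nat \<Rightarrow> nat \<Rightarrow> 'v \<Rightarrow> 'v" where
  "row_op a' a = act (loop_unit a' a 0)"

definition col_op :: "nat \<Rightarrow> nat \<Rightarrow> 'v \<Rightarrow> 'v" where
  "col_op b' b = act (loop_unit (n - 1 - b) (n - 1 - b') 0)"

text \<open>
  The raising operator opposite to \<open>y\<^sub>a\<^sub>b\<close>.
\<close>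

definition xmul :: "nat \<Rightarrow> nat \<Rightarrow> 'v \<Rightarrow> 'v" where
  "xmul a b = act (loop_unit (n - 1 - b) a 1)"

lemma row_op_linear: 
  assumes "a < l" "a' < l" "a \<noteq> a'"
  shows "row_op a' a (v + w) = row_op a' a v + row_op a' a w" "row_op a' a 0 = 0"
    "row_op a' a (\<Sum>i\<in>I. g i) = (\<Sum>i\<in>I. row_op a' a (g i))"
  using assms window by (simp_all add: row_op_def act_add_right act_zero_right act_sum_right)

lemma col_op_linear: 
  assumes "b < l" "b' < l" "b \<noteq> b'"
  shows "col_op b' b (v + w) = col_op b' b v + col_op b' b w" "col_op b' b 0 = 0"
    "col_op b' b (\<Sum>i\<in>I. g i) = (\<Sum>i\<in>I. col_op b' b (g i))"
  using assms window by (simp_all add: col_op_def act_add_right act_zero_right act_sum_right)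

lemma xmul_linear: 
  assumes "a < l" "b < l"
  shows "xmul a b (v + w) = xmul a b v + xmul a b w" "xmul a b 0 = 0" "xmul a b (- w) = - xmul a b w"
    "xmul a b (\<Sum>i\<in>I. g i) = (\<Sum>i\<in>I. xmul a b (g i))" "xmul a b (scale c w) = scale c (xmul a b w)"
  using assms window by (simp_all add: xmul_def act_add_right act_minus_right act_scale_right act_zero_right act_sum_right)

lemma row_op_ymul:
  assumes "a < l" "a' < l" "a \<noteq> a'"
  shows "row_op a' a (ymul p w) = ymul p (row_op a' a w) + (if fst p = a then ymul (a', snd p) w else 0)"
proof -
  obtain c d where p: "p = (c, d)" by (metis surj_pair)
  show ?thesis
  proof (cases "c < l \<and> d < l")
    case True
    then show ?thesis
      using commute_loop_unit[of a' a c "n - 1 - d" 0 "- 1" w] assms window by (auto simp: p ymul_eq row_op_def)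
  next
    case False
    then show ?thesis using assms by (auto simp: p ymul_outside row_op_linear)
  qed
qed

lemma col_op_ymul:
  assumes "b < l" "b' < l" "b \<noteq> b'"
  shows "col_op b' b (ymul p w) = ymul p (col_op b' b w) - (if snd p = b then ymul (fst p, b') w else 0)"
proof -
  obtain c d where p: "p = (c, d)" by (metis surj_pair)
  show ?thesis
  proof (cases "c < l \<and> d < l")
    case True
    then show ?thesis
      using commute_loop_unit[of "n - 1 - b" "n - 1 - b'" c "n - 1 - d" 0 "- 1" w] assms window
      by (auto simp: p ymul_eq col_op_def)
  next
    case False
    then show ?thesis using assms by (auto simp: p ymul_outside col_op_linear)
  qed
qed

lemma xmul_ymul_disjoint:
  assumes "a < l" "b < l" "c < l" "d < l" "a \<noteq> c" "b \<noteq> d"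
  shows "xmul a b (ymul (c, d) w) = ymul (c, d) (xmul a b w)"
  using commute_loop_unit[of "n - 1 - b" a c "n - 1 - d" 1 "- 1" w] assms window by (simp add: ymul_eq xmul_def)

lemma xmul_ymul_row:
  assumes "a < l" "b < l" "d < l" "b \<noteq> d"
  shows "xmul a b (ymul (a, d) w) = ymul (a, d) (xmul a b w) + col_op d b w"
  using commute_loop_unit[of "n - 1 - b" a a "n - 1 - d" 1 "- 1" w] assms window
  by (simp add: ymul_eq xmul_def col_op_def)

lemma xmul_ymul_col:
  assumes "a < l" "b < l" "c < l" "a \<noteq> c"
  shows "xmul a b (ymul (c, b) w) = ymul (c, b) (xmul a b w) - row_op c a w"
  using commute_loop_unit[of "n - 1 - b" a c "n - 1 - b" 1 "- 1" w] assms window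
  by (simp add: ymul_eq xmul_def row_op_def)

lemma xmul_ymul_same:
  assumes "a < l" "b < l"
  shows "xmul a b (ymul (a, b) w) = ymul (a, b) (xmul a b w)
    + (act (loop_unit (n - 1 - b) (n - 1 - b) 0 - loop_unit a a 0) w + act central w)"
  using commute_opposite[of "n - 1 - b" a 1 "- 1" w] assms window by (simp add: ymul_eq xmul_def)

text \<open>
  As \<open>k\<Lambda>\<^sub>0\<close> vanishes on the coroots other than \<open>h\<^sub>0\<close>, the vector \<open>vac\<close> spans a trivial
  representation of the constant matrices of trace zero.
\<close>

lemma const_vac: "i < n \<Longrightarrow> j < n \<Longrightarrow> i \<noteq> j \<Longrightarrow> act (loop_unit i j 0) vac = 0"
proof (rule offdiag_induct[where P = "\<lambda>i j. act (loop_unit i j 0) vac = 0"])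
  show "act (loop_unit (i - 1) i 0) vac = 0" if "0 < i" "i < n" for i
    using e_vac[of i] that rank by (simp add: chevalley_e_eq)
  show "act (loop_unit i (i - 1) 0) vac = 0" if "0 < i" "i < n" for i
    using f_vac[of i] that by (simp add: chevalley_f_def)
  show "act (loop_unit i s 0) vac = 0"
    if "i < n" "j < n" "s < n" "i \<noteq> j" "j \<noteq> s" "i \<noteq> s" "act (loop_unit i j 0) vac = 0" "act (loop_unit j s 0) vac = 0" for i j s
    using commute_loop_unit[of i j j s 0 0 vac] that by (simp add: act_zero_right)
qed auto

lemma diag_vac: "i < n \<Longrightarrow> j < n \<Longrightarrow> i \<noteq> j \<Longrightarrow> act (loop_unit i i 0 - loop_unit j j 0) vac = 0"
  using commute_opposite[of i j 0 0 vac] const_vac[of i j] const_vac[of j i] by (simp add: act_zero_right)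

lemma central_vac: "act central vac = scale (of_nat k) vac"
  using act_coroot[OF rank, of 0 vac] cartan_vac[OF coroot_in_cartan, of 0] rank diag_vac[of "n - 1" 0]
  by (simp add: fundamental_weight_coroot cpred_def)

lemma xmul_vac: "a < l \<Longrightarrow> b < l \<Longrightarrow> xmul a b vac = 0"
proof -
  assume a: "a < l" and b: "b < l"
  define r where "r = n - 1"
  have r: "r < n" "r \<noteq> 0" "0 < n" using rank by (auto simp: r_def)
  have 0: "act (loop_unit r 0 1) vac = 0" using e_vac[of 0] rank by (simp add: chevalley_e_eq r_def)
  have a0: "act (loop_unit r a 1) vac = 0"
  proof (cases "a = 0")
    case False
    have ra: "a \<noteq> r" "a < n" using a window window_le by (auto simp: r_def)
    show ?thesis
      using commute_loop_unit[of r 0 0 a 1 0 vac] r ra False const_vac[of 0 a] 0 by (simp add: act_zero_right)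
  qed (use 0 in simp)
  have ab: "n - 1 - b \<noteq> a" "n - 1 - b < n" "a < n" "a \<noteq> r" using a b window window_le by (auto simp: r_def)
  show ?thesis
  proof (cases "n - 1 - b = r")
    case True
    then show ?thesis using a0 unfolding xmul_def by simp
  next
    case False
    then show ?thesis
      unfolding xmul_def
      using commute_loop_unit[of "n - 1 - b" r r a 0 1 vac] r ab const_vac[of "n - 1 - b" r] a0
      by (simp add: act_zero_right)
  qed
qed

definition valid :: "(nat \<times> nat) multiset \<Rightarrow> bool" where
  "valid M \<longleftrightarrow> set_mset M \<subseteq> {..<l} \<times> {..<l}"

lemma row_op_ymonomial_zero:
  assumes "a < l" "a' < l" "a \<noteq> a'"
  shows "a \<notin> fst ` set_mset M \<Longrightarrow> row_op a' a (ymonomial M) = 0"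
proof (induction M)
  case empty
  then show ?case using assms window by (simp add: row_op_def const_vac)
next
  case (add p M)
  then show ?case using assms by (simp add: row_op_ymul ymul_linear)
qed

lemma col_op_ymonomial_zero:
  assumes "b < l" "b' < l" "b \<noteq> b'"
  shows "b \<notin> snd ` set_mset M \<Longrightarrow> col_op b' b (ymonomial M) = 0"
proof (induction M)
  case empty
  then show ?case using assms window by (simp add: col_op_def const_vac)
next
  case (add p M)
  then show ?case using assms by (simp add: col_op_ymul ymul_linear)
qed

lemma central_ymonomial: "valid M \<Longrightarrow> act central (ymonomial M) = scale (of_nat k) (ymonomial M)"
proof (induction M)
  case empty
  then show ?case by (simp add: central_vac)
next
  case (add p M)
  have "act central (ymul p (ymonomial M)) = ymul p (act central (ymonomial M))"
    using window by (auto simp: ymul_def commute_central act_zero_right)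
  then show ?case using add by (simp add: valid_def ymul_linear)
qed

text \<open>
  The diagonal matrix \<open>[x\<^sub>a\<^sub>b, y\<^sub>a\<^sub>b] - c\<close> only feels factors in row \<open>a\<close> or column \<open>b\<close>.
\<close>

lemma diag_ymonomial: "valid M \<Longrightarrow> a < l \<Longrightarrow> b < l \<Longrightarrow> a \<notin> fst ` set_mset M \<Longrightarrow> b \<notin> snd ` set_mset M \<Longrightarrow>
  act (loop_unit (n - 1 - b) (n - 1 - b) 0 - loop_unit a a 0) (ymonomial M) = 0"
proof (induction M)
  case empty
  then show ?case using window by (simp add: diag_vac)
next
  case (add p M)
  let ?H = "loop_unit (n - 1 - b) (n - 1 - b) 0 - loop_unit a a 0"
  have "act ?H (ymul p (ymonomial M)) = ymul p (act ?H (ymonomial M))"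
  proof -
    obtain c d where p: "p = (c, d)" by (metis surj_pair)
    show ?thesis
      using commute_diag[of "n - 1 - b" a c "n - 1 - d" 0 "- 1" "ymonomial M"] add.prems window
      by (simp add: p ymul_eq valid_def)
  qed
  then show ?case using add by (simp add: valid_def ymul_linear)
qed

text \<open>
  Commuting \<open>x\<^sub>a\<^sub>b\<close> past a factor in another row produces at most a row operation out of row \<open>a\<close>,
  which finds nothing to act on.
\<close>

lemma xmul_ymonomial_zero: "valid M \<Longrightarrow> a < l \<Longrightarrow> b < l \<Longrightarrow> a \<notin> fst ` set_mset M \<Longrightarrow> xmul a b (ymonomial M) = 0"
proof (induction M)
  case empty
  then show ?case by (simp add: xmul_vac)
next
  case (add p M)
  obtain c d where p: "p = (c, d)" by force
  have cd: "c < l" "d < l" "a \<noteq> c" using add.prems p by (auto simp: valid_def)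
  have IH: "xmul a b (ymonomial M) = 0" using add by (simp add: valid_def)
  show ?case
  proof (cases "b = d")
    case True
    have "row_op c a (ymonomial M) = 0"
      using add.prems cd by (intro row_op_ymonomial_zero) auto
    then show ?thesis using xmul_ymul_col[of a b c] add.prems cd IH True p by (simp add: ymul_linear)
  next
    case False
    then show ?thesis using xmul_ymul_disjoint add.prems cd IH p by (simp add: ymul_linear)
  qed
qed

definition yprod :: "nat set \<Rightarrow> (nat \<Rightarrow> nat) \<Rightarrow> (nat \<Rightarrow> nat) \<Rightarrow> 'v" where
  "yprod I A B = ymonomial (image_mset (\<lambda>i. (A i, B i)) (mset_set I))"

lemma yprod_insert: "finite I \<Longrightarrow> i \<notin> I \<Longrightarrow> yprod (insert i I) A B = ymul (A i, B i) (yprod I A B)"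
  by (simp add: yprod_def)

lemma yprod_empty [simp]: "yprod {} A B = vac"
  by (simp add: yprod_def)

lemma yprod_cong: "(\<And>i. i \<in> I \<Longrightarrow> A i = A' i) \<Longrightarrow> (\<And>i. i \<in> I \<Longrightarrow> B i = B' i) \<Longrightarrow> yprod I A B = yprod I A' B'"
  unfolding yprod_def by (cases "finite I") (auto intro!: arg_cong[of _ _ ymonomial] image_mset_cong)

lemma yprod_permute:
  assumes "r permutes I"
  shows "yprod I (A \<circ> r) (B \<circ> r) = yprod I A B"
proof -
  have "image_mset (\<lambda>i. (A i, B i)) (mset_set I) = image_mset (\<lambda>i. (A i, B i)) (image_mset r (mset_set I))"
    using assms image_mset_mset_set[of r I] by (simp add: permutes_image permutes_inj_on)
  then show ?thesis by (simp add: yprod_def multiset.map_comp comp_def)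
qed

lemma row_op_yprod:
  assumes "a < l" "a' < l" "a \<noteq> a'" "finite I"
  shows "row_op a' a (yprod I A B) = (\<Sum>i\<in>I. if A i = a then yprod I (A(i := a')) B else 0)"
  using assms(4)
proof (induction I)
  case empty
  show ?case using assms window by (simp add: row_op_def const_vac)
next
  case (insert i I)
  have "yprod (insert i I) (A(j := a')) B = ymul (A i, B i) (yprod I (A(j := a')) B)" if "j \<in> I" for j
    using insert that by (subst yprod_insert) auto
  moreover have "yprod (insert i I) (A(i := a')) B = ymul (a', B i) (yprod I A B)"
  proof -
    have "yprod I (A(i := a')) B = yprod I A B" using insert.hyps by (intro yprod_cong) auto
    then show ?thesis using insert.hyps by (subst yprod_insert) auto
  qed
  ultimately have t: "ymul (A i, B i) (\<Sum>j\<in>I. if A j = a then yprod I (A(j := a')) B else 0) =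
      (\<Sum>j\<in>I. if A j = a then yprod (insert i I) (A(j := a')) B else 0)"
    "(if A i = a then ymul (a', B i) (yprod I A B) else 0) = (if A i = a then yprod (insert i I) (A(i := a')) B else 0)"
    unfolding ymul_sum by (auto intro!: sum.cong simp: ymul_linear)
  show ?case
    unfolding yprod_insert[OF insert.hyps, of A B] row_op_ymul[OF assms(1-3)] fst_conv snd_conv insert.IH
      sum.insert[OF insert.hyps] t
    by (rule add.commute)
qed

lemma col_op_yprod:
  assumes "b < l" "b' < l" "b \<noteq> b'" "finite I"
  shows "col_op b' b (yprod I A B) = (\<Sum>i\<in>I. if B i = b then - yprod I A (B(i := b')) else 0)"
  using assms(4)
proof (induction I)
  case empty
  show ?case using assms window by (simp add: col_op_def const_vac)
next
  case (insert i I)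
  have "yprod (insert i I) A (B(j := b')) = ymul (A i, B i) (yprod I A (B(j := b')))" if "j \<in> I" for j
    using insert that by (subst yprod_insert) auto
  moreover have "yprod (insert i I) A (B(i := b')) = ymul (A i, b') (yprod I A B)"
  proof -
    have "yprod I A (B(i := b')) = yprod I A B" using insert.hyps by (intro yprod_cong) auto
    then show ?thesis using insert.hyps by (subst yprod_insert) auto
  qed
  ultimately have t: "ymul (A i, B i) (\<Sum>j\<in>I. if B j = b then - yprod I A (B(j := b')) else 0) =
      (\<Sum>j\<in>I. if B j = b then - yprod (insert i I) A (B(j := b')) else 0)"
    "(if B i = b then ymul (A i, b') (yprod I A B) else 0) = - (if B i = b then - yprod (insert i I) A (B(i := b')) else 0)"
    unfolding ymul_sum by (auto intro!: sum.cong simp: ymul_linear)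
  show ?case
    unfolding yprod_insert[OF insert.hyps, of A B] col_op_ymul[OF assms(1-3)] fst_conv snd_conv insert.IH
      sum.insert[OF insert.hyps] t diff_minus_eq_add
    by (rule add.commute)
qed

section \<open>Permanents annihilate the vacuum\<close>

text \<open>
  The permanent of the array \<open>y\<^sub>A\<^sub>(\<^sub>i\<^sub>)\<^sub>,\<^sub>B\<^sub>(\<^sub>j\<^sub>)\<close> with \<open>i, j \<in> I\<close>, applied to \<open>vac\<close>. Rows and columns may
  repeat.
\<close>

definition permanent :: "nat set \<Rightarrow> (nat \<Rightarrow> nat) \<Rightarrow> (nat \<Rightarrow> nat) \<Rightarrow> 'v" where
  "permanent I A B = (\<Sum>p | p permutes I. yprod I A (B \<circ> p))"

lemma permanent_alt: "finite I \<Longrightarrow> permanent I A B = (\<Sum>p | p permutes I. yprod I (A \<circ> p) B)"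
proof -
  assume I: "finite I"
  have "permanent I A B = (\<Sum>p | p permutes I. yprod I A (B \<circ> inv p))"
    unfolding permanent_def by (rule sum_permutations_inverse)
  also have "\<dots> = (\<Sum>p | p permutes I. yprod I (A \<circ> p) B)"
  proof (rule sum.cong[OF refl])
    fix p assume "p \<in> {p. p permutes I}"
    then have p: "p permutes I" by simp
    have "yprod I (A \<circ> p) (B \<circ> inv p \<circ> p) = yprod I A (B \<circ> inv p)"
      by (rule yprod_permute[OF p])
    moreover have "B \<circ> inv p \<circ> p = B" using permutes_inv_o(2)[OF p] by (simp add: comp_assoc)
    ultimately show "yprod I A (B \<circ> inv p) = yprod I (A \<circ> p) B" by simp
  qed
  finally show ?thesis .
qed

lemma permanent_permute_left:
  assumes "finite I" "r permutes I"
  shows "permanent I (A \<circ> r) B = permanent I A B"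
proof -
  have "permanent I (A \<circ> r) B = (\<Sum>p | p permutes I. yprod I (A \<circ> (r \<circ> p)) B)"
    unfolding permanent_alt[OF assms(1)] by (simp add: comp_assoc)
  also have "\<dots> = (\<Sum>p | p permutes I. yprod I (A \<circ> p) B)"
    using setum_permutations_compose_left[OF assms(2), of "\<lambda>p. yprod I (A \<circ> p) B"] by simp
  finally show ?thesis unfolding permanent_alt[OF assms(1)] .
qed

lemma permanent_permute_right:
  assumes "finite I" "r permutes I"
  shows "permanent I A (B \<circ> r) = permanent I A B"
proof -
  have "permanent I A (B \<circ> r) = (\<Sum>p | p permutes I. yprod I A (B \<circ> (r \<circ> p)))"
    unfolding permanent_def by (simp add: comp_assoc)
  also have "\<dots> = (\<Sum>p | p permutes I. yprod I A (B \<circ> p))"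
    using setum_permutations_compose_left[OF assms(2), of "\<lambda>p. yprod I A (B \<circ> p)"] by simp
  finally show ?thesis unfolding permanent_def .
qed

text \<open>
  Let \<open>F\<close> be a symmetric function of a family of indices and let \<open>T b\<close> act as the derivation that
  replaces one index 0 by \<open>b\<close>. To reach \<open>A\<close>, set one of its nonzero entries to 0 and apply \<open>T\<close>:
  by symmetry, each of the resulting terms equals \<open>F A\<close>. So \<open>F\<close> vanishes as soon
  as it vanishes on the constant family 0. It is applied to the columns of a permanent and
  then to its rows.
\<close>

lemma polarization:
  fixes F :: "(nat \<Rightarrow> nat) \<Rightarrow> 'v"
  assumes I: "finite I"
    and cong: "\<And>A A'. (\<And>i. i \<in> I \<Longrightarrow> A i = A' i) \<Longrightarrow> F A = F A'"
    and sym: "\<And>r A. r permutes I \<Longrightarrow> F (A \<circ> r) = F A"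
    and T: "\<And>b A. 0 < b \<Longrightarrow> b < l \<Longrightarrow> T b (F A) = scale c (\<Sum>i\<in>I. if A i = 0 then F (A(i := b)) else 0)"
    and T0: "\<And>b. 0 < b \<Longrightarrow> b < l \<Longrightarrow> T b 0 = 0" and c: "c \<noteq> 0"
    and base: "F (\<lambda>i. 0) = 0"
    and A: "\<And>i. i \<in> I \<Longrightarrow> A i < l"
  shows "F A = 0"
  using A
proof (induction "card {i \<in> I. A i \<noteq> 0}" arbitrary: A)
  case 0
  then have "A i = 0" if "i \<in> I" for i using I that by auto
  then show ?case using cong[of A "\<lambda>i. 0"] base by simp
next
  case (Suc m)
  from Suc.hyps(2) have "{i \<in> I. A i \<noteq> 0} \<noteq> {}" by (metis card.empty nat.simps(3))
  then obtain j where j: "j \<in> I" "A j \<noteq> 0" by blast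
  define B where "B = A(j := 0)"
  have "{i \<in> I. B i \<noteq> 0} = {i \<in> I. A i \<noteq> 0} - {j}" by (auto simp: B_def)
  then have "m = card {i \<in> I. B i \<noteq> 0}" using Suc.hyps(2) j I by simp
  moreover have "B i < l" if "i \<in> I" for i using Suc.prems[OF that] by (auto simp: B_def)
  ultimately have B0: "F B = 0" by (rule Suc.hyps(1))
  \<comment> \<open>Moving the restored entry from place \<open>j\<close> to place \<open>i\<close> is a transposition of the family.\<close>
  have same: "F (B(i := A j)) = F A" if "i \<in> I" "B i = 0" for i
  proof -
    have "B(i := A j) = A \<circ> Transposition.transpose i j"
      using that by (auto simp: fun_eq_iff B_def Transposition.transpose_def)
    then show ?thesis using sym[of "Transposition.transpose i j" A] permutes_swap_id[of i I j] that(1) j(1) by simp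
  qed
  have "0 = scale c (\<Sum>i\<in>I. if B i = 0 then F (B(i := A j)) else 0)"
    using T[of "A j" B] T0[of "A j"] j Suc.prems[OF j(1)] B0 by simp
  also have "(\<Sum>i\<in>I. if B i = 0 then F (B(i := A j)) else 0) = (\<Sum>i\<in>I. if B i = 0 then F A else 0)"
    by (intro sum.cong refl) (simp add: same)
  also have "\<dots> = (\<Sum>i\<in>{i\<in>I. B i = 0}. F A)" using I by (simp add: sum.If_cases Int_def)
  also have "\<dots> = scale (of_nat (card {i\<in>I. B i = 0})) (F A)"
    by (rule sum_constant_scale)
  finally have "c = 0 \<or> (of_nat (card {i\<in>I. B i = 0}) :: complex) = 0 \<or> F A = 0" by simp
  moreover have "card {i\<in>I. B i = 0} \<noteq> 0"
  proof -
    have "j \<in> {i\<in>I. B i = 0}" using j by (simp add: B_def)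
    moreover have fin: "finite {i\<in>I. B i = 0}" using I by simp
    ultimately show ?thesis using card_0_eq[OF fin] by auto
  qed
  ultimately show ?case using c by simp
qed

lemma permanent_cong: "(\<And>i. i \<in> I \<Longrightarrow> A i = A' i) \<Longrightarrow> (\<And>i. i \<in> I \<Longrightarrow> B i = B' i) \<Longrightarrow> permanent I A B = permanent I A' B'"
  unfolding permanent_def by (intro sum.cong yprod_cong) (auto simp: permutes_in_image)

lemma permanent_zero:
  assumes I: "finite I" "card I = Suc k"
    and A: "\<And>i. i \<in> I \<Longrightarrow> A i < l" and B: "\<And>i. i \<in> I \<Longrightarrow> B i < l"
  shows "permanent I A B = 0"
proof -
  have 0: "permanent I (\<lambda>i. 0) (\<lambda>i. 0) = 0"
  proof -
    have "ymonomial (replicate_mset j (0, 0)) = lowering (replicate j 0)" for j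
      using window_pos by (induction j) (auto simp: ymul_def chevalley_f_def)
    from this[of "Suc k"] have "ymonomial (replicate_mset (Suc k) (0, 0)) = 0" by (simp only: f0_power_zero)
    then have "yprod I (\<lambda>i. 0) (\<lambda>i. 0) = 0"
      unfolding yprod_def image_mset_const_eq size_mset_set I .
    then show ?thesis by (simp add: permanent_def comp_def)
  qed
  have 1: "permanent I (\<lambda>i. 0) B' = 0" if "\<And>i. i \<in> I \<Longrightarrow> B' i < l" for B'
  proof (rule polarization[where F = "\<lambda>B. permanent I (\<lambda>i. 0) B" and T = "\<lambda>b. col_op b 0" and c = "- 1" and I = I])
    show "col_op b 0 (permanent I (\<lambda>i. 0) B) = scale (- 1) (\<Sum>i\<in>I. if B i = 0 then permanent I (\<lambda>i. 0) (B(i := b)) else 0)"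
      if b: "0 < b" "b < l" for b B
    proof -
      have "col_op b 0 (permanent I (\<lambda>i. 0) B) = (\<Sum>p | p permutes I. \<Sum>i\<in>I. if B i = 0 then - yprod I ((\<lambda>i. 0) \<circ> p) (B(i := b)) else 0)"
        using b I window_pos by (simp add: permanent_alt col_op_linear col_op_yprod)
      also have "\<dots> = (\<Sum>i\<in>I. \<Sum>p | p permutes I. if B i = 0 then - yprod I ((\<lambda>i. 0) \<circ> p) (B(i := b)) else 0)"
        by (rule sum.swap)
      also have "\<dots> = (\<Sum>i\<in>I. - (if B i = 0 then permanent I (\<lambda>i. 0) (B(i := b)) else 0))"
        by (intro sum.cong refl) (simp add: permanent_alt[OF I(1)] sum_negf)
      finally show ?thesis by (simp add: sum_negf)
    qed
    show "permanent I (\<lambda>i. 0) B = permanent I (\<lambda>i. 0) B''" if "\<And>i. i \<in> I \<Longrightarrow> B i = B'' i" for B B''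
      using that by (intro permanent_cong) auto
    show "col_op b 0 0 = 0" if "0 < b" "b < l" for b
      using that by (intro col_op_linear) auto
  qed (simp_all add: I 0 that permanent_permute_right)
  show ?thesis
  proof (rule polarization[where F = "\<lambda>A. permanent I A B" and T = "\<lambda>b. row_op b 0" and c = 1 and I = I])
    show "row_op b 0 (permanent I A B) = scale 1 (\<Sum>i\<in>I. if A i = 0 then permanent I (A(i := b)) B else 0)"
      if b: "0 < b" "b < l" for b A
    proof -
      have "row_op b 0 (permanent I A B) = (\<Sum>p | p permutes I. \<Sum>i\<in>I. if A i = 0 then yprod I (A(i := b)) (B \<circ> p) else 0)"
        using b I window_pos by (simp add: permanent_def row_op_linear row_op_yprod)
      also have "\<dots> = (\<Sum>i\<in>I. \<Sum>p | p permutes I. if A i = 0 then yprod I (A(i := b)) (B \<circ> p) else 0)"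
        by (rule sum.swap)
      also have "\<dots> = (\<Sum>i\<in>I. (if A i = 0 then permanent I (A(i := b)) B else 0))"
        by (intro sum.cong refl) (simp add: permanent_def)
      finally show ?thesis by simp
    qed
    show "permanent I A B = permanent I A' B" if "\<And>i. i \<in> I \<Longrightarrow> A i = A' i" for A A'
      using that by (intro permanent_cong) auto
    show "row_op b 0 0 = 0" if "0 < b" "b < l" for b
      using that by (intro row_op_linear) auto
  qed (simp_all add: I 1 A B permanent_permute_left)
qed

end

section \<open>Colourings and the lexicographic order\<close>

text \<open>
  Colourings are undefined outside \<open>{..<m}\<close>, where permutations of \<open>{..<m}\<close> are the identity; so
  composing with such a permutation needs no restriction.
\<close>

definition colourings :: "nat \<Rightarrow> nat \<Rightarrow> (nat \<Rightarrow> nat) set" where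
  "colourings k m = {..<m} \<rightarrow>\<^sub>E {..<k}"

lemma finite_colourings [simp]: "finite (colourings k m)"
  by (simp add: colourings_def finite_PiE)

lemma colourings_permute:
  assumes "p permutes {..<m}" "g \<in> colourings k m"
  shows "g \<circ> p \<in> colourings k m"
proof -
  have "p i \<in> {..<m}" if "i < m" for i using permutes_in_image[OF assms(1), of i] that by simp
  moreover have "p i = i" if "\<not> i < m" for i using permutes_not_in[OF assms(1), of i] that by simp
  ultimately show ?thesis using assms(2) by (auto simp: colourings_def PiE_iff extensional_def)
qed

text \<open>
  The next two lemmas are the recursion for \<open>k\<close> to the number of cycles: a new fixed point may be
  coloured freely, whereas a new point that is inserted into an existing cycle is bound to its colour.
\<close>

lemma card_fixed_Suc:
  assumes p: "p permutes {..<m}"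
  shows "card {g \<in> colourings k (Suc m). g \<circ> p = g} = k * card {g \<in> colourings k m. g \<circ> p = g}"
proof -
  have pm: "p m = m" using p by (auto intro: permutes_not_in)
  have lt: "p i < m \<longleftrightarrow> i < m" for i using permutes_in_image[OF p, of i] by simp
  have upd: "g(m := y) \<circ> p = g(m := y) \<longleftrightarrow> g \<circ> p = g" for g :: "nat \<Rightarrow> nat" and y
  proof -
    have "p i = m \<longleftrightarrow> i = m" for i using pm permutes_inj[OF p] by (metis injD)
    then have "(g(m := y)) (p i) = (g(m := y)) i \<longleftrightarrow> g (p i) = g i" for i
    proof (cases "i = m")
      case True
      then show ?thesis by (simp only: pm refl)
    qed simp
    then show ?thesis by (simp only: fun_eq_iff comp_apply)
  qed
  have "colourings k (Suc m) = (\<lambda>(y, g). g(m := y)) ` ({..<k} \<times> colourings k m)"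
    unfolding colourings_def lessThan_Suc PiE_insert_eq ..
  then have "{g \<in> colourings k (Suc m). g \<circ> p = g} = (\<lambda>(y, g). g(m := y)) ` ({..<k} \<times> {g \<in> colourings k m. g \<circ> p = g})"
    using upd by auto
  moreover have "inj_on (\<lambda>(y, g). g(m := y)) ({..<k} \<times> {g \<in> colourings k m. g \<circ> p = g})"
    by (rule inj_on_subset[OF inj_combinator[of m "{..<m}" "\<lambda>_. {..<k}"]]) (auto simp: colourings_def)
  ultimately show ?thesis by (simp add: card_image card_cartesian_product)
qed

lemma card_fixed_transpose:
  assumes p: "p permutes {..<m}" and b: "b < m"
  shows "card {g \<in> colourings k (Suc m). g \<circ> (transpose m b \<circ> p) = g} = card {g \<in> colourings k m. g \<circ> p = g}"
proof -
  let ?A = "{g \<in> colourings k (Suc m). g \<circ> (transpose m b \<circ> p) = g}"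
  let ?B = "{g \<in> colourings k m. g \<circ> p = g}"
  have pm: "p m = m" using p by (auto intro: permutes_not_in)
  have pim: "p i = m \<longleftrightarrow> i = m" for i using pm permutes_inj[OF p] by (metis injD)
  have A: "g m = g b \<and> (\<forall>i. i \<noteq> m \<longrightarrow> g (p i) = g i)" if "g \<circ> (transpose m b \<circ> p) = g" for g :: "nat \<Rightarrow> nat"
  proof -
    from fun_cong[OF that] have e: "g (transpose m b (p i)) = g i" for i by (simp only: comp_apply)
    have mb: "g m = g b" using e[of m] unfolding pm transpose_apply_first by (rule sym)
    have tr: "g (transpose m b j) = g j" for j
    proof -
      consider "j = m" | "j = b" | "j \<noteq> m" "j \<noteq> b" by blast
      then show ?thesis
      proof cases
        case 1
        show ?thesis unfolding 1 transpose_apply_first by (rule mb[symmetric])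
      next
        case 2
        show ?thesis unfolding 2 transpose_apply_second by (rule mb)
      qed simp
    qed
    have "g (p i) = g i" for i by (rule trans[OF tr[symmetric] e])
    then show ?thesis using mb by blast
  qed
  have "bij_betw (\<lambda>g. g(m := undefined)) ?A ?B"
  proof (rule bij_betw_byWitness[where f' = "\<lambda>g. g(m := g b)"])
    show "\<forall>g\<in>?A. (g(m := undefined))(m := (g(m := undefined)) b) = g"
    proof
      fix g assume "g \<in> ?A"
      then have "g m = g b" using A by blast
      then have "g(m := g b) = g" by (rule fun_upd_idem)
      then show "(g(m := undefined))(m := (g(m := undefined)) b) = g" using b by simp
    qed
    show "\<forall>g\<in>?B. (g(m := g b))(m := undefined) = g"
    proof
      fix g assume "g \<in> ?B"
      then have "g m = undefined" by (simp add: colourings_def PiE_iff extensional_def)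
      then show "(g(m := g b))(m := undefined) = g" unfolding fun_upd_upd by (rule fun_upd_idem)
    qed
    show "(\<lambda>g. g(m := undefined)) ` ?A \<subseteq> ?B"
    proof (intro image_subsetI CollectI conjI)
      fix g assume g: "g \<in> ?A"
      then show "g(m := undefined) \<in> colourings k m"
      proof -
        have "g \<in> colourings k (Suc m)" using g by blast
        then show ?thesis by (auto simp: colourings_def PiE_iff extensional_def)
      qed
      show "g(m := undefined) \<circ> p = g(m := undefined)"
      proof
        fix i
        have "i \<noteq> m \<longrightarrow> g (p i) = g i" using A g by blast
        then show "(g(m := undefined) \<circ> p) i = (g(m := undefined)) i"
          using pim[of i] by simp
      qed
    qed
    show "(\<lambda>g. g(m := g b)) ` ?B \<subseteq> ?A"
    proof (intro image_subsetI CollectI conjI)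
      fix g assume g: "g \<in> ?B"
      then show "g(m := g b) \<in> colourings k (Suc m)"
      proof -
        have "g \<in> colourings k m" using g by blast
        then show ?thesis using b by (auto simp: colourings_def PiE_iff extensional_def)
      qed
      have "g \<circ> p = g" using g by blast
      from fun_cong[OF this] have e: "g (p i) = g i" for i by (simp only: comp_apply)
      have tr: "(g(m := g b)) (transpose m b j) = (g(m := g b)) j" for j
        using b by (cases "j = m"; cases "j = b") (simp_all add: transpose_def)
      have "(g(m := g b)) (p i) = (g(m := g b)) i" for i
      proof (cases "i = m")
        case True
        then show ?thesis by (simp only: pm)
      next
        case False
        then show ?thesis using e[of i] pim[of i] by simp
      qed
      then show "g(m := g b) \<circ> (transpose m b \<circ> p) = g(m := g b)"
        by (intro ext) (simp only: comp_apply tr)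
    qed
  qed
  then show ?thesis by (rule bij_betw_same_card)
qed

lemma card_fixed_quotient:
  assumes s: "s permutes {..<m}" and t: "t permutes {..<m}"
  shows "card {g \<in> colourings k m. g \<circ> (inv t \<circ> s) = g} = card {g \<in> colourings k m. g \<circ> s = g \<circ> t}"
proof -
  let ?A = "{g \<in> colourings k m. g \<circ> (inv t \<circ> s) = g}" and ?B = "{g \<in> colourings k m. g \<circ> s = g \<circ> t}"
  have i: "inv t \<circ> t = id" "t \<circ> inv t = id" using permutes_inv_o[OF t] by auto
  have "bij_betw (\<lambda>g. g \<circ> inv t) ?A ?B"
  proof (rule bij_betw_byWitness[where f' = "\<lambda>g. g \<circ> t"])
    show "\<forall>g\<in>?A. (g \<circ> inv t) \<circ> t = g" "\<forall>g\<in>?B. (g \<circ> t) \<circ> inv t = g"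
      by (simp_all only: comp_assoc i comp_id simp_thms ball_simps)
    show "(\<lambda>g. g \<circ> inv t) ` ?A \<subseteq> ?B"
    proof (intro image_subsetI CollectI conjI)
      fix g assume g: "g \<in> ?A"
      show "g \<circ> inv t \<in> colourings k m" using colourings_permute[OF permutes_inv[OF t]] g by blast
      have "(g \<circ> inv t) \<circ> s = g" using g by (simp only: comp_assoc mem_Collect_eq)
      then show "(g \<circ> inv t) \<circ> s = (g \<circ> inv t) \<circ> t" by (simp only: comp_assoc i comp_id)
    qed
    show "(\<lambda>g. g \<circ> t) ` ?B \<subseteq> ?A"
    proof (intro image_subsetI CollectI conjI)
      fix g assume g: "g \<in> ?B"
      show "g \<circ> t \<in> colourings k m" using colourings_permute[OF t] g by blast
      have "(g \<circ> t) \<circ> (inv t \<circ> s) = g \<circ> (t \<circ> inv t) \<circ> s" by (simp only: comp_assoc)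
      also have "\<dots> = g \<circ> s" by (simp only: i comp_id)
      also have "\<dots> = g \<circ> t" using g by blast
      finally show "(g \<circ> t) \<circ> (inv t \<circ> s) = g \<circ> t" .
    qed
  qed
  then show ?thesis by (rule bij_betw_same_card)
qed

definition lexless :: "(nat \<Rightarrow> nat) \<Rightarrow> (nat \<Rightarrow> nat) \<Rightarrow> bool" where
  "lexless s t \<longleftrightarrow> (\<exists>x. (\<forall>y<x. s y = t y) \<and> s x < t x)"

lemma lexless_irrefl: "\<not> lexless s s"
  by (simp add: lexless_def)

lemma lexless_trans: "lexless r s \<Longrightarrow> lexless s t \<Longrightarrow> lexless r t"
proof -
  assume "lexless r s" "lexless s t"
  then obtain x x' where x: "\<forall>y<x. r y = s y" "r x < s x" and x': "\<forall>y<x'. s y = t y" "s x' < t x'"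
    unfolding lexless_def by blast
  show ?thesis unfolding lexless_def
  proof (intro exI[of _ "min x x'"] conjI allI impI)
    show "r y = t y" if "y < min x x'" for y using x x' that by simp
    show "r (min x x') < t (min x x')"
      using x x' by (cases x x' rule: linorder_cases) (auto simp: min_def)
  qed
qed

lemma wf_lexless:
  assumes "finite P"
  shows "wf {(s, t) \<in> P \<times> P. lexless s t}" "wf {(t, s) \<in> P \<times> P. lexless s t}"
proof -
  let ?r = "{(s, t) \<in> P \<times> P. lexless s t}"
  have "trans ?r" using lexless_trans by (auto intro!: transI)
  then have "acyclic ?r" using lexless_irrefl by (auto simp: acyclic_irrefl trancl_id irrefl_def)
  moreover have "finite ?r" by (rule finite_subset[of _ "P \<times> P"]) (use assms in auto)
  ultimately show "wf ?r" by (simp add: finite_acyclic_wf)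
  have "wf (?r\<inverse>)" using \<open>finite ?r\<close> \<open>acyclic ?r\<close> by (rule finite_acyclic_wf_converse)
  moreover have "?r\<inverse> = {(t, s) \<in> P \<times> P. lexless s t}" by auto
  ultimately show "wf {(t, s) \<in> P \<times> P. lexless s t}" by simp
qed

definition decreasing_on :: "(nat \<Rightarrow> nat) \<Rightarrow> nat set \<Rightarrow> bool" where
  "decreasing_on s P \<longleftrightarrow> (\<forall>x\<in>P. \<forall>y\<in>P. x < y \<longrightarrow> s y < s x)"

definition avoiders :: "nat \<Rightarrow> nat \<Rightarrow> (nat \<Rightarrow> nat) set" where
  "avoiders k l = {s. s permutes {..<l} \<and> \<not> (\<exists>P\<subseteq>{..<l}. card P = Suc k \<and> decreasing_on s P)}"

lemma finite_avoiders: "finite (avoiders k l)"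
  by (rule finite_subset[OF _ finite_permutations[of "{..<l}"]]) (auto simp: avoiders_def)

text \<open>
  The first position moved by \<open>p\<close> receives a value from a later position of \<open>P\<close>, where \<open>s\<close> is
  smaller.
\<close>

lemma lexless_rearrange_decreasing:
  assumes s: "s permutes {..<l}" and P: "P \<subseteq> {..<l}" "decreasing_on s P"
    and p: "p permutes P" "p \<noteq> id"
  shows "lexless (s \<circ> p) s"
proof -
  have "\<exists>x. p x \<noteq> x" using p(2) by (auto simp: fun_eq_iff)
  define x where "x = (LEAST x. p x \<noteq> x)"
  have x: "p x \<noteq> x" and below: "p y = y" if "y < x" for y
    using LeastI_ex[OF \<open>\<exists>x. p x \<noteq> x\<close>] not_less_Least that unfolding x_def by blast+
  have px: "p x \<noteq> x" using LeastI_ex[OF \<open>\<exists>x. p x \<noteq> x\<close>] unfolding x_def .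
  then have xP: "x \<in> P" using p(1) permutes_not_in by metis
  then have pxP: "p x \<in> P" using permutes_in_image[OF p(1)] by simp
  have "\<not> p x < x" using below[of "p x"] permutes_inj[OF p(1)] px by (metis injD)
  then have "x < p x" using px by simp
  then have "s (p x) < s x" using P(2) xP pxP unfolding decreasing_on_def by blast
  then show ?thesis using below unfolding lexless_def by (intro exI[of _ x]) simp
qed

text \<open>
  Colour \<open>x\<close> by the size of a largest decreasing set of positions that ends at \<open>x\<close>. If \<open>s\<close> descends
  from \<open>x\<close> to a later \<open>y\<close>, then \<open>y\<close> extends every such set at \<open>x\<close> and gets a greater colour.
\<close>

lemma avoider_colouring:
  assumes "s \<in> avoiders k l"
  obtains f where "f \<in> colourings k l" "\<And>x y. x < y \<Longrightarrow> y < l \<Longrightarrow> f x = f y \<Longrightarrow> s x < s y"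
proof -
  define S where "S x = {P. P \<subseteq> {..x} \<and> x \<in> P \<and> decreasing_on s P}" for x
  define c where "c x = Max (card ` S x)" for x
  have fin: "finite (S x)" for x
    by (rule finite_subset[of _ "Pow {..x}"]) (auto simp: S_def)
  have ne: "{x} \<in> S x" for x by (auto simp: S_def decreasing_on_def)
  have cin: "c x \<in> card ` S x" for x unfolding c_def using fin ne by (intro Max_in) auto
  have cge: "card P \<le> c x" if "P \<in> S x" for x P unfolding c_def using fin that by (intro Max_ge) auto
  have c1: "1 \<le> c x" for x using cge[OF ne, of x] by simp
  have ck: "c x \<le> k" if "x < l" for x
  proof (rule ccontr)
    assume "\<not> c x \<le> k"
    obtain P where P: "P \<in> S x" "c x = card P" using cin by blast
    then obtain Q where "Q \<subseteq> P" "card Q = Suc k"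
      using \<open>\<not> c x \<le> k\<close> obtain_subset_with_card_n[of "Suc k" P] by (metis not_less_eq_eq)
    then have "Q \<subseteq> {..<l}" "decreasing_on s Q" using P that by (auto simp: S_def decreasing_on_def)
    then show False using assms \<open>card Q = Suc k\<close> by (auto simp: avoiders_def)
  qed
  have step: "c x < c y" if "x < y" "s y < s x" for x y
  proof -
    obtain P where P: "P \<in> S x" "c x = card P" using cin by blast
    have fP: "finite P" "y \<notin> P" using P that by (auto simp: S_def intro: finite_subset)
    have "decreasing_on s (insert y P)"
      unfolding decreasing_on_def
    proof (intro ballI impI)
      fix u w assume uw: "u \<in> insert y P" "w \<in> insert y P" "u < w"
      have le: "u \<in> P \<Longrightarrow> u \<le> x" "w \<in> P \<Longrightarrow> w \<le> x" using P by (auto simp: S_def)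
      have sx: "s x \<le> s u" if "u \<in> P"
      proof (cases "u = x")
        case False
        then have "u < x" "x \<in> P" using P le(1)[OF that] by (simp_all add: S_def)
        then have "s x < s u" using P(1) that unfolding S_def decreasing_on_def by blast
        then show ?thesis by simp
      qed simp
      show "s w < s u"
      proof (cases "w = y")
        case True
        then show ?thesis using uw sx \<open>s y < s x\<close> by auto
      next
        case False
        then have "w \<in> P" "u \<in> P" using uw le \<open>x < y\<close> by auto
        then show ?thesis using P(1) uw(3) unfolding S_def decreasing_on_def by blast
      qed
    qed
    moreover have "insert y P \<subseteq> {..y}" using P that by (auto simp: S_def)
    ultimately have "insert y P \<in> S y" by (simp add: S_def)
    from cge[OF this] show ?thesis using fP P by simp
  qed
  \<comment> \<open>The sizes \<open>c x\<close> run from 1 to \<open>k\<close>, the colours from 0.\<close>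
  show thesis
  proof (rule that[of "\<lambda>x\<in>{..<l}. c x - 1"])
    have "c x - 1 < k" if "x < l" for x using ck[OF that] c1[of x] by linarith
    then show "(\<lambda>x\<in>{..<l}. c x - 1) \<in> colourings k l"
      by (simp add: colourings_def)
    fix x y assume xy: "x < y" "y < l" "(\<lambda>x\<in>{..<l}. c x - 1) x = (\<lambda>x\<in>{..<l}. c x - 1) y"
    then have "c x - 1 = c y - 1" by simp
    then have "c x = c y" using c1[of x] c1[of y] by linarith
    then have "\<not> s y < s x" using step[of x y] xy by auto
    moreover have "s x \<noteq> s y"
      using assms xy permutes_inj[of s "{..<l}"] by (auto simp: avoiders_def dest: injD)
    ultimately show "s x < s y" by simp
  qed
qed

text \<open>
  Give each value the colour of its position. At the first place where a compatible \<open>t\<close> differs from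
  \<open>s\<close>, it uses a value of the same colour that \<open>s\<close> takes later, hence a greater one.
\<close>

lemma avoider_lex_least:
  assumes s: "s \<in> avoiders k l"
  obtains f g where "f \<in> colourings k l" "g \<in> colourings k l" "g \<circ> s = f"
    "\<And>t. t permutes {..<l} \<Longrightarrow> g \<circ> t = f \<Longrightarrow> t \<noteq> s \<Longrightarrow> lexless s t"
proof -
  have sp: "s permutes {..<l}" using s by (simp add: avoiders_def)
  obtain f where f: "f \<in> colourings k l" "\<And>x y. x < y \<Longrightarrow> y < l \<Longrightarrow> f x = f y \<Longrightarrow> s x < s y"
    using avoider_colouring[OF s] by blast
  show thesis
  proof (rule that[of f "f \<circ> inv s"])
    show "f \<circ> inv s \<in> colourings k l" using colourings_permute[OF permutes_inv[OF sp] f(1)] .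
    show "f \<circ> inv s \<circ> s = f" using permutes_inv_o(2)[OF sp] by (simp add: comp_assoc)
    fix t assume t: "t permutes {..<l}" "f \<circ> inv s \<circ> t = f" "t \<noteq> s"
    have ex: "\<exists>x. s x \<noteq> t x" using t(3) by (metis ext)
    define x where "x = (LEAST x. s x \<noteq> t x)"
    have x: "s x \<noteq> t x" unfolding x_def by (rule LeastI_ex[OF ex])
    have below: "s y = t y" if "y < x" for y using not_less_Least that unfolding x_def by blast
    define z where "z = inv s (t x)"
    have sz: "s z = t x" unfolding z_def using permutes_inverses(1)[OF sp] by simp
    have "x < l" using x permutes_not_in[OF sp, of x] permutes_not_in[OF t(1), of x] by force
    then have "z < l" using permutes_in_image[OF t(1), of x] permutes_in_image[OF sp, of z] sz by simp
    have "\<not> z < x" using below[of z] sz permutes_inj[OF t(1)] by (metis injD less_irrefl)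
    moreover have "z \<noteq> x" using sz x by auto
    ultimately have "x < z" by simp
    moreover have "f z = f x" using fun_cong[OF t(2), of x] by (simp add: z_def)
    ultimately have "s x < t x" using f(2)[of x z] \<open>z < l\<close> sz by simp
    then show "lexless s t" using below unfolding lexless_def by blast
  qed (rule f(1))
qed

text \<open>
  The hypothesis says that \<open>\<Sum>\<^sub>s c\<^sub>s e\<^sub>s\<close> is orthogonal to all \<open>e\<^sub>t\<close>, hence to itself, for the 0-1
  vectors \<open>e\<^sub>s = ([g \<circ> s = f])\<close> over pairs of colourings. So its entries \<open>q f g\<close> are all 0. Going
  down the lexicographic order, the entry at the colourings belonging to \<open>s\<close> involves \<open>c\<^sub>s\<close>
  and coefficients already known to vanish.
\<close>

lemma gram_independent:
  fixes c :: "(nat \<Rightarrow> nat) \<Rightarrow> complex"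
  assumes z: "\<And>t. t \<in> avoiders k l \<Longrightarrow>
      (\<Sum>s\<in>avoiders k l. c s * of_nat (card {g \<in> colourings k l. g \<circ> s = g \<circ> t})) = 0"
    and s: "s \<in> avoiders k l"
  shows "c s = 0"
proof -
  let ?A = "avoiders k l" and ?F = "colourings k l"
  define e where "e f g s = (if g \<circ> s = f then 1 else 0 :: complex)" for f g s :: "nat \<Rightarrow> nat"
  define q where "q f g = (\<Sum>s\<in>?A. c s * e f g s)" for f g
  have count: "of_nat (card {g \<in> ?F. g \<circ> s = g \<circ> t}) = (\<Sum>g\<in>?F. \<Sum>f\<in>?F. e f g s * e f g t)"
    if "t \<in> ?A" for s t
  proof -
    have "(\<Sum>f\<in>?F. e f g s * e f g t) = (if g \<circ> s = g \<circ> t then 1 else 0)" if g: "g \<in> ?F" for g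
    proof -
      have "(\<Sum>f\<in>?F. e f g s * e f g t) = (\<Sum>f\<in>?F. if f = g \<circ> t then (if g \<circ> s = g \<circ> t then 1 else 0) else 0)"
        by (intro sum.cong refl) (auto simp: e_def)
      then show ?thesis using colourings_permute[of t l g k] g \<open>t \<in> ?A\<close> by (simp add: avoiders_def)
    qed
    then have "(\<Sum>g\<in>?F. \<Sum>f\<in>?F. e f g s * e f g t) = (\<Sum>g\<in>?F. if g \<circ> s = g \<circ> t then 1 else 0)"
      by simp
    also have "\<dots> = of_nat (card {g \<in> ?F. g \<circ> s = g \<circ> t})"
      by (simp add: sum.If_cases Int_def)
    finally show ?thesis ..
  qed
  have "(\<Sum>g\<in>?F. \<Sum>f\<in>?F. q f g * cnj (q f g)) = 0"
  proof -
    have "(\<Sum>g\<in>?F. \<Sum>f\<in>?F. q f g * cnj (q f g))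
        = (\<Sum>g\<in>?F. \<Sum>f\<in>?F. \<Sum>t\<in>?A. \<Sum>s\<in>?A. cnj (c t) * (c s * (e f g s * e f g t)))"
    proof (intro sum.cong refl)
      fix f g
      have "cnj (q f g) = (\<Sum>t\<in>?A. cnj (c t) * e f g t)" 
      proof -
        have "cnj (e f g t) = e f g t" for t by (simp add: e_def)
        then show ?thesis by (simp add: q_def)
      qed
      then have "q f g * cnj (q f g) = (\<Sum>t\<in>?A. \<Sum>s\<in>?A. c s * e f g s * (cnj (c t) * e f g t))"
        unfolding q_def by (subst sum.swap) (simp add: sum_product)
      then show "q f g * cnj (q f g) = (\<Sum>t\<in>?A. \<Sum>s\<in>?A. cnj (c t) * (c s * (e f g s * e f g t)))"
        by (simp add: mult_ac)
    qed
    also have "\<dots> = (\<Sum>t\<in>?A. \<Sum>s\<in>?A. \<Sum>g\<in>?F. \<Sum>f\<in>?F. cnj (c t) * (c s * (e f g s * e f g t)))"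
    proof -
      have swap3: "(\<Sum>g\<in>?F. \<Sum>t\<in>?A. \<Sum>s\<in>?A. h g t s) = (\<Sum>t\<in>?A. \<Sum>s\<in>?A. \<Sum>g\<in>?F. h g t s)"
        for h :: "(nat \<Rightarrow> nat) \<Rightarrow> (nat \<Rightarrow> nat) \<Rightarrow> (nat \<Rightarrow> nat) \<Rightarrow> complex"
      proof -
        have "(\<Sum>g\<in>?F. \<Sum>t\<in>?A. \<Sum>s\<in>?A. h g t s) = (\<Sum>t\<in>?A. \<Sum>g\<in>?F. \<Sum>s\<in>?A. h g t s)"
          by (rule sum.swap)
        also have "\<dots> = (\<Sum>t\<in>?A. \<Sum>s\<in>?A. \<Sum>g\<in>?F. h g t s)"
          by (rule sum.cong[OF refl]) (rule sum.swap)
        finally show ?thesis .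
      qed
      show ?thesis unfolding swap3 ..
    qed
    also have "\<dots> = (\<Sum>t\<in>?A. cnj (c t) * (\<Sum>s\<in>?A. c s * of_nat (card {g \<in> ?F. g \<circ> s = g \<circ> t})))"
      by (intro sum.cong refl) (simp add: count sum_distrib_left)
    also have "\<dots> = 0" using z by simp
    finally show ?thesis .
  qed
  moreover have "(\<Sum>g\<in>?F. \<Sum>f\<in>?F. q f g * cnj (q f g)) = of_real (\<Sum>g\<in>?F. \<Sum>f\<in>?F. (cmod (q f g))\<^sup>2)"
    by (simp only: of_real_sum complex_norm_square)
  ultimately have "complex_of_real (\<Sum>g\<in>?F. \<Sum>f\<in>?F. (cmod (q f g))\<^sup>2) = 0" by (simp only:)
  then have "(\<Sum>g\<in>?F. \<Sum>f\<in>?F. (cmod (q f g))\<^sup>2) = 0" by (simp only: of_real_eq_0_iff)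
  then have "(\<Sum>f\<in>?F. (cmod (q f g))\<^sup>2) = 0" if "g \<in> ?F" for g
    using that by (subst (asm) sum_nonneg_eq_0_iff) (auto intro: sum_nonneg)
  then have q0: "q f g = 0" if "f \<in> ?F" "g \<in> ?F" for f g
    using that sum_nonneg_eq_0_iff[of ?F "\<lambda>f. (cmod (q f g))\<^sup>2"] by auto
  show ?thesis
    using wf_lexless(2)[OF finite_avoiders[of k l]] s
  proof (induction s rule: wf_induct_rule)
    case (less s)
    obtain f g where fg: "f \<in> ?F" "g \<in> ?F" "g \<circ> s = f"
      and least: "\<And>t. t permutes {..<l} \<Longrightarrow> g \<circ> t = f \<Longrightarrow> t \<noteq> s \<Longrightarrow> lexless s t"
      using avoider_lex_least[OF less.prems] by blast
    have "c t * e f g t = 0" if t: "t \<in> ?A" "t \<noteq> s" for t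
    proof (cases "g \<circ> t = f")
      case True
      have "t permutes {..<l}" using t(1) by (simp add: avoiders_def)
      then have "lexless s t" using least True t(2) by blast
      then have "c t = 0" by (intro less.IH) (use t less.prems in auto)
      then show ?thesis by simp
    qed (simp add: e_def)
    then have "(\<Sum>t\<in>?A - {s}. c t * e f g t) = 0" by (intro sum.neutral) blast
    then have "q f g = c s * e f g s"
      unfolding q_def sum.remove[OF finite_avoiders less.prems] by simp
    then show ?case using q0[OF fg(1,2)] fg(3) by (simp add: e_def)
  qed
qed

context vacuum_window
begin

section \<open>Pairing with the raising operators\<close>

fun raise_along :: "nat \<Rightarrow> (nat \<Rightarrow> nat) \<Rightarrow> 'v \<Rightarrow> 'v" where
  "raise_along 0 t w = w"
| "raise_along (Suc m) t w = raise_along m t (xmul m (t m) w)"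

lemma raise_along_linear:
  assumes "t permutes {..<l}" "m \<le> l"
  shows "raise_along m t (scale c w) = scale c (raise_along m t w)" "raise_along m t 0 = 0"
    "raise_along m t (\<Sum>i\<in>I. g i) = (\<Sum>i\<in>I. raise_along m t (g i))"
proof -
  have "t i < l" if "i < l" for i using permutes_in_image[OF assms(1), of i] that by simp
  then show "raise_along m t (scale c w) = scale c (raise_along m t w)" "raise_along m t 0 = 0"
    "raise_along m t (\<Sum>i\<in>I. g i) = (\<Sum>i\<in>I. raise_along m t (g i))"
    using assms(2) by (induction m arbitrary: w g) (simp_all add: xmul_linear)
qed

lemma set_mset_index: "finite I \<Longrightarrow> set_mset (image_mset (\<lambda>i. (A i, B i)) (mset_set I)) = (\<lambda>i. (A i, B i)) ` I"
  by simp

text \<open>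
  Removing the last row \<open>m\<close> with \<open>x\<^sub>m\<^sub>,\<^sub>t\<^sub>(\<^sub>m\<^sub>)\<close> follows the decomposition \<open>s = transpose m b \<circ> p\<close>. If
  \<open>b = m\<close>, the factor \<open>y\<^sub>m\<^sub>,\<^sub>t\<^sub>(\<^sub>m\<^sub>)\<close> is there and contributes the central charge \<open>k\<close>. Otherwise
  the commutator with the factor in row \<open>m\<close> is a column operation, which rewires the factor in
  column \<open>t m\<close> and turns \<open>s\<close> into \<open>p\<close> at the price of a sign. This is the recursion satisfied by
  the number of fixed colourings.
\<close>

lemma raise_along_yprod:
  assumes t: "t permutes {..<l}"
  shows "m \<le> l \<Longrightarrow> s permutes {..<m} \<Longrightarrow> raise_along m t (yprod {..<m} id (t \<circ> s)) =
    scale (of_int (sign s) * of_nat (card {g \<in> colourings k m. g \<circ> s = g})) vac"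
proof (induction m arbitrary: s)
  case 0
  then have "s = id" by simp
  then show ?case by (simp add: colourings_def sign_id)
next
  case (Suc m)
  have tl: "t i < l \<longleftrightarrow> i < l" for i using permutes_in_image[OF t, of i] by simp
  have tinj: "t i = t j \<longleftrightarrow> i = j" for i j using permutes_inj[OF t] by (metis injD)
  have "s \<in> {p. p permutes insert m {..<m}}" using Suc.prems(2) by (simp add: lessThan_Suc)
  then obtain b p where sp: "s = transpose m b \<circ> p" and b: "b \<in> insert m {..<m}" and p: "p permutes {..<m}"
    unfolding permutes_insert by auto
  have pl: "p i < m \<longleftrightarrow> i < m" for i using permutes_in_image[OF p, of i] by simp
  have pm: "p m = m" using p by (auto intro: permutes_not_in)
  have ml: "m < l" "t m < l" using Suc.prems(1) tl by auto
  have ml': "m \<le> l" using ml by simp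
  have IH: "raise_along m t (yprod {..<m} id (t \<circ> p)) =
    scale (of_int (sign p) * of_nat (card {g \<in> colourings k m. g \<circ> p = g})) vac"
    by (rule Suc.IH[OF ml' p])
  have Ysuc: "yprod {..<Suc m} id (t \<circ> s) = ymul (m, t (s m)) (yprod {..<m} id (t \<circ> s))"
    by (simp add: lessThan_Suc yprod_insert)
  have s_le: "s i \<le> m" if "i \<le> m" for i
    using permutes_in_image[OF Suc.prems(2), of i] that by simp
  let ?M = "image_mset (\<lambda>i. (id i, (t \<circ> s) i)) (mset_set {..<m})"
  have M: "yprod {..<m} id (t \<circ> s) = ymonomial ?M" "valid ?M" "m \<notin> fst ` set_mset ?M"
  proof -
    have ts: "t (s i) < l" if "i < m" for i using tl[of "s i"] s_le[of i] that ml by simp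
    show "yprod {..<m} id (t \<circ> s) = ymonomial ?M" by (rule yprod_def)
    show "valid ?M" using ts ml by (auto simp: valid_def)
    show "m \<notin> fst ` set_mset ?M" by auto
  qed
  have x0: "xmul m (t m) (yprod {..<m} id (t \<circ> s)) = 0"
    using M ml by (simp add: xmul_ymonomial_zero)
  show ?case
  proof (cases "b = m")
    case True
    then have s: "s = p" using sp by simp
    have "t m \<notin> snd ` set_mset ?M" using tinj pl s by (force simp: s)
    then have d: "act (loop_unit (n - 1 - t m) (n - 1 - t m) 0 - loop_unit m m 0) (ymonomial ?M) = 0"
      by (intro diag_ymonomial M ml)
    have "s m = m" using s pm by simp
    then have "xmul m (t m) (yprod {..<Suc m} id (t \<circ> s)) = scale (of_nat k) (yprod {..<m} id (t \<circ> s))"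
      unfolding Ysuc using x0 by (simp only: xmul_ymul_same[OF ml] M(1) d central_ymonomial[OF M(2)] ymul_linear add_0)
    then have "raise_along (Suc m) t (yprod {..<Suc m} id (t \<circ> s)) = scale (of_nat k) (raise_along m t (yprod {..<m} id (t \<circ> s)))"
      by (simp only: raise_along.simps raise_along_linear[OF t ml'])
    then have "raise_along (Suc m) t (yprod {..<Suc m} id (t \<circ> s)) = scale (of_nat k)
      (scale (of_int (sign p) * of_nat (card {g \<in> colourings k m. g \<circ> p = g})) vac)"
      unfolding s IH .
    then show ?thesis
      unfolding s card_fixed_Suc[OF p, of k] by (simp only: scale_scale of_nat_mult mult_ac)
  next
    case False
    then have bm: "b < m" using b by simp
    define i where "i = inv p b"
    have pi: "p i = b" unfolding i_def using permutes_inverses(1)[OF p] .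
    have i: "i < m" using pl[of i] pi bm by simp
    have si: "s i = m" and sm: "s m = b" unfolding sp comp_apply pi pm by simp_all
    have sj: "s j = p j" if "j \<in> {..<m} - {i}" for j
    proof -
      have "p j \<noteq> b" using that pi permutes_inj[OF p] by (auto dest: injD)
      moreover have "p j \<noteq> m" using pl[of j] that by auto
      ultimately show ?thesis using sp by (simp add: transpose_def)
    qed
    let ?I = "{..<m} - {i}"
    let ?Z = "yprod ?I id (t \<circ> s)"
    have ins: "insert i ?I = {..<m}" using i by auto
    have split: "yprod {..<m} id B = ymul (i, B i) (yprod ?I id B)" for B
      using yprod_insert[of ?I i id B] ins by simp
    have Z: "?Z = yprod ?I id (t \<circ> p)" using sj by (intro yprod_cong) auto
    have tb: "t b < l" "t m \<noteq> t b" using bm ml tl tinj by auto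
    have colZ: "col_op (t b) (t m) ?Z = 0"
      unfolding yprod_def
    proof (rule col_op_ymonomial_zero)
      show "t m \<notin> snd ` set_mset (image_mset (\<lambda>i. (id i, (t \<circ> s) i)) (mset_set ?I))"
      proof
        assume "t m \<in> snd ` set_mset (image_mset (\<lambda>i. (id i, (t \<circ> s) i)) (mset_set ?I))"
        then have "t m \<in> (\<lambda>j. t (s j)) ` ?I"
          unfolding set_mset_index[OF finite_Diff[OF finite_lessThan]] image_image by (simp only: snd_conv comp_apply)
        then obtain j where j: "j \<in> ?I" "t m = t (s j)" by blast
        from j(2) have "m = s j" by (simp only: tinj)
        then have "m = p j" unfolding sj[OF j(1)] .
        moreover have "p j < m" using pl j(1) by blast
        ultimately show False by (simp only: less_irrefl)
      qed
    qed (use ml tb in auto)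
    have "xmul m (t m) (yprod {..<Suc m} id (t \<circ> s)) = col_op (t b) (t m) (yprod {..<m} id (t \<circ> s))"
      unfolding Ysuc using ml tb x0 sm by (simp add: xmul_ymul_row ymul_linear)
    also have "\<dots> = - ymul (i, t b) ?Z"
      unfolding split using ml tb colZ si by (simp add: col_op_ymul ymul_linear)
    also have "\<dots> = - yprod {..<m} id (t \<circ> p)"
      unfolding split[of "t \<circ> p"] Z using pi by simp
    also have "\<dots> = scale (- 1) (yprod {..<m} id (t \<circ> p))" by simp
    finally have x: "xmul m (t m) (yprod {..<Suc m} id (t \<circ> s)) = scale (- 1) (yprod {..<m} id (t \<circ> p))" .
    have "permutation p" unfolding permutation_permutes using p finite_lessThan by blast
    then have "sign s = sign (transpose m b) * sign p"
      unfolding sp by (rule sign_compose[OF permutation_swap_id])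
    then have sgn: "sign s = - sign p" using bm by (simp add: sign_swap_id)
    have fixed: "card {g \<in> colourings k (Suc m). g \<circ> s = g} = card {g \<in> colourings k m. g \<circ> p = g}"
      unfolding sp by (rule card_fixed_transpose[OF p bm])
    have "raise_along (Suc m) t (yprod {..<Suc m} id (t \<circ> s)) = scale (- 1) (raise_along m t (yprod {..<m} id (t \<circ> p)))"
      by (simp only: raise_along.simps raise_along_linear[OF t ml'] x)
    then show ?thesis
      by (simp only: IH fixed sgn scale_scale of_int_minus mult_minus_left mult_1)
  qed
qed

lemma raise_along_yprod_pairing:
  assumes s: "s permutes {..<l}" and t: "t permutes {..<l}"
  shows "raise_along l t (yprod {..<l} id s) =
    scale (of_int (sign t * sign s) * of_nat (card {g \<in> colourings k l. g \<circ> s = g \<circ> t})) vac"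
proof -
  have "t \<circ> (inv t \<circ> s) = s" using permutes_inv_o(1)[OF t] by (simp flip: comp_assoc)
  moreover have "inv t \<circ> s permutes {..<l}" by (rule permutes_compose[OF s permutes_inv[OF t]])
  moreover have "sign (inv t \<circ> s) = sign t * sign s"
    using s t permutation_permutes finite_lessThan permutation_inverse
    by (metis sign_compose sign_inverse)
  ultimately show ?thesis using raise_along_yprod[OF t order_refl, of "inv t \<circ> s"] card_fixed_quotient[OF s t] by simp
qed

lemma yprod_avoiders_independent:
  assumes "(\<Sum>s\<in>avoiders k l. scale (c s) (yprod {..<l} id s)) = 0" and s: "s \<in> avoiders k l"
  shows "c s = 0"
proof -
  have perm: "u permutes {..<l}" if "u \<in> avoiders k l" for u using that by (simp add: avoiders_def)
  have "c s * of_int (sign s) = 0"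
  proof (rule gram_independent[where c = "\<lambda>s. c s * of_int (sign s)", OF _ s])
    fix t assume "t \<in> avoiders k l"
    then have t: "t permutes {..<l}" by (rule perm)
    note lin = t order_refl
    have "0 = raise_along l t (\<Sum>s\<in>avoiders k l. scale (c s) (yprod {..<l} id s))"
      unfolding assms(1) using raise_along_linear(2)[OF lin] by simp
    also have "\<dots> = (\<Sum>s\<in>avoiders k l. scale (c s) (raise_along l t (yprod {..<l} id s)))"
      by (simp add: raise_along_linear[OF lin])
    also have "\<dots> = (\<Sum>s\<in>avoiders k l. scale (of_int (sign t) *
       (c s * of_int (sign s) * of_nat (card {g \<in> colourings k l. g \<circ> s = g \<circ> t}))) vac)"
      using raise_along_yprod_pairing[OF perm t] by (intro sum.cong refl) (simp add: mult_ac)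
    also have "\<dots> = scale (of_int (sign t) * (\<Sum>s\<in>avoiders k l. 
       (c s * of_int (sign s) * of_nat (card {g \<in> colourings k l. g \<circ> s = g \<circ> t})))) vac"
      by (simp add: scale_sum_left sum_distrib_left)
    finally have calculation: "0 = scale (of_int (sign t) * (\<Sum>s\<in>avoiders k l. 
       (c s * of_int (sign s) * of_nat (card {g \<in> colourings k l. g \<circ> s = g \<circ> t})))) vac" .
    show "(\<Sum>s\<in>avoiders k l. c s * of_int (sign s) * of_nat (card {g \<in> colourings k l. g \<circ> s = g \<circ> t})) = 0"
    proof -
      have "of_int (sign t) \<noteq> (0 :: complex)" by (simp add: sign_def)
      then show ?thesis using calculation vac_nonzero by simp
    qed
  qed
  then show ?thesis by (auto simp: sign_def split: if_splits)
qed

lemma fold_ymul_sum: "fold_mset ymul (\<Sum>i\<in>I. g i) M = (\<Sum>i\<in>I. fold_mset ymul (g i) M)"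
  by (induction M) (simp_all add: ymul_sum)

lemma fold_ymul_zero: "fold_mset ymul 0 M = 0"
  by (induction M) (simp_all add: ymul_linear)

text \<open>
  The factors outside \<open>P\<close> are common to all terms, so the sum is a product of \<open>y\<close>'s applied to
  a vanishing permanent.
\<close>

lemma straightening:
  assumes s: "s permutes {..<l}" and P: "P \<subseteq> {..<l}" "card P = Suc k"
  shows "(\<Sum>p | p permutes P. yprod {..<l} id (s \<circ> p)) = 0"
proof -
  have fP: "finite P" using P finite_subset by blast
  let ?R = "image_mset (\<lambda>i. (i, s i)) (mset_set ({..<l} - P))"
  have "yprod {..<l} id (s \<circ> p) = fold_mset ymul (yprod P id (s \<circ> p)) ?R" if p: "p permutes P" for p
  proof -
    have "mset_set {..<l} = mset_set P + mset_set ({..<l} - P)"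
      using P fP by (subst mset_set_Union[symmetric]) (auto simp: Un_absorb1)
    moreover have "image_mset (\<lambda>i. (id i, (s \<circ> p) i)) (mset_set ({..<l} - P)) = ?R"
      by (intro image_mset_cong) (use permutes_not_in[OF p] in auto)
    ultimately show ?thesis by (simp add: yprod_def flip: ymonomial_union)
  qed
  then have "(\<Sum>p | p permutes P. yprod {..<l} id (s \<circ> p)) = fold_mset ymul (permanent P id s) ?R"
    by (simp add: permanent_def fold_ymul_sum)
  also have "permanent P id s = 0"
    using P fP permutes_in_image[OF s] by (intro permanent_zero) auto
  finally show ?thesis unfolding fold_ymul_zero .
qed

lemma yprod_in_span_avoiders:
  assumes "s permutes {..<l}"
  shows "yprod {..<l} id s \<in> span (yprod {..<l} id ` avoiders k l)"
  using wf_lexless(1)[OF finite_permutations[OF finite_lessThan[of l]]] assms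
proof (induction s rule: wf_induct_rule)
  case (less s)
  show ?case
  proof (cases "s \<in> avoiders k l")
    case True
    then show ?thesis by (intro span_base) auto
  next
    case False
    then obtain P where P: "P \<subseteq> {..<l}" "card P = Suc k" "decreasing_on s P"
      using less.prems by (auto simp: avoiders_def)
    have fin: "finite {p. p permutes P}" using P finite_subset by (intro finite_permutations) blast
    have "yprod {..<l} id (s \<circ> p) \<in> span (yprod {..<l} id ` avoiders k l)" if p: "p permutes P" "p \<noteq> id" for p
    proof (rule less.IH)
      have "s \<circ> p permutes {..<l}" using permutes_compose[OF permutes_subset[OF p(1) P(1)] less.prems] .
      then show "s \<circ> p permutes {..<l}" "(s \<circ> p, s) \<in> {(s, t). (s, t) \<in> {p. p permutes {..<l}} \<times> {p. p permutes {..<l}} \<and> lexless s t}"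
        using lexless_rearrange_decreasing[OF less.prems P(1,3) p] less.prems by auto
    qed
    then have "(\<Sum>p\<in>{p. p permutes P} - {id}. yprod {..<l} id (s \<circ> p)) \<in> span (yprod {..<l} id ` avoiders k l)"
      by (intro span_sum) auto
    moreover have "yprod {..<l} id s = - (\<Sum>p\<in>{p. p permutes P} - {id}. yprod {..<l} id (s \<circ> p))"
    proof -
      have "yprod {..<l} id (s \<circ> id) + (\<Sum>p\<in>{p. p permutes P} - {id}. yprod {..<l} id (s \<circ> p)) = 0"
        using straightening[OF less.prems P(1,2)] fin
        by (subst (asm) sum.remove[of _ id]) (auto simp: permutes_id)
      then show ?thesis by (simp add: eq_neg_iff_add_eq_0)
    qed
    ultimately show ?thesis by (simp only: span_neg)
  qed
qed

end

section \<open>The weight space of \<open>k\<Lambda>\<^sub>0 - \<gamma>\<^sub>l\<close>\<close>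

text \<open>
  The coefficient of \<open>\<alpha>\<^sub>i\<close> in \<open>\<gamma>\<^sub>l\<close>. The two nontrivial cases exclude each other for \<open>2l \<le> n\<close>.
\<close>

definition gamma_coeff :: "nat \<Rightarrow> nat \<Rightarrow> nat \<Rightarrow> nat" where
  "gamma_coeff n l i = (if i < l then l - i else if n < i + l then l - (n - i) else 0)"

lemma gamma_root_coeff:
  assumes "1 \<le> l" "2 * l \<le> n"
  shows "gamma_root n l h = (\<Sum>i<n. of_nat (gamma_coeff n l i) * simple_root n i h)"
proof -
  let ?r = "\<lambda>i. simple_root n i h"
  have "(\<Sum>i<n. of_nat (gamma_coeff n l i) * ?r i) =
      (\<Sum>i\<in>insert 0 {1..<l} \<union> (\<lambda>i. n - i) ` {1..<l}. of_nat (gamma_coeff n l i) * ?r i)"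
  proof (rule sum.mono_neutral_right)
    show "\<forall>i\<in>{..<n} - (insert 0 {1..<l} \<union> (\<lambda>i. n - i) ` {1..<l}). of_nat (gamma_coeff n l i) * ?r i = 0"
    proof
      fix i assume i: "i \<in> {..<n} - (insert 0 {1..<l} \<union> (\<lambda>i. n - i) ` {1..<l})"
      then have "\<not> i < l" by auto
      moreover have "\<not> n < i + l"
      proof
        assume "n < i + l"
        then have "n - i \<in> {1..<l}" "i = n - (n - i)" using i by auto
        then show False using i by blast
      qed
      ultimately show "of_nat (gamma_coeff n l i) * ?r i = 0" by (simp add: gamma_coeff_def)
    qed
  qed (use assms in auto)
  also have "\<dots> = (\<Sum>i\<in>insert 0 {1..<l}. of_nat (gamma_coeff n l i) * ?r i)
      + (\<Sum>i\<in>(\<lambda>i. n - i) ` {1..<l}. of_nat (gamma_coeff n l i) * ?r i)"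
    by (rule sum.union_disjoint) (use assms in auto)
  also have "(\<Sum>i\<in>(\<lambda>i. n - i) ` {1..<l}. of_nat (gamma_coeff n l i) * ?r i) =
      (\<Sum>i = 1..<l. of_nat (gamma_coeff n l (n - i)) * ?r (n - i))"
    by (subst sum.reindex) (use assms in \<open>auto simp: inj_on_def\<close>)
  also have "\<dots> = (\<Sum>i = 1..<l. of_nat (l - i) * ?r (n - i))"
    using assms by (intro sum.cong refl) (auto simp: gamma_coeff_def)
  also have "(\<Sum>i\<in>insert 0 {1..<l}. of_nat (gamma_coeff n l i) * ?r i) = of_nat l * ?r 0 + (\<Sum>i = 1..<l. of_nat (l - i) * ?r i)"
    using assms by (simp add: gamma_coeff_def)
  finally show ?thesis by (simp add: gamma_root_def)
qed

text \<open>
  The factor \<open>y\<^sub>a\<^sub>b\<close> lowers the weight by the sum of the simple roots at the nodes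
  \<open>n - b, \<dots>, n - 1, 0, 1, \<dots>, a\<close>. So this is the coefficient of \<open>\<alpha>\<^sub>i\<close> in the sum of the roots of
  all factors.
\<close>

definition content :: "nat \<Rightarrow> (nat \<times> nat) multiset \<Rightarrow> nat \<Rightarrow> nat" where
  "content n M i = size (filter_mset (\<lambda>p. i \<le> fst p \<or> n \<le> i + snd p) M)"

lemma mset_eq_graph:
  assumes "finite A" "image_mset fst M = mset_set A"
  shows "\<exists>g. M = image_mset (\<lambda>a. (a, g a)) (mset_set A)"
  using assms
proof (induction A arbitrary: M)
  case empty
  then show ?case by simp
next
  case (insert x A)
  have "x \<in># image_mset fst M" unfolding insert.prems using insert.hyps by simp
  then obtain y where y: "(x, y) \<in># M" by (auto simp: in_image_mset)
  define N where "N = M - {#(x, y)#}"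
  have M: "M = add_mset (x, y) N" using y by (simp add: N_def)
  then have "image_mset fst N = mset_set A" using insert.prems insert.hyps(1,2) by simp
  then obtain g where g: "N = image_mset (\<lambda>a. (a, g a)) (mset_set A)" using insert.IH by blast
  have "image_mset (\<lambda>a. (a, (g(x := y)) a)) (mset_set A) = image_mset (\<lambda>a. (a, g a)) (mset_set A)"
    using insert.hyps by (intro image_mset_cong) auto
  then have "M = image_mset (\<lambda>a. (a, (g(x := y)) a)) (mset_set (insert x A))"
    using insert.hyps M g by simp
  then show ?case by (rule exI[where x = "g(x := y)"])
qed

lemma mset_from_tails:
  assumes lt: "\<And>x. x \<in># N \<Longrightarrow> x < l" and sz: "\<And>i. i < l \<Longrightarrow> size (filter_mset (\<lambda>x. i \<le> x) N) = l - i"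
  shows "N = mset_set {..<l}"
proof (rule multiset_eqI)
  fix i
  show "count N i = count (mset_set {..<l}) i"
  proof (cases "i < l")
    case True
    have "filter_mset (\<lambda>x. i \<le> x) N = filter_mset (\<lambda>x. x = i) N + filter_mset (\<lambda>x. Suc i \<le> x) N"
      by (rule multiset_eqI) auto
    then have "size (filter_mset (\<lambda>x. i \<le> x) N) = count N i + size (filter_mset (\<lambda>x. Suc i \<le> x) N)"
      by (simp only: size_union filter_eq_replicate_mset size_replicate_mset)
    moreover have "size (filter_mset (\<lambda>x. Suc i \<le> x) N) = l - Suc i"
    proof (cases "Suc i < l")
      case False
      have "filter_mset (\<lambda>x. Suc i \<le> x) N = filter_mset (\<lambda>x. False) N"
        by (intro filter_mset_cong refl) (use lt False in force)
      then show ?thesis using False by simp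
    qed (rule sz)
    ultimately have "count N i = 1" using sz[OF True] True by simp
    then show ?thesis using True by simp
  next
    case False
    then have "i \<notin># N" using lt by blast
    then show ?thesis using False by (simp add: not_in_iff)
  qed
qed

context affine_module
begin

text \<open>
  Weights add under commutators. As \<open>y\<^sub>a\<^sub>+\<^sub>1\<^sub>,\<^sub>b = [f\<^sub>a\<^sub>+\<^sub>1, y\<^sub>a\<^sub>b]\<close>, and similarly for columns, this yields
  the weights of all \<open>y\<^sub>a\<^sub>b\<close> from those of the Chevalley generators.
\<close>

lemma weight_commutator:
  assumes h: "h \<in> affine_sl n" and lin: "\<And>v w. y (v - w) = y v - y w" "\<And>c w. y (scale c w) = scale c (y w)"
    "\<And>v w. r (v - w) = r v - r w" "\<And>c w. r (scale c w) = scale c (r w)"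
    and R: "\<And>w. act h (r w) = r (act h w) - scale a (r w)"
    and y: "\<And>w. act h (y w) = y (act h w) - scale b (y w)"
  shows "act h (r (y w) - y (r w)) = (r (y (act h w)) - y (r (act h w))) - scale (a + b) (r (y w) - y (r w))"
  by (simp add: act_diff_right[OF h] R y lin scale_left_distrib scale_right_diff_distrib)

end

context vacuum_window
begin

lemma cartan_ymul:
  assumes h: "h \<in> cartan n"
  shows "a < l \<Longrightarrow> b < l \<Longrightarrow> act h (ymul (a, b) w) = ymul (a, b) (act h w)
    - scale ((\<Sum>i\<le>a. simple_root n i h) + (\<Sum>i = 1..b. simple_root n (n - i) h)) (ymul (a, b) w)"
proof (induction b arbitrary: w)
  case 0
  then show ?case
  proof (induction a arbitrary: w)
    case 0
    then show ?case
      using commute_cartan_f[OF rank _ h, of 0 w] rank by (simp add: ymul_eq chevalley_f_def)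
  next
    case (Suc a)
    have r: "row_op (Suc a) a = act (chevalley_f n (Suc a))" by (simp add: row_op_def chevalley_f_def)
    have an: "Suc a < n" using Suc.prems window by simp
    have y: "ymul (Suc a, 0) w = row_op (Suc a) a (ymul (a, 0) w) - ymul (a, 0) (row_op (Suc a) a w)" for w
      using Suc.prems by (simp add: row_op_ymul)
    show ?case
      unfolding y
    proof (subst weight_commutator[where a = "simple_root n (Suc a) h" and b = "\<Sum>i\<le>a. simple_root n i h"])
      show "act h (row_op (Suc a) a w) = row_op (Suc a) a (act h w) - scale (simple_root n (Suc a) h) (row_op (Suc a) a w)" for w
        unfolding r by (rule commute_cartan_f[OF rank an h])
      show "act h (ymul (a, 0) w) = ymul (a, 0) (act h w) - scale (\<Sum>i\<le>a. simple_root n i h) (ymul (a, 0) w)" for w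
        using Suc by simp
    qed (use h cartan_subset[OF rank] an rank in \<open>auto simp: ymul_linear r act_diff_right act_scale_right add.commute\<close>)
  qed
next
  case (Suc b)
  let ?j = "n - Suc b"
  have j: "?j < n" "?j \<noteq> 0" using Suc.prems window_le by auto
  have r: "col_op (Suc b) b = act (chevalley_f n ?j)"
    using j by (simp add: col_op_def chevalley_f_def)
  have y: "ymul (a, Suc b) w = - (col_op (Suc b) b (ymul (a, b) w) - ymul (a, b) (col_op (Suc b) b w))" for w
    using Suc.prems by (simp add: col_op_ymul)
  have hs: "h \<in> affine_sl n" using h cartan_subset[OF rank] by auto
  have comm: "act h (col_op (Suc b) b (ymul (a, b) w) - ymul (a, b) (col_op (Suc b) b w)) =
      (col_op (Suc b) b (ymul (a, b) (act h w)) - ymul (a, b) (col_op (Suc b) b (act h w)))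
      - scale (simple_root n ?j h + ((\<Sum>i\<le>a. simple_root n i h) + (\<Sum>i = 1..b. simple_root n (n - i) h)))
        (col_op (Suc b) b (ymul (a, b) w) - ymul (a, b) (col_op (Suc b) b w))"
  proof (rule weight_commutator[OF hs])
    show "act h (col_op (Suc b) b w) = col_op (Suc b) b (act h w) - scale (simple_root n ?j h) (col_op (Suc b) b w)" for w
      unfolding r by (rule commute_cartan_f[OF rank j(1) h])
    show "act h (ymul (a, b) w) = ymul (a, b) (act h w)
        - scale ((\<Sum>i\<le>a. simple_root n i h) + (\<Sum>i = 1..b. simple_root n (n - i) h)) (ymul (a, b) w)" for w
      using Suc by simp
  qed (use j rank in \<open>simp_all add: ymul_linear r act_diff_right act_scale_right\<close>)
  have sc: "(\<Sum>i\<le>a. simple_root n i h) + (\<Sum>i = 1..Suc b. simple_root n (n - i) h) =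
      simple_root n ?j h + ((\<Sum>i\<le>a. simple_root n i h) + (\<Sum>i = 1..b. simple_root n (n - i) h))"
    by simp
  show ?case
    unfolding y act_minus_right[OF hs] comm sc by (simp only: scale_minus_right minus_diff_minus)
qed

lemma root_content:
  assumes "a < l" "b < l"
  shows "(\<Sum>i\<le>a. simple_root n i h) + (\<Sum>i = 1..b. simple_root n (n - i) h) =
    (\<Sum>i<n. (if i \<le> a \<or> n \<le> i + b then 1 else 0) * simple_root n i h)"
proof -
  let ?r = "\<lambda>i. simple_root n i h"
  have "(\<Sum>i = 1..b. ?r (n - i)) = (\<Sum>i\<in>(\<lambda>i. n - i) ` {1..b}. ?r i)"
    by (subst sum.reindex) (use assms window_le in \<open>auto simp: inj_on_def\<close>)
  also have "(\<lambda>i. n - i) ` {1..b} = {n - b..<n}"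
  proof
    show "{n - b..<n} \<subseteq> (\<lambda>i. n - i) ` {1..b}"
    proof
      fix i assume "i \<in> {n - b..<n}"
      then have "n - i \<in> {1..b}" "i = n - (n - i)" by auto
      then show "i \<in> (\<lambda>i. n - i) ` {1..b}" by blast
    qed
  qed (use assms window_le in auto)
  finally have "(\<Sum>i\<le>a. ?r i) + (\<Sum>i = 1..b. ?r (n - i)) = (\<Sum>i\<in>{..a} \<union> {n - b..<n}. ?r i)"
    by (subst sum.union_disjoint) (use assms window_le in auto)
  also have "{..a} \<union> {n - b..<n} = {i \<in> {..<n}. i \<le> a \<or> n \<le> i + b}"
    using assms window_le by auto
  also have "(\<Sum>i\<in>{i \<in> {..<n}. i \<le> a \<or> n \<le> i + b}. ?r i) = (\<Sum>i<n. if i \<le> a \<or> n \<le> i + b then ?r i else 0)"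
    by (rule sum.inter_filter) simp
  also have "\<dots> = (\<Sum>i<n. (if i \<le> a \<or> n \<le> i + b then 1 else 0) * ?r i)"
    by (intro sum.cong) auto
  finally show ?thesis .
qed

lemma cartan_ymonomial:
  assumes h: "h \<in> cartan n"
  shows "valid M \<Longrightarrow> act h (ymonomial M) = scale (of_nat k * fundamental_weight n 0 h -
    (\<Sum>i<n. of_nat (content n M i) * simple_root n i h)) (ymonomial M)"
proof (induction M)
  case empty
  then show ?case using h by (simp add: cartan_vac content_def)
next
  case (add p M)
  obtain a b where p: "p = (a, b)" by (metis surj_pair)
  have ab: "a < l" "b < l" and v: "valid M" using add.prems p by (auto simp: valid_def)
  have "act h (ymonomial (add_mset p M)) = scale (of_nat k * fundamental_weight n 0 h -
     (\<Sum>i<n. of_nat (content n M i) * simple_root n i h)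
     - (\<Sum>i<n. (if i \<le> a \<or> n \<le> i + b then 1 else 0) * simple_root n i h)) (ymonomial (add_mset p M))"
    using cartan_ymul[OF h ab, of "ymonomial M"] add.IH[OF v]
    by (simp only: p ymonomial_simps ymul_linear root_content[OF ab] scale_left_diff_distrib)
  moreover have "(\<Sum>i<n. of_nat (content n (add_mset p M) i) * simple_root n i h) =
    (\<Sum>i<n. of_nat (content n M i) * simple_root n i h)
     + (\<Sum>i<n. (if i \<le> a \<or> n \<le> i + b then 1 else 0) * simple_root n i h)"
    unfolding sum.distrib[symmetric] by (intro sum.cong refl) (simp add: content_def p algebra_simps)
  ultimately show ?case by (simp only: diff_diff_eq)
qed

lemma ymonomial_weight: "valid M \<Longrightarrow> ymonomial M \<in> weight_space (\<lambda>h. of_nat k * fundamental_weight n 0 h -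
    (\<Sum>i<n. of_nat (content n M i) * simple_root n i h))"
  unfolding weight_space_def by (intro CollectI ballI) (rule cartan_ymonomial)

definition Yspan :: "'v set" where
  "Yspan = span (ymonomial ` {M. valid M})"

lemma subspace_Yspan: "subspace Yspan"
  unfolding Yspan_def by (rule subspace_span)

lemma Yspan_ymul: "w \<in> Yspan \<Longrightarrow> a < l \<Longrightarrow> b < l \<Longrightarrow> ymul (a, b) w \<in> Yspan"
  unfolding Yspan_def
proof (induction rule: span_induct_alt)
  case base
  then show ?case by (simp add: ymul_linear span_zero)
next
  case (step c s w)
  then obtain M where M: "valid M" "s = ymonomial M" by auto
  have "ymul (a, b) s \<in> ymonomial ` {M. valid M}"
    using M step.prems by (intro image_eqI[of _ _ "add_mset (a, b) M"]) (auto simp: valid_def)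
  then show ?case using step by (simp add: ymul_linear span_add span_scale span_base)
qed

lemma row_op_Yspan:
  assumes "a < l" "a' < l" "a \<noteq> a'"
  shows "valid M \<Longrightarrow> row_op a' a (ymonomial M) \<in> Yspan"
proof (induction M)
  case empty
  then show ?case using assms window by (simp add: row_op_def const_vac Yspan_def span_zero)
next
  case (add p M)
  obtain c d where p: "p = (c, d)" by (metis surj_pair)
  have v: "valid M" "c < l" "d < l" using add.prems p by (auto simp: valid_def)
  have YM: "ymonomial M \<in> Yspan" unfolding Yspan_def using v(1) by (intro span_base) blast
  have e: "row_op a' a (ymonomial (add_mset p M)) = ymul (c, d) (row_op a' a (ymonomial M)) + (if c = a then ymul (a', d) (ymonomial M) else 0)"
    unfolding ymonomial_simps p row_op_ymul[OF assms] by simp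
  have "(if c = a then ymul (a', d) (ymonomial M) else 0) \<in> Yspan"
    using Yspan_ymul[OF YM] v assms subspace_0[OF subspace_Yspan] by simp
  then show ?case
    unfolding e by (intro subspace_add[OF subspace_Yspan] Yspan_ymul add.IH v)
qed

lemma col_op_Yspan:
  assumes "b < l" "b' < l" "b \<noteq> b'"
  shows "valid M \<Longrightarrow> col_op b' b (ymonomial M) \<in> Yspan"
proof (induction M)
  case empty
  then show ?case using assms window by (simp add: col_op_def const_vac Yspan_def span_zero)
next
  case (add p M)
  obtain c d where p: "p = (c, d)" by (metis surj_pair)
  have v: "valid M" "c < l" "d < l" using add.prems p by (auto simp: valid_def)
  have YM: "ymonomial M \<in> Yspan" unfolding Yspan_def using v(1) by (intro span_base) blast
  have e: "col_op b' b (ymonomial (add_mset p M)) = ymul (c, d) (col_op b' b (ymonomial M)) - (if d = b then ymul (c, b') (ymonomial M) else 0)"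
    unfolding ymonomial_simps p col_op_ymul[OF assms] by simp
  have "(if d = b then ymul (c, b') (ymonomial M) else 0) \<in> Yspan"
    using Yspan_ymul[OF YM] v assms subspace_0[OF subspace_Yspan] by simp
  then show ?case
    unfolding e by (intro subspace_diff[OF subspace_Yspan] Yspan_ymul add.IH v)
qed

text \<open>
  The \<open>f\<^sub>i\<close> at the nodes near 0 are \<open>y\<^sub>0\<^sub>0\<close> and Levi operators, and both preserve the span of the
  monomials in the \<open>y\<^sub>a\<^sub>b\<close>.
\<close>

lemma lowering_Yspan:
  "set is \<subseteq> {i. i < l \<or> n < i + l \<and> i < n} \<Longrightarrow> lowering is \<in> Yspan"
proof (induction "is")
  case Nil
  have "vac \<in> ymonomial ` {M. valid M}" by (intro image_eqI[of _ _ "{#}"]) (auto simp: valid_def)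
  then show ?case by (simp add: Yspan_def span_base)
next
  case (Cons i "is")
  have w: "lowering is \<in> Yspan" and i: "i < l \<or> n < i + l \<and> i < n" using Cons by auto
  have inn: "i < n" using i window_le by auto
  show ?case
  proof (cases "i = 0")
    case True
    have "act (chevalley_f n 0) u = ymul (0, 0) u" for u
      using window_pos by (simp add: ymul_def chevalley_f_def)
    then show ?thesis using Yspan_ymul[OF w, of 0 0] window_pos True by simp
  next
    case False
    have step: "act (chevalley_f n i) (ymonomial M) \<in> Yspan" if M: "valid M" for M
    proof (cases "i < l")
      case True
      have "row_op i (i - 1) (ymonomial M) \<in> Yspan" using True False by (intro row_op_Yspan M) simp_all
      then show ?thesis using False by (simp add: row_op_def chevalley_f_def)
    next
      case c: False
      define b where "b = n - 1 - i"
      have b: "b < l" "Suc b < l" "n - 1 - b = i" "n - 1 - Suc b = i - 1"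
        using c i unfolding b_def by linarith+
      have "col_op (Suc b) b = act (chevalley_f n i)"
        unfolding col_op_def chevalley_f_def b using False by simp
      moreover have "col_op (Suc b) b (ymonomial M) \<in> Yspan" using b by (intro col_op_Yspan M) simp_all
      ultimately show ?thesis by simp
    qed
    show ?thesis
      unfolding lowering_simps Yspan_def
    proof (rule act_span_mono)
      show "chevalley_f n i \<in> affine_sl n" using inn rank by simp
      show "lowering is \<in> span (ymonomial ` {M. valid M})" using w unfolding Yspan_def .
      show "act (chevalley_f n i) u \<in> span (ymonomial ` {M. valid M})" if "u \<in> ymonomial ` {M. valid M}" for u
        using that step unfolding Yspan_def by blast
    qed
  qed
qed

lemma content_permutation:
  assumes "s permutes {..<l}" "i < n"
  shows "content n (image_mset (\<lambda>a. (a, s a)) (mset_set {..<l})) i = gamma_coeff n l i"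
proof -
  have sl: "s a < l \<longleftrightarrow> a < l" for a using permutes_in_image[OF assms(1), of a] by simp
  have "content n (image_mset (\<lambda>a. (a, s a)) (mset_set {..<l})) i = card {a \<in> {..<l}. i \<le> a \<or> n \<le> i + s a}"
    unfolding content_def filter_mset_image_mset size_image_mset fst_conv snd_conv
    by (simp add: filter_mset_mset_set)
  also have "\<dots> = gamma_coeff n l i"
  proof (cases "i < l")
    case True
    then have "{a \<in> {..<l}. i \<le> a \<or> n \<le> i + s a} = {i..<l}"
    proof (intro set_eqI)
      fix a show "a \<in> {a \<in> {..<l}. i \<le> a \<or> n \<le> i + s a} \<longleftrightarrow> a \<in> {i..<l}"
        using sl[of a] True window_le by auto
    qed
    then show ?thesis using True by (simp add: gamma_coeff_def)
  next
    case False
    then have "card {a \<in> {..<l}. i \<le> a \<or> n \<le> i + s a} = card {a \<in> {..<l}. n - i \<le> s a}"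
      by (intro arg_cong[of _ _ card]) auto
    also have "\<dots> = card (s ` {a \<in> {..<l}. n - i \<le> s a})"
      using permutes_inj_on[OF assms(1)] by (intro card_image[symmetric])
    also have "s ` {a \<in> {..<l}. n - i \<le> s a} = {n - i..<l}"
    proof
      show "{n - i..<l} \<subseteq> s ` {a \<in> {..<l}. n - i \<le> s a}"
      proof
        fix b assume b: "b \<in> {n - i..<l}"
        define a where "a = inv s b"
        have a: "s a = b" unfolding a_def by (rule permutes_inverses(1)[OF assms(1)])
        then have "a < l" using b sl[of a] by simp
        then show "b \<in> s ` {a \<in> {..<l}. n - i \<le> s a}"
          using a b by (intro image_eqI[of _ _ a]) simp_all
      qed
      show "s ` {a \<in> {..<l}. n - i \<le> s a} \<subseteq> {n - i..<l}"
      proof (rule image_subsetI)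
        fix a assume "a \<in> {a \<in> {..<l}. n - i \<le> s a}"
        then show "s a \<in> {n - i..<l}" using sl[of a] by simp
      qed
    qed
    finally have "card {a \<in> {..<l}. i \<le> a \<or> n \<le> i + s a} = l - (n - i)" by simp
    then show ?thesis unfolding gamma_coeff_def using False assms(2) by simp
  qed
  finally show ?thesis .
qed

text \<open>
  The content determines how many row indices are at least \<open>i\<close>, and likewise for columns. The
  coefficients of \<open>\<gamma>\<^sub>l\<close> force every row and every column to occur exactly once.
\<close>

lemma permutation_of_content:
  assumes v: "valid M" and c: "\<And>i. i < n \<Longrightarrow> content n M i = gamma_coeff n l i"
  obtains s where "s permutes {..<l}" "ymonomial M = yprod {..<l} id s"
proof -
  have p: "fst p < l" "snd p < l" if "p \<in># M" for p using v that by (auto simp: valid_def)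
  have fst: "image_mset fst M = mset_set {..<l}"
  proof (rule mset_from_tails)
    show "size (filter_mset (\<lambda>x. i \<le> x) (image_mset fst M)) = l - i" if "i < l" for i
    proof -
      have "filter_mset (\<lambda>q. i \<le> fst q) M = filter_mset (\<lambda>q. i \<le> fst q \<or> n \<le> i + snd q) M"
      proof (intro filter_mset_cong refl)
        fix q assume "q \<in># M"
        from p[OF this] that window_le show "i \<le> fst q \<longleftrightarrow> i \<le> fst q \<or> n \<le> i + snd q" by linarith
      qed
      then show ?thesis using c[of i] that window by (simp add: content_def gamma_coeff_def filter_mset_image_mset)
    qed
  qed (use p in auto)
  have snd: "image_mset snd M = mset_set {..<l}"
  proof (rule mset_from_tails)
    show "size (filter_mset (\<lambda>x. j \<le> x) (image_mset snd M)) = l - j" if "j < l" for j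
    proof (cases "j = 0")
      case True
      have "size M = l" using arg_cong[OF fst, of size] by simp
      then show ?thesis using True by simp
    next
      case False
      have "filter_mset (\<lambda>q. j \<le> snd q) M = filter_mset (\<lambda>q. n - j \<le> fst q \<or> n \<le> n - j + snd q) M"
      proof (intro filter_mset_cong refl)
        fix q assume "q \<in># M"
        from p[OF this] that window_le show "j \<le> snd q \<longleftrightarrow> n - j \<le> fst q \<or> n \<le> n - j + snd q" by linarith
      qed
      moreover have "gamma_coeff n l (n - j) = l - j"
      proof -
        have "\<not> n - j < l" "n < n - j + l" "n - (n - j) = j" using that False window_le by linarith+
        then show ?thesis unfolding gamma_coeff_def by (simp only: if_True if_False)
      qed
      moreover have "n - j < n" using that False window_le by linarith
      ultimately show ?thesis using c[of "n - j"]
        by (simp only: content_def filter_mset_image_mset size_image_mset)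
    qed
  qed (use p in auto)
  obtain g where g: "M = image_mset (\<lambda>a. (a, g a)) (mset_set {..<l})"
    using mset_eq_graph[OF _ fst] by auto
  have gm: "image_mset g (mset_set {..<l}) = mset_set {..<l}"
    using snd unfolding g by (simp add: multiset.map_comp comp_def)
  have img: "g ` {..<l} = {..<l}"
    using arg_cong[OF gm, of set_mset] by simp
  have bij: "bij_betw g {..<l} {..<l}"
    using img eq_card_imp_inj_on[of "{..<l}" g] by (simp add: bij_betw_def)
  define s where "s a = (if a < l then g a else a)" for a
  have "s permutes {..<l}"
  proof (rule bij_imp_permutes)
    show "bij_betw s {..<l} {..<l}" using bij by (rule bij_betw_cong[THEN iffD1, rotated]) (simp add: s_def)
  qed (simp add: s_def)
  moreover have "ymonomial M = yprod {..<l} id s"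
    unfolding g yprod_def by (intro arg_cong[of _ _ ymonomial] image_mset_cong) (simp add: s_def)
  ultimately show thesis by (rule that)
qed

text \<open>
  The weight space is spanned by the words in the \<open>f\<^sub>i\<close> of the right weight. By the independence of
  the simple roots, such a word only uses nodes in the support of \<open>\<gamma>\<^sub>l\<close>, so it lies in the span of
  the monomials in the \<open>y\<^sub>a\<^sub>b\<close>. Comparing weights once more leaves the monomials of permutations.
\<close>

lemma weight_space_span:
  "weight_space (\<lambda>h. of_nat k * fundamental_weight n 0 h - gamma_root n l h) =
    span (yprod {..<l} id ` {s. s permutes {..<l}})" (is "weight_space ?mu = span ?T")
proof
  let ?L = "\<lambda>h. of_nat k * fundamental_weight n 0 h"
  have gam: "gamma_root n l h = (\<Sum>i<n. of_nat (gamma_coeff n l i) * simple_root n i h)" for h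
    by (rule gamma_root_coeff[OF window_pos window_le])
  have eq: "c i = gamma_coeff n l i"
    if eq: "\<And>h. h \<in> cartan n \<Longrightarrow> ?L h - (\<Sum>i<n. of_nat (c i) * simple_root n i h) = ?mu h" and i: "i < n" for c i
  proof -
    have "(of_nat (c i) - of_nat (gamma_coeff n l i) :: complex) = 0"
    proof (rule simple_roots_independent[OF rank _ i])
      show "(\<Sum>i<n. (of_nat (c i) - of_nat (gamma_coeff n l i)) * simple_root n i h) = 0" if "h \<in> cartan n" for h
        using eq[OF that] by (simp add: gam left_diff_distrib sum_subtractf)
    qed
    then show ?thesis by simp
  qed
  show "span ?T \<subseteq> weight_space ?mu"
  proof (rule span_minimal)
    show "subspace (weight_space ?mu)"
    proof (rule subspaceI)
      have hs: "h \<in> affine_sl n" if "h \<in> cartan n" for h using that cartan_subset[OF rank] by auto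
      show "0 \<in> weight_space ?mu" by (simp add: weight_space_def act_zero_right hs)
      show "x + y \<in> weight_space ?mu" if "x \<in> weight_space ?mu" "y \<in> weight_space ?mu" for x y
        using that by (simp add: weight_space_def act_add_right hs scale_right_distrib)
      show "scale c x \<in> weight_space ?mu" if "x \<in> weight_space ?mu" for c x
        using that by (simp add: weight_space_def act_scale_right hs mult.commute)
    qed
    show "?T \<subseteq> weight_space ?mu"
    proof
      fix w assume "w \<in> ?T"
      then obtain s where s: "s permutes {..<l}" and w: "w = yprod {..<l} id s" by blast
      let ?M = "image_mset (\<lambda>a. (a, s a)) (mset_set {..<l})"
      have "valid ?M" using permutes_in_image[OF s] by (auto simp: valid_def)
      from ymonomial_weight[OF this] have "ymonomial ?M \<in> weight_space (\<lambda>h. ?L h - (\<Sum>i<n. of_nat (content n ?M i) * simple_root n i h))" .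
      moreover have "(\<Sum>i<n. of_nat (content n ?M i) * simple_root n i h) = gamma_root n l h" for h
        unfolding gam by (intro sum.cong refl) (simp only: content_permutation[OF s] lessThan_iff)
      moreover have "w = ymonomial ?M" by (simp add: w yprod_def)
      ultimately show "w \<in> weight_space ?mu" by (simp only:)
    qed
  qed
  show "weight_space ?mu \<subseteq> span ?T"
  proof
    fix w assume w: "w \<in> weight_space ?mu"
    let ?J = "{js. set js \<subseteq> {..<n}}"
    have "w \<in> span (lowering ` {js \<in> ?J. \<forall>h\<in>cartan n. ?L h - (\<Sum>i\<leftarrow>js. simple_root n i h) = ?mu h})"
      by (rule weight_component[OF rank _ _ w]) (simp_all only: lowering_weight mem_Collect_eq lowering_span UNIV_I)
    moreover have "lowering ` {js \<in> ?J. \<forall>h\<in>cartan n. ?L h - (\<Sum>i\<leftarrow>js. simple_root n i h) = ?mu h} \<subseteq> Yspan"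
    proof (intro image_subsetI lowering_Yspan subsetI)
      fix js i assume js: "js \<in> {js \<in> ?J. \<forall>h\<in>cartan n. ?L h - (\<Sum>i\<leftarrow>js. simple_root n i h) = ?mu h}" and i: "i \<in> set js"
      have "i < n" using js i by auto
      then have "count_list js i = gamma_coeff n l i"
      proof (rule eq[rotated])
        show "?L h - (\<Sum>i<n. of_nat (count_list js i) * simple_root n i h) = ?mu h" if "h \<in> cartan n" for h
        proof -
          have "?L h - (\<Sum>i\<leftarrow>js. simple_root n i h) = ?mu h" using js that by blast
          moreover have "set js \<subseteq> {..<n}" using js by blast
          ultimately show ?thesis by (simp only: sum_list_simple_root)
        qed
      qed
      moreover have "count_list js i \<noteq> 0" using i by (simp add: count_list_0_iff)
      ultimately have "gamma_coeff n l i \<noteq> 0" by simp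
      then show "i \<in> {i. i < l \<or> n < i + l \<and> i < n}"
        using \<open>i < n\<close> by (auto simp: gamma_coeff_def split: if_splits)
    qed
    ultimately have "w \<in> Yspan"
      using span_minimal[of _ Yspan] subspace_span unfolding Yspan_def by blast
    then have "w \<in> span (ymonomial ` {M \<in> {M. valid M}. \<forall>h\<in>cartan n. ?L h - (\<Sum>i<n. of_nat (content n M i) * simple_root n i h) = ?mu h})"
      unfolding Yspan_def by (intro weight_component[OF rank _ _ w]) (simp_all only: ymonomial_weight mem_Collect_eq)
    moreover have "ymonomial ` {M \<in> {M. valid M}. \<forall>h\<in>cartan n. ?L h - (\<Sum>i<n. of_nat (content n M i) * simple_root n i h) = ?mu h} \<subseteq> ?T"
    proof (intro image_subsetI)
      fix M assume M: "M \<in> {M \<in> {M. valid M}. \<forall>h\<in>cartan n. ?L h - (\<Sum>i<n. of_nat (content n M i) * simple_root n i h) = ?mu h}"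
      then have v: "valid M" by blast
      have "content n M i = gamma_coeff n l i" if "i < n" for i
        using M that by (intro eq) blast+
      then obtain s where "s permutes {..<l}" "ymonomial M = yprod {..<l} id s"
        using permutation_of_content[OF v] by blast
      then show "ymonomial M \<in> ?T" by blast
    qed
    ultimately show "w \<in> span ?T" using span_mono by blast
  qed
qed

lemma dim_weight_space:
  "dim (weight_space (\<lambda>h. of_nat k * fundamental_weight n 0 h - gamma_root n l h)) = card (avoiders k l)"
proof -
  let ?B = "yprod {..<l} id ` avoiders k l"
  have sub: "avoiders k l \<subseteq> {s. s permutes {..<l}}" by (auto simp: avoiders_def)
  have inj: "inj_on (yprod {..<l} id) (avoiders k l)"
  proof (rule inj_onI, rule ccontr)
    fix s t assume st: "s \<in> avoiders k l" "t \<in> avoiders k l" "yprod {..<l} id s = yprod {..<l} id t" "s \<noteq> t"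
    \<comment> \<open>Two equal vectors would satisfy the nontrivial relation \<open>Y\<^sub>s - Y\<^sub>t = 0\<close>.\<close>
    let ?c = "\<lambda>u. if u = s then 1 else if u = t then - 1 else (0 :: complex)"
    have "(\<Sum>u\<in>avoiders k l. scale (?c u) (yprod {..<l} id u)) = (\<Sum>u\<in>{s, t}. scale (?c u) (yprod {..<l} id u))"
      by (rule sum.mono_neutral_right) (use st finite_avoiders in auto)
    also have "\<dots> = 0" using st by simp
    finally show False using yprod_avoiders_independent[of ?c s] st by simp
  qed
  have ind: "independent ?B"
  proof (rule independent_if_scalars_zero)
    show "finite ?B" using finite_avoiders by simp
    fix f w assume z: "(\<Sum>x\<in>?B. scale (f x) x) = 0" and w: "w \<in> ?B"
    have "(\<Sum>u\<in>avoiders k l. scale (f (yprod {..<l} id u)) (yprod {..<l} id u)) = 0"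
      using z unfolding sum.reindex[OF inj] comp_def .
    then show "f w = 0" using yprod_avoiders_independent[of "\<lambda>u. f (yprod {..<l} id u)"] w by blast
  qed
  have sp: "span (yprod {..<l} id ` {s. s permutes {..<l}}) = span ?B"
  proof
    show "span (yprod {..<l} id ` {s. s permutes {..<l}}) \<subseteq> span ?B"
      by (intro span_minimal subspace_span) (use yprod_in_span_avoiders in blast)
    show "span ?B \<subseteq> span (yprod {..<l} id ` {s. s permutes {..<l}})"
      by (intro span_mono image_mono sub)
  qed
  have "dim (span ?B) = card ?B" using dim_span_eq_card_independent[OF ind] .
  then show ?thesis unfolding weight_space_span sp card_image[OF inj] .
qed

end

section \<open>One-line notation and the multiplicity\<close>

lemma one_line_avoids_iff:
  "(\<exists>u. subseq u (map (\<lambda>a. Suc (s a)) [0..<l]) \<and> length u = k + 1 \<and> sorted_wrt (>) u)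
    \<longleftrightarrow> (\<exists>P\<subseteq>{..<l}. card P = Suc k \<and> decreasing_on s P)" (is "?L \<longleftrightarrow> ?R")
proof
  assume ?L
  then obtain u N where u: "u = nths (map (\<lambda>a. Suc (s a)) [0..<l]) N" "length u = k + 1" "sorted_wrt (>) u"
    unfolding subseq_conv_nths by blast
  define xs where "xs = nths [0..<l] N"
  have um: "u = map (\<lambda>a. Suc (s a)) xs" by (simp only: u(1) xs_def nths_map)
  have d: "distinct xs" unfolding xs_def by (rule distinct_nthsI) simp
  have inc: "sorted_wrt (<) xs"
    unfolding strict_sorted_iff using d sorted_nths[of "[0..<l]" N] by (simp add: xs_def)
  have "set xs \<subseteq> {..<l}" unfolding xs_def using set_nths_subset[of "[0..<l]" N] by auto
  moreover have "card (set xs) = Suc k" using distinct_card[OF d] u(2) um by simp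
  moreover have "decreasing_on s (set xs)"
    unfolding decreasing_on_def
  proof (intro ballI impI)
    fix x y assume "x \<in> set xs" "y \<in> set xs" "x < y"
    then obtain i j where ij: "i < length xs" "x = xs ! i" "j < length xs" "y = xs ! j"
      by (metis in_set_conv_nth)
    have "\<not> j < i" "j \<noteq> i" using sorted_wrt_nth_less[OF inc, of j i] ij \<open>x < y\<close> by auto
    then have "i < j" by simp
    then have "u ! j < u ! i" using sorted_wrt_nth_less[OF u(3), of i j] ij um by simp
    then show "s y < s x" using ij um by simp
  qed
  ultimately show ?R by blast
next
  assume ?R
  then obtain P where P: "P \<subseteq> {..<l}" "card P = Suc k" "decreasing_on s P" by blast
  define xs where "xs = filter (\<lambda>x. x \<in> P) [0..<l]"
  have set: "set xs = P" using P(1) by (auto simp: xs_def)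
  have d: "distinct xs" by (simp add: xs_def)
  have inc: "sorted_wrt (<) xs" unfolding xs_def by (intro sorted_wrt_filter) simp
  show ?L
  proof (intro exI conjI)
    show "subseq (map (\<lambda>a. Suc (s a)) xs) (map (\<lambda>a. Suc (s a)) [0..<l])"
      unfolding xs_def by (intro subseq_map subseq_filter_left)
    show "length (map (\<lambda>a. Suc (s a)) xs) = k + 1"
      using distinct_card[OF d] P(2) set by simp
    show "sorted_wrt (>) (map (\<lambda>a. Suc (s a)) xs)"
      unfolding sorted_wrt_map
      by (rule sorted_wrt_mono_rel[OF _ inc]) (use P(3) set in \<open>auto simp: decreasing_on_def\<close>)
  qed
qed

lemma one_line_permutations:
  "bij_betw (\<lambda>s. map (\<lambda>a. Suc (s a)) [0..<l]) {s. s permutes {..<l}} (permutations_of_set {1..l})"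
proof (rule bij_betw_imageI)
  show "inj_on (\<lambda>s. map (\<lambda>a. Suc (s a)) [0..<l]) {s. s permutes {..<l}}"
  proof (rule inj_onI)
    fix s t assume st: "s \<in> {s. s permutes {..<l}}" "t \<in> {s. s permutes {..<l}}"
      "map (\<lambda>a. Suc (s a)) [0..<l] = map (\<lambda>a. Suc (t a)) [0..<l]"
    show "s = t"
    proof
      fix a
      show "s a = t a"
      proof (cases "a < l")
        case True
        then show ?thesis using st(3) by simp
      next
        case False
        then show ?thesis using st(1,2) permutes_not_in[of s "{..<l}" a] permutes_not_in[of t "{..<l}" a] by simp
      qed
    qed
  qed
  show "(\<lambda>s. map (\<lambda>a. Suc (s a)) [0..<l]) ` {s. s permutes {..<l}} = permutations_of_set {1..l}"
  proof (intro equalityI subsetI)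
    fix w assume "w \<in> (\<lambda>s. map (\<lambda>a. Suc (s a)) [0..<l]) ` {s. s permutes {..<l}}"
    then obtain s where s: "s permutes {..<l}" and w: "w = map (\<lambda>a. Suc (s a)) [0..<l]" by blast
    have "(\<lambda>a. Suc (s a)) ` {..<l} = Suc ` (s ` {..<l})" by (simp add: image_image)
    also have "\<dots> = {1..l}"
      unfolding permutes_image[OF s] by (simp add: lessThan_atLeast0 image_Suc_atLeastLessThan atLeastLessThanSuc_atLeastAtMost)
    finally have "set w = {1..l}" by (simp add: w atLeast0LessThan)
    moreover have "distinct w"
      unfolding w distinct_map using permutes_inj_on[OF s] by (auto simp: inj_on_def)
    ultimately show "w \<in> permutations_of_set {1..l}" by (simp add: permutations_of_set_def)
  next
    fix w assume "w \<in> permutations_of_set {1..l}"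
    then have w: "set w = {1..l}" "distinct w" by (auto simp: permutations_of_set_def)
    have len: "length w = l" using distinct_card[OF w(2)] w(1) by simp
    define s where "s a = (if a < l then w ! a - 1 else a)" for a
    have nth: "w ! a \<in> {1..l}" if "a < l" for a using nth_mem[of a w] that len w(1) by simp
    have Suc_s: "Suc (s a) = w ! a" if "a < l" for a using nth[OF that] that by (simp add: s_def)
    have "bij_betw s {..<l} {..<l}"
    proof -
      have "inj_on s {..<l}"
      proof (rule inj_onI)
        fix a b assume ab: "a \<in> {..<l}" "b \<in> {..<l}" "s a = s b"
        then have "w ! a = w ! b" using Suc_s[of a] Suc_s[of b] by simp
        then show "a = b" using nth_eq_iff_index_eq[OF w(2)] ab len by simp
      qed
      moreover have "s ` {..<l} \<subseteq> {..<l}"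
      proof (rule image_subsetI)
        fix a assume "a \<in> {..<l}"
        then show "s a \<in> {..<l}" using nth[of a] Suc_s[of a] by simp
      qed
      ultimately show ?thesis by (simp add: bij_betw_def endo_inj_surj)
    qed
    then have "s permutes {..<l}" by (rule bij_imp_permutes) (simp add: s_def)
    moreover have "w = map (\<lambda>a. Suc (s a)) [0..<l]"
      by (rule nth_equalityI) (simp_all add: len Suc_s)
    ultimately show "w \<in> (\<lambda>s. map (\<lambda>a. Suc (s a)) [0..<l]) ` {s. s permutes {..<l}}" by blast
  qed
qed

lemma card_avoiding_permutations: "card (avoiding_permutations k l) = card (avoiders k l)"
proof -
  let ?f = "\<lambda>s. map (\<lambda>a. Suc (s a)) [0..<l]"
  have img: "?f ` {s. s permutes {..<l}} = permutations_of_set {1..l}" and inj: "inj_on ?f {s. s permutes {..<l}}"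
    using one_line_permutations[of l] by (auto simp: bij_betw_def)
  have "avoiding_permutations k l = ?f ` avoiders k l"
  proof (intro equalityI subsetI)
    fix w assume w: "w \<in> avoiding_permutations k l"
    then have "w \<in> ?f ` {s. s permutes {..<l}}" unfolding img by (simp add: avoiding_permutations_def)
    then obtain s where s: "s permutes {..<l}" "w = ?f s" by blast
    have "\<not> (\<exists>u. subseq u w \<and> length u = k + 1 \<and> sorted_wrt (>) u)"
      using w unfolding avoiding_permutations_def by blast
    then have "s \<in> avoiders k l" using s(1) unfolding s(2) one_line_avoids_iff avoiders_def by blast
    then show "w \<in> ?f ` avoiders k l" using s(2) by blast
  next
    fix w assume "w \<in> ?f ` avoiders k l"
    then obtain s where s: "s \<in> avoiders k l" "w = ?f s" by blast
    then have "s permutes {..<l}" and av: "\<not> (\<exists>P\<subseteq>{..<l}. card P = Suc k \<and> decreasing_on s P)"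
      unfolding avoiders_def by blast+
    then have "w \<in> permutations_of_set {1..l}" using img s(2) by blast
    moreover have "\<not> (\<exists>u. subseq u w \<and> length u = k + 1 \<and> sorted_wrt (>) u)"
      using av unfolding s(2) one_line_avoids_iff .
    ultimately show "w \<in> avoiding_permutations k l" unfolding avoiding_permutations_def by blast
  qed
  moreover have "inj_on ?f (avoiders k l)" by (rule inj_on_subset[OF inj]) (auto simp: avoiders_def)
  ultimately show ?thesis by (simp only: card_image)
qed

theorem corollary3p3:
  fixes n k l :: nat
    and scale :: "complex \<Rightarrow> 'v::ab_group_add \<Rightarrow> 'v"
    and act :: "affine \<Rightarrow> 'v \<Rightarrow> 'v"
  assumes "2 \<le> n" and "2 \<le> k" and "1 \<le> l" and "l \<le> n div 2"
    and "is_irreducible_highest_weight_module n (\<lambda>h. of_nat k * fundamental_weight n 0 h) scale act"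
  shows "affine_module.multiplicity scale n act
           (\<lambda>h. of_nat k * fundamental_weight n 0 h - gamma_root n l h)
         = card (avoiding_permutations k l)"
proof -
  let ?L = "\<lambda>h. of_nat k * fundamental_weight n 0 h"
  have M: "affine_module scale n act"
    and irr: "affine_module.irreducible_module scale n act"
    and hw: "affine_module.highest_weight_module scale n act ?L"
    using assms(5) unfolding is_irreducible_highest_weight_module_def by blast+
  interpret M: affine_module scale n act by (rule M)
  obtain v where v: "v \<noteq> 0" "\<forall>x\<in>n_plus n. act x v = 0" "\<forall>h\<in>cartan n. act h v = scale (?L h) v"
    "\<forall>W. M.submodule W \<and> v \<in> W \<longrightarrow> W = UNIV"
    using hw unfolding M.highest_weight_module_def by blast
  interpret W: vacuum_window scale n act k v l
  proof unfold_locales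
    show "2 \<le> n" by (rule assms(1))
    show "W = {0} \<or> W = UNIV" if "M.submodule W" for W
      using irr that unfolding M.irreducible_module_def by blast
    show "v \<noteq> 0" by (rule v(1))
    show "act (chevalley_e n i) v = 0" if "i < n" for i
      using v(2) n_plus.generator[OF that] by blast
    show "act h v = scale (?L h) v" if "h \<in> cartan n" for h
      using v(3) that by blast
    show "W = UNIV" if "M.submodule W" "v \<in> W" for W
      using v(4) that by blast
    show "1 \<le> l" by (rule assms(3))
    show "2 * l \<le> n" using assms(4) by linarith
  qed
  show ?thesis
    unfolding M.multiplicity_def card_avoiding_permutations by (rule W.dim_weight_space)
qed

end
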